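(* Let $q,z,a,b,c,h$ be non-zero complex numbers with $|q|<1$, $|z|<1$, let $\sigma\in(0,\infty)$, $w=\mathrm e^{i\psi}$, and suppose $h\sqrt{\frac c{bz}}\notin\{q^k:k\in\mathbb Z\}$. Assume there are no vanishing denominator factors and that the denominator factors in the integrand have maximum modulus less than unity, i.e. $\big|\sigma\sqrt{\frac c{bz}}\big|$, $\big|\sigma\sqrt{\frac{bz}c}\big|$ and $|\gamma|/\sigma$ are $<1$ for each $\gamma\in\big\{a\sqrt{\frac{bz}c},\sqrt{\frac{cz}b},\pm\sqrt{az},\pm\sqrt{qaz}\big\}$. Then $$\int_{-\pi}^{\pi}\frac{\left(\big(h\sqrt{\frac c{bz}},\frac qh\sqrt{\frac{bz}c}\big)\frac\sigma w,\ \big(h\sqrt{\frac c{bz}},\frac qh\sqrt{\frac{bz}c},\sqrt{bcz},a\sqrt{\frac{cz}b},qa\sqrt{\frac z{bc}},a\sqrt{\frac{bz^3}c}\big)\frac w\sigma;q\right)_\infty}{\left(\big(\sqrt{\frac c{bz}},\sqrt{\frac{bz}c}\big)\frac\sigma w,\ \big(a\sqrt{\frac{bz}c},\sqrt{\frac{cz}b},\pm\sqrt{az},\pm\sqrt{qaz}\big)\frac w\sigma;q\right)_\infty}\,\mathrm d\psi$$ $$=\frac{2\pi\,\vartheta(h,h\frac c{bz};q)\,(z,c,\frac{qa}b;q)_\infty}{(q,a,\frac cb,\frac{abz}c;q)_\infty}\;{}_2\phi_1\!\left(a,b;c;q,z\right)\,{}_2\phi_1\!\left(a,\tfrac{qa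}c;\tfrac{qa}b;q,z\right).$$
   Context: Notation. $(a;q)_k=\prod_{j=0}^{k-1}(1-aq^j)$, $(a;q)_\infty=\prod_{j\ge0}(1-aq^j)$, $(a_1,\dots,a_r;q)_k=\prod_j(a_j;q)_k$ for $k\in\mathbb N_0\cup\{\infty\}$. In a list, $\pm x$ stands for the two entries $x,-x$, and $(x_1,\dots,x_k)t$ stands for the entries $x_1t,\dots,x_kt$. $\vartheta(x;q)=(x,q/x;q)_\infty$ for $x\ne0$, $\vartheta(x_1,\dots,x_k;q)=\prod_j\vartheta(x_j;q)$. ${}_2\phi_1(a,b;c;q,z)=\sum_{k\ge0}\frac{(a,b;q)_k}{(q,c;q)_k}z^k$ for $|z|<1$. Square roots are chosen consistently: fix square roots of $q,a,b,c,z$ and define all square roots of monomials multiplicatively from these. Convention "no vanishing denominator factors": every infinite $q$-shifted factorial appearing in a denominator is non-zero, and no denominator parameter of any series lies in $\{q^{-k}:k\in\mathbb N_0\}$. *)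

theory Defs
  imports "HOL-Analysis.Analysis"
begin

definition qpoch :: "complex \<Rightarrow> complex \<Rightarrow> nat \<Rightarrow> complex" where
  "qpoch a q k = (\<Prod>j<k. 1 - a * q ^ j)"

text \<open>The library's infinite product is also meaningful when some factors vanish; its value
  is then 0.\<close>
definition qpoch_inf :: "complex \<Rightarrow> complex \<Rightarrow> complex" where
  "qpoch_inf a q = (\<Prod>j. 1 - a * q ^ j)"

definition qpochs_inf :: "complex list \<Rightarrow> complex \<Rightarrow> complex" where
  "qpochs_inf as q = (\<Prod>a\<leftarrow>as. qpoch_inf a q)"

text \<open>The list \<open>(x\<^sub>1,\<dots>,x\<^sub>k)t\<close> of the entries \<open>x\<^sub>1t,\<dots>,x\<^sub>kt\<close>.\<close>
definition scale_list :: "complex list \<Rightarrow> complex \<Rightarrow> complex list" where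
  "scale_list xs t = map (\<lambda>x. x * t) xs"

definition qtheta :: "complex \<Rightarrow> complex \<Rightarrow> complex" where
  "qtheta x q = qpochs_inf [x, q / x] q"

definition qthetas :: "complex list \<Rightarrow> complex \<Rightarrow> complex" where
  "qthetas xs q = (\<Prod>x\<leftarrow>xs. qtheta x q)"

text \<open>Intended for \<open>\<bar>q\<bar> < 1\<close>, \<open>\<bar>z\<bar> < 1\<close> and \<open>c\<close> not of the form \<open>q\<^bsup>-k\<^esup>\<close>.\<close>
definition phi21 ::
  "complex \<Rightarrow> complex \<Rightarrow> complex \<Rightarrow> complex \<Rightarrow> complex \<Rightarrow> complex" where
  "phi21 a b c q z =
     (\<Sum>k. (qpoch a q k * qpoch b q k) / (qpoch q q k * qpoch c q k) * z ^ k)"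

end

theory Submission
  imports Defs
begin

text \<open>
Write \<open>(x)\<close> for \<open>(x;q)\<^sub>\<infinity>\<close> and put \<open>y = bz/c\<close>, \<open>B = c/b\<close>, \<open>d = qa/b\<close>, \<open>\<alpha> = aB\<close> and
\<open>H = hc/(bz)\<close>, so that \<open>Hy = h\<close>, \<open>By = z\<close> and \<open>cd = q\<alpha>\<close>. In the variable \<open>s = w / (\<sigma>X)\<close> with
\<open>X = sc/(sb sz)\<close>, the integrand is

  \<open>(Hs)(q/(Hs))(h/s)(qs/h) / ((1/s)(y/s))  \<cdot>  (\<alpha>s)(\<alpha>ys)/(\<alpha>s\<^sup>2)  \<cdot>  (cs)(ds) / ((as)(Bs))\<close>:

the four factors with square roots and signs combine into \<open>(\<alpha>s\<^sup>2)\<close>. The bounds on the moduli say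
\<open>\<bar>s\<bar> > 1\<close>, \<open>\<bar>s\<bar> > \<bar>y\<bar>\<close>, \<open>\<bar>as\<bar> < 1\<close> and \<open>\<bar>Bs\<bar> < 1\<close>. Hence the first factor is an entire power series
in \<open>s\<close> times a convergent power series in \<open>1/s\<close>, and the other two are power series in \<open>s\<close>.

Averaging \<open>s\<^sup>n\<close> against the first factor gives \<open>\<theta>(h)\<theta>(H)/(q)\<close> times the Rogers--Szego polynomial
\<open>h\<^sub>n(y)\<close> (\<open>moment_rogers_szego\<close>, \<open>moment_0\<close>): the q-difference equations of the theta quotient become the
three-term recurrence of \<open>h\<^sub>n\<close>, and the constant is read off as \<open>n\<close> tends to infinity. So up to that
constant the integral is the value of the linear functional \<open>s\<^sup>n \<mapsto> h\<^sub>n(y)\<close> on the remaining factors.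

The functional is compatible with the middle factor: \<open>s\<^sup>n\<close> times the coefficient of \<open>\<alpha>\<^sup>r\<close> goes to a multiple
of the same \<open>h\<^sub>n(y)\<close>, with an explicit multiplier (\<open>kernel_fps_rec\<close> and \<open>kernel_moment_rec\<close>). Expanding
\<open>(cs)/(Bs)\<close> and \<open>(ds)/(as)\<close> by the q-binomial theorem leaves a triple series in the \<open>h\<^sub>n(y)\<close>. It factors into
two double series (\<open>rogers_szego_bilinear_sum\<close>), by the linearization of \<open>h\<^sub>ih\<^sub>j\<close> and a terminating
convolution (\<open>triple_convolution\<close>) into which the relation \<open>cd = q\<alpha>\<close> enters. Each double series is a
\<open>\<^sub>2\<phi>\<^sub>1\<close> (\<open>infsum_rs_phi_term\<close>); the first is the one wanted, and the second becomes so by Euler's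
transformation.
\<close>

section \<open>Shifted factorials\<close>

lemma qpoch_0 [simp]: "qpoch a q 0 = 1"
  by (simp add: qpoch_def)

lemma qpoch_Suc: "qpoch a q (Suc n) = qpoch a q n * (1 - a * q ^ n)"
  by (simp add: qpoch_def)

lemma qpoch_Suc_left: "qpoch a q (Suc n) = (1 - a) * qpoch (a * q) q n"
  unfolding qpoch_def prod.lessThan_Suc_shift by (simp add: mult.assoc)

lemma qpoch_add: "qpoch a q (m + n) = qpoch a q m * qpoch (a * q ^ m) q n"
  by (induction n) (simp_all add: qpoch_Suc power_add mult.assoc)

lemma qpoch_zero_param [simp]: "qpoch 0 q n = 1"
  by (simp add: qpoch_def)

lemma binomial_two_Suc: "Suc n * (Suc n - 1) div 2 = n * (n - 1) div 2 + n"
proof -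
  have "Suc n * (Suc n - 1) = n * (n - 1) + n * 2"
    by (cases n) (simp_all add: algebra_simps)
  hence "Suc n * (Suc n - 1) div 2 = (n * (n - 1) + n * 2) div 2" by (rule arg_cong)
  also have "\<dots> = n + n * (n - 1) div 2" by (rule div_mult_self1) simp
  finally show ?thesis by (simp only: add.commute)
qed

section \<open>Evaluating absolutely summable power series\<close>

text \<open>Absolute summability at a real radius, rather than a bound on the radius of
convergence, is the condition that survives Cauchy products on the circle of convergence itself
and that can be checked with geometric majorants.\<close>
definition fps_abs_summable :: "complex fps \<Rightarrow> real \<Rightarrow> bool" where
  "fps_abs_summable F r \<longleftrightarrow> summable (\<lambda>n. norm (fps_nth F n) * r ^ n)"

lemma fps_abs_summable_norm:
  "fps_abs_summable F (norm x) \<longleftrightarrow> summable (\<lambda>n. norm (fps_nth F n * x ^ n))"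
  by (simp add: fps_abs_summable_def norm_mult norm_power)

lemma fps_abs_summable_sums:
  "fps_abs_summable F (norm x) \<Longrightarrow> (\<lambda>n. fps_nth F n * x ^ n) sums eval_fps F x"
  unfolding fps_abs_summable_norm eval_fps_def by (rule summable_sums[OF summable_norm_cancel])

lemma norm_eval_fps_le:
  assumes "fps_abs_summable F r" "norm x = r"
  shows "norm (eval_fps F x) \<le> (\<Sum>n. norm (fps_nth F n) * r ^ n)"
proof -
  have "norm (eval_fps F x) \<le> (\<Sum>n. norm (fps_nth F n * x ^ n))"
    unfolding eval_fps_def
    by (rule summable_norm) (use assms fps_abs_summable_norm[of F x] in simp)
  thus ?thesis using assms(2) by (simp add: norm_mult norm_power)
qed

lemma fps_mult_nth_power:
  "(\<Sum>i\<le>n. (fps_nth F i * x ^ i) * (fps_nth G (n - i) * x ^ (n - i))) = fps_nth (F * G) n * x ^ n"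
  for x :: complex
proof -
  have "(\<Sum>i\<le>n. (fps_nth F i * x ^ i) * (fps_nth G (n - i) * x ^ (n - i)))
      = (\<Sum>i\<le>n. fps_nth F i * fps_nth G (n - i) * x ^ n)"
    by (intro sum.cong refl) (simp add: power_add [symmetric] mult_ac)
  thus ?thesis by (simp add: fps_mult_nth atLeast0AtMost sum_distrib_right)
qed

lemma fps_abs_summable_mult:
  assumes "fps_abs_summable F r" "fps_abs_summable G r" "0 \<le> r"
  shows "fps_abs_summable (F * G) r"
proof -
  let ?f = "\<lambda>n. norm (fps_nth F n) * r ^ n" and ?g = "\<lambda>n. norm (fps_nth G n) * r ^ n"
  have "summable (\<lambda>n. \<Sum>i\<le>n. ?f i * ?g (n - i))"
    by (rule summable_Cauchy_product) (use assms in \<open>simp_all add: fps_abs_summable_def\<close>)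
  moreover have "norm (norm (fps_nth (F * G) n) * r ^ n) \<le> (\<Sum>i\<le>n. ?f i * ?g (n - i))" for n
  proof -
    have "norm (fps_nth (F * G) n) * r ^ n \<le> (\<Sum>i\<le>n. norm (fps_nth F i * fps_nth G (n - i))) * r ^ n"
      unfolding fps_mult_nth atLeast0AtMost
      by (intro mult_right_mono norm_sum) (use assms in auto)
    also have "\<dots> = (\<Sum>i\<le>n. ?f i * ?g (n - i))"
      unfolding sum_distrib_right
      by (intro sum.cong refl) (simp add: norm_mult power_add [symmetric] mult_ac)
    finally show ?thesis using assms by simp
  qed
  ultimately show ?thesis
    unfolding fps_abs_summable_def by (rule summable_comparison_test'[where N = 0])
qed

lemma eval_fps_mult_abs:
  assumes "fps_abs_summable F (norm x)" "fps_abs_summable G (norm x)"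
  shows "eval_fps (F * G) x = eval_fps F x * eval_fps G x"
proof -
  have "(\<lambda>n. \<Sum>i\<le>n. (fps_nth F i * x ^ i) * (fps_nth G (n - i) * x ^ (n - i)))
          sums (eval_fps F x * eval_fps G x)"
    unfolding eval_fps_def
    by (rule Cauchy_product_sums) (use assms in \<open>simp_all add: fps_abs_summable_norm\<close>)
  thus ?thesis
    by (simp add: fps_mult_nth_power eval_fps_def sums_iff)
qed

lemma fps_abs_summable_linear: "fps_abs_summable (1 - fps_const c * fps_X) r"
  unfolding fps_abs_summable_def
  by (rule summable_finite[of "{..1}"]) (auto simp: fps_X_def fps_one_def)

lemma eval_fps_linear: "eval_fps (1 - fps_const c * fps_X) x = 1 - c * x"
proof -
  have "(\<lambda>n. fps_nth (1 - fps_const c * fps_X) n * x ^ n) sums (\<Sum>n\<le>1. fps_nth (1 - fps_const c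
      * fps_X) n * x ^ n)"
    by (rule sums_finite) (auto simp: fps_X_def fps_one_def)
  thus ?thesis by (simp add: eval_fps_def sums_iff)
qed

text \<open>Continuity at the origin, in the form in which a q-difference equation is iterated:
the arguments \<open>q\<^sup>nx\<close> tend to 0 and only the constant coefficient remains.\<close>
lemma eval_fps_tendsto_0:
  assumes "fps_abs_summable F r" "r > 0" "t \<longlonglongrightarrow> 0"
  shows "(\<lambda>n. eval_fps F (t n)) \<longlonglongrightarrow> fps_nth F 0"
proof -
  have "summable (\<lambda>n. fps_nth F n * complex_of_real r ^ n)"
    using assms(1,2) fps_abs_summable_norm[of F "complex_of_real r"] by
        (auto intro: summable_norm_cancel [of "\<lambda>n. fps_nth F n * complex_of_real r ^ n"])
  hence "isCont (\<lambda>x. \<Sum>n. fps_nth F n * x ^ n) 0"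
    by (rule isCont_powser) (use assms(2) in simp)
  hence "(\<lambda>n. eval_fps F (t n)) \<longlonglongrightarrow> eval_fps F 0"
    unfolding eval_fps_def by (rule isCont_tendsto_compose[OF _ assms(3)])
  thus ?thesis by (simp add: eval_fps_at_0)
qed

section \<open>Infinite shifted factorials\<close>

locale q_series =
  fixes q :: complex
  assumes q_lt_1: "norm q < 1"
begin

lemma q_power_tendsto_0: "(\<lambda>n. q ^ n * x) \<longlonglongrightarrow> 0"
  using tendsto_mult_left_zero[OF LIMSEQ_power_zero[OF q_lt_1]] by simp

lemma convergent_prod_qpoch: "convergent_prod (\<lambda>j. 1 - a * q ^ j)"
proof -
  have "summable (\<lambda>j. norm (a * q ^ j))"
    using q_lt_1 by (simp add: norm_mult norm_power summable_geometric summable_mult)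
  hence "abs_convergent_prod (\<lambda>j. 1 - a * q ^ j)"
    by (simp add: abs_convergent_prod_conv_summable)
  thus ?thesis by (rule abs_convergent_prod_imp_convergent_prod)
qed

lemma qpoch_tendsto: "(\<lambda>n. qpoch a q n) \<longlonglongrightarrow> qpoch_inf a q"
proof -
  have "(\<lambda>n. \<Prod>j\<le>n. 1 - a * q ^ j) \<longlonglongrightarrow> qpoch_inf a q"
    unfolding qpoch_inf_def by (rule convergent_prod_LIMSEQ[OF convergent_prod_qpoch])
  hence "(\<lambda>n. qpoch a q (Suc n)) \<longlonglongrightarrow> qpoch_inf a q"
    by (simp only: qpoch_def lessThan_Suc_atMost)
  thus ?thesis by (simp add: filterlim_sequentially_Suc)
qed

lemma qpoch_inf_rec: "qpoch_inf a q = (1 - a) * qpoch_inf (a * q) q"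
proof -
  have "(\<lambda>n. qpoch a q (Suc n)) \<longlonglongrightarrow> (1 - a) * qpoch_inf (a * q) q"
    unfolding qpoch_Suc_left by (intro tendsto_intros qpoch_tendsto)
  moreover have "(\<lambda>n. qpoch a q (Suc n)) \<longlonglongrightarrow> qpoch_inf a q"
    using qpoch_tendsto by (simp add: filterlim_sequentially_Suc)
  ultimately show ?thesis using LIMSEQ_unique by blast
qed

lemma qpoch_inf_split: "qpoch_inf a q = qpoch a q n * qpoch_inf (a * q ^ n) q"
proof (induction n)
  case (Suc n)
  show ?case
    using Suc qpoch_inf_rec[of "a * q ^ n"] by (simp add: qpoch_Suc mult_ac)
qed simp

lemma qpoch_inf_0 [simp]: "qpoch_inf 0 q = 1"
  by (simp add: qpoch_inf_def)

lemma one_minus_power_neq_0: assumes "norm a < 1" shows "1 - a * q ^ n \<noteq> 0"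
proof
  assume "1 - a * q ^ n = 0"
  hence "norm (a * q ^ n) = 1" by simp
  moreover have "norm (a * q ^ n) \<le> norm a * 1"
    unfolding norm_mult norm_power using q_lt_1 by (intro mult_left_mono power_le_one) auto
  ultimately show False using assms by simp
qed

lemma qpoch_neq_0: "norm a < 1 \<Longrightarrow> qpoch a q n \<noteq> 0"
  unfolding qpoch_def using one_minus_power_neq_0[of a] by (subst prod_zero_iff) blast+

lemma qpoch_inf_neq_0: assumes "norm a < 1" shows "qpoch_inf a q \<noteq> 0"
  unfolding qpoch_inf_def
  using prodinf_nonzero[OF convergent_prod_qpoch] one_minus_power_neq_0[OF assms] by metis

lemma one_minus_q_power_neq_0: "1 - q ^ Suc n \<noteq> 0"
  using one_minus_power_neq_0[OF q_lt_1, of n] by simp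

lemma qpoch_q_neq_0 [simp]: "qpoch q q n \<noteq> 0"
  by (rule qpoch_neq_0[OF q_lt_1])

lemma qpoch_q_Suc: "qpoch q q (Suc n) = qpoch q q n * (1 - q ^ Suc n)"
  by (simp add: qpoch_Suc)

text \<open>The bound is uniform in the parameter, as the parameter \<open>1/s\<close> will run over a circle.\<close>
lemma qpoch_bounded: obtains C where "C > 0" "\<And>a n. norm a \<le> r \<Longrightarrow> norm (qpoch a q n) \<le> C"
proof -
  have s: "summable (\<lambda>j. norm (of_real r * q ^ j))"
    using q_lt_1 by (simp add: norm_mult norm_power summable_geometric summable_mult)
  hence "convergent_prod (\<lambda>j. 1 + norm (of_real r * q ^ j))"
    by (intro summable_imp_convergent_prod_real)
       (auto dest!: arg_cong[of _ _ "\<lambda>x. x \<ge> (0::real)"])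
  hence "convergent (\<lambda>n. \<Prod>j\<le>n. 1 + norm (of_real r * q ^ j))"
    using convergent_prod_imp_convergent by blast
  hence "Bseq (\<lambda>n. \<Prod>j\<le>n. 1 + norm (of_real r * q ^ j))"
    by (rule convergent_imp_Bseq)
  then obtain C where C: "C > 0" "\<And>n. norm (\<Prod>j\<le>n. 1 + norm (of_real r * q ^ j)) \<le> C"
    unfolding Bseq_def by blast
  show ?thesis
  proof (rule that[OF C(1)])
    fix a :: complex and n assume a: "norm a \<le> r"
    have "norm (qpoch a q n) \<le> (\<Prod>j<n. 1 + norm (of_real r * q ^ j))"
      unfolding qpoch_def prod_norm [symmetric]
    proof (intro prod_mono conjI)
      fix j
      have "norm (1 - a * q ^ j) \<le> 1 + norm (a * q ^ j)"
        by (metis norm_one norm_triangle_ineq4)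
      also have "norm (a * q ^ j) \<le> norm (of_real r * q ^ j)"
        unfolding norm_mult using a by (intro mult_right_mono) auto
      finally show "norm (1 - a * q ^ j) \<le> 1 + norm (of_real r * q ^ j)" by simp
    qed auto
    also have "\<dots> \<le> (\<Prod>j\<le>n. 1 + norm (of_real r * q ^ j))"
      by (intro prod_mono2) auto
    also have "\<dots> \<le> C" using C(2)[of n] by simp
    finally show "norm (qpoch a q n) \<le> C" .
  qed
qed

lemma inverse_qpoch_q_bounded: obtains C where "C > 0" "\<And>n. norm (1 / qpoch q q n) \<le> C"
proof -
  have "(\<lambda>n. 1 / qpoch q q n) \<longlonglongrightarrow> 1 / qpoch_inf q q"
    by (intro tendsto_intros qpoch_tendsto qpoch_inf_neq_0 q_lt_1)
  hence "Bseq (\<lambda>n. 1 / qpoch q q n)" by (intro convergent_imp_Bseq convergentI)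
  thus ?thesis using that unfolding Bseq_def by blast
qed

section \<open>The q-binomial theorem\<close>

definition euler_coeff :: "nat \<Rightarrow> complex" where
  "euler_coeff n = (-1) ^ n * q ^ (n * (n - 1) div 2) / qpoch q q n"

text \<open>Euler's series of \<open>(aX;q)\<^sub>\<infinity>\<close>.\<close>
definition fps_qpoch :: "complex \<Rightarrow> complex fps" where
  "fps_qpoch a = Abs_fps (\<lambda>n. euler_coeff n * a ^ n)"

text \<open>The series of \<open>(abX;q)\<^sub>\<infinity>/(bX;q)\<^sub>\<infinity>\<close>.\<close>
definition fps_qbinom :: "complex \<Rightarrow> complex \<Rightarrow> complex fps" where
  "fps_qbinom a b = Abs_fps (\<lambda>n. qpoch a q n / qpoch q q n * b ^ n)"

text \<open>The series of \<open>1/(bX;q)\<^sub>\<infinity>\<close>. As a case of the q-binomial series it inherits its q-difference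
equation and its bounds.\<close>
abbreviation fps_inv_qpoch :: "complex \<Rightarrow> complex fps" where
  "fps_inv_qpoch b \<equiv> fps_qbinom 0 b"

text \<open>The operator \<open>F(X) \<mapsto> F(qX)\<close>, in which all q-difference equations are written.\<close>
definition dilate :: "complex fps \<Rightarrow> complex fps" where
  "dilate F = Abs_fps (\<lambda>n. q ^ n * fps_nth F n)"

lemma euler_coeff_0 [simp]: "euler_coeff 0 = 1"
  by (simp add: euler_coeff_def)

lemma euler_coeff_Suc: "euler_coeff (Suc n) * (1 - q ^ Suc n) = - (q ^ n) * euler_coeff n"
  unfolding euler_coeff_def binomial_two_Suc qpoch_q_Suc
  using one_minus_q_power_neq_0[of n] by (simp add: field_simps power_add)

lemma fps_nth_qpoch [simp]: "fps_nth (fps_qpoch a) n = euler_coeff n * a ^ n"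
  by (simp add: fps_qpoch_def)

lemma fps_nth_qbinom [simp]: "fps_nth (fps_qbinom a b) n = qpoch a q n / qpoch q q n * b ^ n"
  by (simp add: fps_qbinom_def)

lemma dilate_nth [simp]: "fps_nth (dilate F) n = q ^ n * fps_nth F n"
  by (simp add: dilate_def)

lemma dilate_mult: "dilate (F * G) = dilate F * dilate G"
proof (rule fps_ext)
  fix n
  have "q ^ n * (fps_nth F i * fps_nth G (n - i)) = q ^ i * fps_nth F i * (q ^ (n - i) * fps_nth G
      (n - i))"
    if "i \<le> n" for i
  proof -
    have "q ^ n = q ^ i * q ^ (n - i)" using that by (simp add: power_add [symmetric])
    thus ?thesis by simp
  qed
  thus "fps_nth (dilate (F * G)) n = fps_nth (dilate F * dilate G) n"
    unfolding dilate_nth fps_mult_nth sum_distrib_left by (intro sum.cong) auto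
qed

lemma linear_fps_mult_nth:
  "fps_nth ((1 - fps_const c * fps_X) * F) n = fps_nth F n - c * (if n = 0 then 0 else fps_nth F (n
      - 1))"
  for F :: "complex fps"
  unfolding left_diff_distrib mult.assoc by simp

lemma fps_qbinom_dilate:
  "(1 - fps_const b * fps_X) * fps_qbinom a b = (1 - fps_const (a * b) * fps_X) * dilate
      (fps_qbinom a b)"
proof (rule fps_ext)
  fix n show "fps_nth ((1 - fps_const b * fps_X) * fps_qbinom a b) n =
    fps_nth ((1 - fps_const (a * b) * fps_X) * dilate (fps_qbinom a b)) n"
    unfolding linear_fps_mult_nth
  proof (cases n)
    case (Suc m)
    show "fps_nth (fps_qbinom a b) n - b * (if n = 0 then 0 else fps_nth (fps_qbinom a b) (n - 1)) =
      fps_nth (dilate (fps_qbinom a b)) n - a * b * (if n = 0 then 0 else fps_nth (dilate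
          (fps_qbinom a b)) (n - 1))"
      using one_minus_q_power_neq_0[of m]
      by (simp add: Suc qpoch_q_Suc) (simp add: field_simps qpoch_Suc)
  qed simp_all
qed

lemma fps_qpoch_dilate: "fps_qpoch a = (1 - fps_const a * fps_X) * dilate (fps_qpoch a)"
proof (rule fps_ext)
  fix n show "fps_nth (fps_qpoch a) n = fps_nth ((1 - fps_const a * fps_X) * dilate (fps_qpoch a)) n"
    unfolding linear_fps_mult_nth
  proof (cases n)
    case (Suc m)
    show "fps_nth (fps_qpoch a) n = fps_nth (dilate (fps_qpoch a)) n
        - a * (if n = 0 then 0 else fps_nth (dilate (fps_qpoch a)) (n - 1))"
    proof -
      have "euler_coeff (Suc m) = q ^ Suc m * euler_coeff (Suc m) - q ^ m * euler_coeff m"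
        using euler_coeff_Suc[of m] by (simp add: algebra_simps)
      hence eq: "euler_coeff (Suc m) * a ^ Suc m
          = (q ^ Suc m * euler_coeff (Suc m) - q ^ m * euler_coeff m) * a ^ Suc m"
        by (rule arg_cong)
      have "fps_nth (fps_qpoch a) n = euler_coeff (Suc m) * a ^ Suc m" by (simp add: Suc)
      also note eq
      also have "(q ^ Suc m * euler_coeff (Suc m) - q ^ m * euler_coeff m) * a ^ Suc m =
          fps_nth (dilate (fps_qpoch a)) n
          - a * (if n = 0 then 0 else fps_nth (dilate (fps_qpoch a)) (n - 1))"
        by (simp add: Suc algebra_simps)
      finally show ?thesis .
    qed
  qed simp_all
qed

text \<open>A first-order q-difference equation determines each coefficient from the previous one, as
\<open>1 - q\<^sup>n\<^sup>+\<^sup>1\<close> does not vanish. All product formulas between these series follow from this.\<close>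
lemma dilate_equation_unique:
  assumes "(1 - fps_const b * fps_X) * F = (1 - fps_const c * fps_X) * dilate F"
    and "(1 - fps_const b * fps_X) * G = (1 - fps_const c * fps_X) * dilate G"
    and "fps_nth F 0 = fps_nth G 0"
  shows "F = G"
proof (rule fps_ext)
  have step: "fps_nth A (Suc n) = (b - c * q ^ n) / (1 - q ^ Suc n) * fps_nth A n"
    if "(1 - fps_const b * fps_X) * A = (1 - fps_const c * fps_X) * dilate A" for A n
    using arg_cong[OF that, of "\<lambda>f. fps_nth f (Suc n)"] one_minus_q_power_neq_0[of n]
    unfolding linear_fps_mult_nth by (simp add: field_simps)
  fix n show "fps_nth F n = fps_nth G n"
    by (induction n) (use assms step in auto)
qed

lemma fps_qbinom_factor: "fps_qbinom a b = fps_qpoch (a * b) * fps_inv_qpoch b"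
proof (rule dilate_equation_unique[OF fps_qbinom_dilate])
  have "(1 - fps_const b * fps_X) * (fps_qpoch (a * b) * fps_inv_qpoch b)
      = fps_qpoch (a * b) * ((1 - fps_const b * fps_X) * fps_inv_qpoch b)"
    by (simp only: mult_ac)
  also have "\<dots> = fps_qpoch (a * b) * dilate (fps_inv_qpoch b)"
    by (subst fps_qbinom_dilate) simp
  also have "\<dots> = (1 - fps_const (a * b) * fps_X) * dilate (fps_qpoch (a * b) * fps_inv_qpoch b)"
    by (subst fps_qpoch_dilate) (simp only: dilate_mult mult_ac)
  finally show "(1 - fps_const b * fps_X) * (fps_qpoch (a * b) * fps_inv_qpoch b) = \<dots>" .
qed (simp)

lemma fps_qpoch_inverse: "fps_qpoch a * fps_inv_qpoch a = 1"
proof -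
  have "fps_qpoch a * fps_inv_qpoch a = fps_qbinom 1 a"
    using fps_qbinom_factor[of 1 a] by simp
  also have "\<dots> = 1"
  proof (rule fps_ext)
    fix n show "fps_nth (fps_qbinom 1 a) n = fps_nth 1 n"
      by (cases n) (simp_all add: qpoch_Suc_left)
  qed
  finally show ?thesis .
qed

text \<open>Formally \<open>(abcX)/(bcX) \<cdot> (bcX)/(cX) = (abcX)/(cX)\<close>. Its coefficients are the q-Chu--Vandermonde sum.\<close>
lemma fps_qbinom_chain: "fps_qbinom a (b * c) * fps_qbinom b c = fps_qbinom (a * b) c"
  using fps_qpoch_inverse[of "b * c"]
  by (simp add: fps_qbinom_factor[of a "b*c"] fps_qbinom_factor[of b c] fps_qbinom_factor[of "a*b" c])
     (metis (no_types, lifting) mult.assoc mult.commute mult.left_neutral)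

lemma fps_abs_summable_qbinom:
  assumes "norm b * r < 1" "0 \<le> r"
  shows "fps_abs_summable (fps_qbinom a b) r"
proof -
  obtain C where C: "C > 0" "\<And>n. norm (qpoch a q n) \<le> C"
    using qpoch_bounded[of "norm a"] by (metis order_refl)
  obtain D where D: "D > 0" "\<And>n. norm (1 / qpoch q q n) \<le> D"
    using inverse_qpoch_q_bounded by blast
  have "summable (\<lambda>n. C * D * (norm b * r) ^ n)"
    by (intro summable_mult summable_geometric) (use assms in \<open>simp add: abs_mult\<close>)
  moreover have "norm (norm (fps_nth (fps_qbinom a b) n) * r ^ n) \<le> C * D * (norm b * r) ^ n" for n
  proof -
    have "norm (fps_nth (fps_qbinom a b) n) * r ^ n
        = norm (qpoch a q n) * norm (1 / qpoch q q n) * (norm b * r) ^ n"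
      by (simp add: norm_mult norm_divide norm_power power_mult_distrib)
    also have "\<dots> \<le> C * D * (norm b * r) ^ n"
      by (intro mult_mono C D) (use C D assms in \<open>auto simp: less_imp_le\<close>)
    finally show ?thesis using assms by simp
  qed
  ultimately show ?thesis
    unfolding fps_abs_summable_def by (rule summable_comparison_test'[where N = 0]) 
qed

lemma fps_abs_summable_qpoch:
  assumes "0 \<le> r" shows "fps_abs_summable (fps_qpoch a) r"
  unfolding fps_abs_summable_def
proof (cases "q = 0 \<or> a = 0 \<or> r = 0")
  case True
  show "summable (\<lambda>n. norm (fps_nth (fps_qpoch a) n) * r ^ n)"
  proof (rule summable_finite[of "{..1}"])
    fix n assume "n \<notin> {..(1::nat)}"
    hence "2 * 1 \<le> n * (n - 1)" by (intro mult_le_mono) auto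
    hence "n * (n - 1) div 2 > 0" by (simp add: div_greater_zero_iff)
    thus "norm (fps_nth (fps_qpoch a) n) * r ^ n = 0"
      using True \<open>n \<notin> {..1}\<close> by (auto simp: euler_coeff_def)
  qed simp
next
  case False
  let ?f = "\<lambda>n. norm (fps_nth (fps_qpoch a) n) * r ^ n"
  have eq: "?f (Suc n) = norm (q ^ n / (1 - q ^ Suc n) * (a * of_real r)) * ?f n" for n
  proof -
    have "euler_coeff (Suc n) = - (q ^ n) / (1 - q ^ Suc n) * euler_coeff n"
      using euler_coeff_Suc[of n] one_minus_q_power_neq_0[of n] by (simp add: field_simps)
    thus ?thesis using assms by (simp add: norm_mult norm_divide norm_power mult_ac)
  qed
  have "(\<lambda>n. norm (q ^ n / (1 - q ^ Suc n) * (a * of_real r))) \<longlonglongrightarrow> norm (0 / (1 - 0) * (a * of_real r))"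
    by (intro tendsto_intros LIMSEQ_power_zero q_lt_1 LIMSEQ_Suc[OF LIMSEQ_power_zero]) simp
  hence "eventually (\<lambda>n. norm (q ^ n / (1 - q ^ Suc n) * (a * of_real r)) < 1/2) sequentially"
    by (intro order_tendstoD(2)) auto
  then obtain N where N: "\<And>n. n \<ge> N \<Longrightarrow> norm (q ^ n / (1 - q ^ Suc n) * (a * of_real r)) < 1/2"
    by (auto simp: eventually_sequentially)
  show "summable ?f"
  proof (rule summable_ratio_test[of "1/2" N])
    fix n assume "n \<ge> N"
    show "norm (?f (Suc n)) \<le> 1/2 * norm (?f n)"
    proof -
      have "norm (?f (Suc n)) = norm (q ^ n / (1 - q ^ Suc n) * (a * of_real r)) * norm (?f n)"
        unfolding eq real_norm_def abs_mult abs_norm_cancel ..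
      also have "\<dots> \<le> 1/2 * norm (?f n)"
        by (rule mult_right_mono[OF less_imp_le[OF N[OF \<open>n \<ge> N\<close>]] norm_ge_zero])
      finally show ?thesis .
    qed
  qed simp
qed

lemma eval_fps_dilate: "eval_fps (dilate F) x = eval_fps F (q * x)"
  by (simp add: eval_fps_def power_mult_distrib mult_ac)

lemma fps_abs_summable_dilate: "fps_abs_summable F r \<Longrightarrow> 0 \<le> r \<Longrightarrow> fps_abs_summable (dilate F) r"
  unfolding fps_abs_summable_def
  by (rule summable_comparison_test'[of "\<lambda>n. norm (fps_nth F n) * r ^ n" 0])
     (use q_lt_1 in \<open>auto simp: norm_mult norm_power intro!: mult_right_mono mult_left_le_one_le power_le_one\<close>)

text \<open>Iterating \<open>F(x) = (1 - ax) F(qx)\<close> peels off the factors of \<open>(ax;q)\<^sub>n\<close>; the rest tends to \<open>F(0) = 1\<close>.\<close>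
lemma eval_fps_qpoch: "eval_fps (fps_qpoch a) x = qpoch_inf (a * x) q"
proof -
  have ab: "fps_abs_summable (fps_qpoch a) r" if "r \<ge> 0" for r
    by (rule fps_abs_summable_qpoch[OF that])
  have rec: "eval_fps (fps_qpoch a) t = (1 - a * t) * eval_fps (fps_qpoch a) (q * t)" for t
    by (subst fps_qpoch_dilate)
       (simp add: eval_fps_mult_abs fps_abs_summable_linear eval_fps_linear fps_abs_summable_dilate ab eval_fps_dilate)
  have it: "eval_fps (fps_qpoch a) x = qpoch (a * x) q n * eval_fps (fps_qpoch a) (q ^ n * x)" for n
  proof (induction n)
    case (Suc n)
    thus ?case using rec[of "q ^ n * x"] by (simp add: qpoch_Suc mult_ac)
  qed simp
  have "(\<lambda>n. qpoch (a * x) q n * eval_fps (fps_qpoch a) (q ^ n * x)) \<longlonglongrightarrow> qpoch_inf (a * x) q * fps_nth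
      (fps_qpoch a) 0"
    by (intro tendsto_mult qpoch_tendsto eval_fps_tendsto_0[of _ 1] ab q_power_tendsto_0) auto
  thus ?thesis unfolding it [symmetric] by (simp add: LIMSEQ_const_iff)
qed

text \<open>The q-binomial theorem, from the factorization of the series and Euler's expansion.\<close>
lemma eval_fps_qbinom:
  assumes "norm (b * x) < 1"
  shows "eval_fps (fps_qbinom a b) x = qpoch_inf (a * b * x) q / qpoch_inf (b * x) q"
proof -
  have x: "norm b * norm x < 1" using assms by (simp add: norm_mult)
  have inv: "fps_abs_summable (fps_qpoch b) (norm x)" "fps_abs_summable (fps_inv_qpoch b) (norm x)"
    by (auto intro: fps_abs_summable_qpoch fps_abs_summable_qbinom x)
  have "eval_fps (fps_qpoch b * fps_inv_qpoch b) x = 1"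
    by (simp add: fps_qpoch_inverse)
  hence "qpoch_inf (b * x) q * eval_fps (fps_inv_qpoch b) x = 1"
    by (simp add: eval_fps_mult_abs inv eval_fps_qpoch)
  moreover have "eval_fps (fps_qbinom a b) x = qpoch_inf (a * b * x) q * eval_fps (fps_inv_qpoch b) x"
    by (subst fps_qbinom_factor) (simp add: eval_fps_mult_abs inv eval_fps_qpoch fps_abs_summable_qpoch)
  ultimately show ?thesis
    by (metis nonzero_eq_divide_eq mult.assoc mult.commute mult.left_neutral mult_zero_left zero_neq_one)
qed

end

section \<open>Rogers--Szego polynomials\<close>

lemma fps_abs_summable_coeff_bound:
  assumes "fps_abs_summable F r" "r > 0"
  obtains C where "C \<ge> 0" "\<And>n. norm (fps_nth F n) \<le> C * (1 / r) ^ n"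
proof -
  have "Bseq (\<lambda>n. norm (fps_nth F n) * r ^ n)"
    using assms(1) unfolding fps_abs_summable_def
    by (intro convergent_imp_Bseq convergentI[of _ 0] summable_LIMSEQ_zero)
  then obtain C where C: "C > 0" "\<And>n. norm (norm (fps_nth F n) * r ^ n) \<le> C"
    unfolding Bseq_def by blast
  show ?thesis
  proof (rule that[of C])
    fix n show "norm (fps_nth F n) \<le> C * (1 / r) ^ n"
      using C(2)[of n] assms(2) by (simp add: power_one_over field_simps)
  qed (use C in simp)
qed

lemma sums_shift_zero:
  fixes f :: "nat \<Rightarrow> complex"
  assumes "(\<lambda>i. f (i + m)) sums s" "\<And>i. i < m \<Longrightarrow> f i = 0"
  shows "f sums s"
  using assms sums_iff_shift[of f m s] by simp

context q_series
begin

lemma two_linear_factors_nth: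
  fixes F :: "complex fps"
  shows "fps_nth ((1 - fps_const c * fps_X) * ((1 - fps_const d * fps_X) * F)) (Suc (Suc n)) =
           fps_nth F (Suc (Suc n)) - (c + d) * fps_nth F (Suc n) + c * d * fps_nth F n"
    and "fps_nth ((1 - fps_const c * fps_X) * ((1 - fps_const d * fps_X) * F)) (Suc 0) =
           fps_nth F (Suc 0) - (c + d) * fps_nth F 0"
  unfolding linear_fps_mult_nth by (simp_all add: algebra_simps)

text \<open>Defined by the generating function \<open>1/((X;q)\<^sub>\<infinity>(yX;q)\<^sub>\<infinity>) = \<Sum> h\<^sub>n(y) X\<^sup>n/(q;q)\<^sub>n\<close>, whose
q-difference equation gives the three-term recurrence.\<close>
definition rogers_szego :: "complex \<Rightarrow> nat \<Rightarrow> complex" where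
  "rogers_szego y n = qpoch q q n * fps_nth (fps_inv_qpoch 1 * fps_inv_qpoch y) n"

lemma fps_qbinom_pair_dilate:
  "(1 - fps_const c * fps_X) * ((1 - fps_const d * fps_X) * (fps_qbinom a c * fps_qbinom b d)) =
   (1 - fps_const (a * c) * fps_X) * ((1 - fps_const (b * d) * fps_X) *
     dilate (fps_qbinom a c * fps_qbinom b d))"
proof -
  have "(1 - fps_const c * fps_X) * ((1 - fps_const d * fps_X) * (fps_qbinom a c * fps_qbinom b d)) =
    ((1 - fps_const c * fps_X) * fps_qbinom a c) * ((1 - fps_const d * fps_X) * fps_qbinom b d)"
    by (simp only: mult_ac)
  also have "\<dots> = ((1 - fps_const (a * c) * fps_X) * dilate (fps_qbinom a c)) *
      ((1 - fps_const (b * d) * fps_X) * dilate (fps_qbinom b d))"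
    by (simp only: fps_qbinom_dilate)
  finally show ?thesis by (simp only: dilate_mult mult_ac)
qed

lemma rogers_szego_0 [simp]: "rogers_szego y 0 = 1"
  by (simp add: rogers_szego_def)

lemma rogers_szego_1: "rogers_szego y (Suc 0) = 1 + y"
proof -
  define g where "g = fps_inv_qpoch 1 * fps_inv_qpoch y"
  have "fps_nth g (Suc 0) - (1 + y) * fps_nth g 0 = q * fps_nth g (Suc 0)"
    using arg_cong[OF fps_qbinom_pair_dilate[of 1 y 0 0], of "\<lambda>F. fps_nth F (Suc 0)"]
    unfolding two_linear_factors_nth g_def [symmetric] by simp
  moreover have "fps_nth g 0 = 1" by (simp add: g_def)
  ultimately have "(1 - q) * fps_nth g (Suc 0) = 1 + y" by (simp add: algebra_simps)
  thus ?thesis by (simp add: rogers_szego_def g_def qpoch_Suc)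
qed

lemma rogers_szego_rec:
  "rogers_szego y (Suc (Suc n)) = (1 + y) * rogers_szego y (Suc n) - y * (1 - q ^ Suc n)
      * rogers_szego y n"
proof -
  let ?g = "\<lambda>n. fps_nth (fps_inv_qpoch 1 * fps_inv_qpoch y) n"
  have "?g (Suc (Suc n)) - (1 + y) * ?g (Suc n) + y * ?g n = q ^ Suc (Suc n) * ?g (Suc (Suc n))"
    using arg_cong[OF fps_qbinom_pair_dilate[of 1 y 0 0], of "\<lambda>F. fps_nth F (Suc (Suc n))"]
    unfolding two_linear_factors_nth by simp
  hence "(1 - q ^ Suc (Suc n)) * ?g (Suc (Suc n)) = (1 + y) * ?g (Suc n) - y * ?g n"
    by (simp add: algebra_simps)
  hence "qpoch q q (Suc n) * ((1 - q ^ Suc (Suc n)) * ?g (Suc (Suc n))) =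
      qpoch q q (Suc n) * ((1 + y) * ?g (Suc n) - y * ?g n)" by simp
  thus ?thesis unfolding rogers_szego_def qpoch_q_Suc by (simp add: algebra_simps)
qed

text \<open>For sequences \<open>P\<close> and \<open>E\<close> satisfying the coefficient form of the q-difference equations of a
theta numerator and of the negative part of the Laurent expansion, the correlations
\<open>\<Sum>\<^sub>i P\<^sub>i E\<^sub>i\<^sub>+\<^sub>n\<close> satisfy the recurrence of the Rogers--Szego polynomials. The equation for \<open>E\<close> produces weights
\<open>q\<^sup>i\<close>; after a shift of the summation index the equation for \<open>P\<close> absorbs them again. This is a
contour shift \<open>s \<mapsto> qs\<close> carried out on coefficients.\<close>
lemma moment_recurrence:
  fixes P E :: "nat \<Rightarrow> complex"
  assumes E: "\<And>k. E (k + 2) - (1 + y) * E (k + 1) + y * E k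
               = q ^ (k + 1) * E (k + 2) - t * q ^ k * E (k + 1) + y * q ^ k * E k"
    and P1: "y * P 1 = y * q * P 1 - t * P 0"
    and P2: "\<And>k. y * P (k + 2) = y * q ^ (k + 2) * P (k + 2) - t * q ^ (k + 1) * P (k + 1) + q ^ (k
        + 1) * P k"
    and summable: "\<And>n. summable (\<lambda>i. norm (P i * E (i + n)))"
  shows "(\<Sum>i. P i * E (i + (n + 2))) = (1 + y) * (\<Sum>i. P i * E (i + (n + 1))) - y * (1 - q ^ n) *
      (\<Sum>i. P i * E (i + n))"
proof -
  have s: "(\<lambda>i. P i * E (i + j)) sums (\<Sum>i. P i * E (i + j))" for j
    by (rule summable_sums[OF summable_norm_cancel[OF summable]])
  have sq: "summable (\<lambda>i. q ^ i * P i * E (i + j))" for j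
  proof (rule summable_norm_cancel, rule summable_comparison_test'[OF summable[of j], where N = 0])
    fix i
    have "norm (q ^ i) * norm (P i * E (i + j)) \<le> 1 * norm (P i * E (i + j))"
      using q_lt_1 by (intro mult_right_mono) (simp_all add: norm_power power_le_one)
    thus "norm (norm (q ^ i * P i * E (i + j))) \<le> norm (P i * E (i + j))"
      by (simp add: norm_mult mult_ac)
  qed
  define T where "T j = (\<Sum>i. q ^ i * P i * E (i + j))" for j
  have T: "(\<lambda>i. q ^ i * P i * E (i + j)) sums T j" for j
    unfolding T_def by (rule summable_sums[OF sq])
  define X where "X i = P i * E (i + (n + 2)) - (1 + y) * (P i * E (i + (n + 1))) + y * (P i * E (i
      + n))" for i
  define Y where "Y i = q ^ n * (q * (q ^ i * P i * E (i + (n + 2))) - t * (q ^ i * P i * E (i + (n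
      + 1))) + y * (q ^ i * P i * E (i + n)))" for i
  have A1: "X sums
        ((\<Sum>i. P i * E (i + (n + 2))) - (1 + y) * (\<Sum>i. P i * E (i + (n + 1))) + y * (\<Sum>i. P i * E (i
            + n)))"
    unfolding X_def by (intro sums_add sums_diff sums_mult s)
  have A2: "X i = Y i" for i
  proof -
    have "P i * E (i + (n + 2)) - (1 + y) * (P i * E (i + (n + 1))) + y * (P i * E (i + n))
        = P i * (E ((i + n) + 2) - (1 + y) * E ((i + n) + 1) + y * E (i + n))"
      by (simp add: algebra_simps)
    also have "\<dots> = P i * (q ^ (i + n + 1) * E (i + n + 2) - t * q ^ (i + n) * E (i + n + 1) + y
        * q ^ (i + n) * E (i + n))"
      by (simp only: E)
    finally show ?thesis
      unfolding X_def Y_def by (simp add: algebra_simps power_add)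
  qed
  have A3: "Y sums (q ^ n * (q * T (n + 2) - t * T (n + 1) + y * T n))"
    unfolding Y_def by (intro sums_add sums_diff sums_mult T)
  have 1: "(\<Sum>i. P i * E (i + (n + 2))) - (1 + y) * (\<Sum>i. P i * E (i + (n + 1))) + y * (\<Sum>i. P i * E (i
      + n))
      = q ^ n * (q * T (n + 2) - t * T (n + 1) + y * T n)"
    by (rule sums_unique2[OF A1 iffD2[OF sums_cong[OF A2] A3]])
  have f2: "(\<lambda>k. if k < 2 then 0 else q ^ (k - 2) * P (k - 2) * E (k + n)) sums T (n + 2)"
    by (rule sums_shift_zero[where m = 2]) (use T[of "n + 2"] in \<open>simp_all add: add_ac\<close>)
  have f1: "(\<lambda>k. if k < 1 then 0 else q ^ (k - 1) * P (k - 1) * E (k + n)) sums T (n + 1)"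
    by (rule sums_shift_zero[where m = 1]) (use T[of "n + 1"] in \<open>simp_all add: add_ac\<close>)
  define U where "U k = q * (if k < 2 then 0 else q ^ (k - 2) * P (k - 2) * E (k + n))
     - t * (if k < 1 then 0 else q ^ (k - 1) * P (k - 1) * E (k + n)) + y * (q ^ k * P k * E (k
         + n))" for k
  have B1: "U sums (q * T (n + 2) - t * T (n + 1) + y * T n)"
    unfolding U_def by (intro sums_add sums_diff sums_mult T f1 f2)
  have B2: "U k = y * (P k * E (k + n))" for k
  proof -
    consider "k = 0" | "k = 1" | "k \<ge> 2" by linarith
    thus ?thesis
    proof cases
      case 2
      have "y * (P 1 * E (1 + n)) = (y * P 1) * E (1 + n)" by simp
      also have "\<dots> = (y * q * P 1 - t * P 0) * E (1 + n)" by (simp only: P1)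
      finally show ?thesis by (simp add: U_def 2 algebra_simps)
    next
      case 3
      define m where "m = k - 2"
      have km: "k = m + 2" using 3 by (simp add: m_def)
      have "y * (P (m + 2) * E (m + 2 + n)) = (y * P (m + 2)) * E (m + 2 + n)" by simp
      also have "\<dots> = (y * q ^ (m + 2) * P (m + 2) - t * q ^ (m + 1) * P (m + 1) + q ^ (m + 1) * P m)
          * E (m + 2 + n)"
        by (simp only: P2)
      finally show ?thesis by (simp add: U_def km algebra_simps)
    qed (simp add: U_def)
  qed
  have B3: "(\<lambda>k. y * (P k * E (k + n))) sums (y * (\<Sum>i. P i * E (i + n)))"
    by (intro sums_mult s)
  have 2: "q * T (n + 2) - t * T (n + 1) + y * T n = y * (\<Sum>i. P i * E (i + n))"
    by (rule sums_unique2[OF B1 iffD2[OF sums_cong[OF B2] B3]])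
  show ?thesis using 1 unfolding 2 by (simp add: algebra_simps)
qed

lemma fps_abs_summable_dilate_iff: "fps_abs_summable (dilate F) r \<longleftrightarrow> fps_abs_summable F (norm q * r)"
  by (simp add: fps_abs_summable_def norm_mult norm_power power_mult_distrib mult_ac)

text \<open>Multiplying by \<open>1 - yX\<close> leaves, for \<open>\<bar>y\<bar> \<le> 1\<close>, at most a simple pole at \<open>X = 1\<close> and no other singularity in a
disc of radius greater than 1; the coefficients therefore tend to the value at 1 of the regular
factor. Taking the combination with \<open>y\<close> keeps the case \<open>\<bar>y\<bar> = 1\<close>, where
the coefficients themselves need not converge.\<close>
lemma fps_pair_coeff_limit:
  assumes "norm y \<le> 1"
  shows "(\<lambda>n. fps_nth (fps_qbinom a 1 * fps_qbinom b y) (Suc n) - y * fps_nth (fps_qbinom a 1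
      * fps_qbinom b y) n)
           \<longlonglongrightarrow> qpoch_inf a q * qpoch_inf (b * y) q / (qpoch_inf q q * qpoch_inf (q * y) q)"
proof -
  define D where "D = fps_qbinom a 1 * fps_qbinom b y"
  define F where "F = (1 - fps_const y * fps_X) * D"
  define G where "G = fps_qpoch a * dilate (fps_inv_qpoch 1) * ((1 - fps_const (b * y) * fps_X)
      * dilate (fps_qbinom b y))"
  have "(1 - fps_const 1 * fps_X) * F = fps_qpoch a * ((1 - fps_const 1 * fps_X) * fps_inv_qpoch 1)
      * ((1 - fps_const y * fps_X) * fps_qbinom b y)"
    unfolding F_def D_def fps_qbinom_factor[of a 1] by (simp only: mult_ac mult_1_left mult_1_right)
  also have "\<dots> = G"
    unfolding G_def by (subst (1 2) fps_qbinom_dilate) simp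
  finally have FG: "(1 - fps_const 1 * fps_X) * F = G" .
  have F_sum: "fps_nth F n = (\<Sum>i\<le>n. fps_nth G i)" for n
  proof (induction n)
    case (Suc n)
    have "fps_nth G (Suc n) = fps_nth F (Suc n) - fps_nth F n"
      unfolding FG [symmetric] linear_fps_mult_nth by simp
    thus ?case using Suc by simp
  qed (simp add: FG [symmetric] linear_fps_mult_nth)
  have qy: "norm (q * y) < 1"
    using mult_right_mono[OF assms, of "norm q"] q_lt_1 by (simp add: norm_mult mult_ac)
  have ab1: "fps_abs_summable (dilate (fps_inv_qpoch 1)) 1" "fps_abs_summable (dilate
      (fps_qbinom b y)) 1"
    unfolding fps_abs_summable_dilate_iff
    using q_lt_1 qy by (auto intro!: fps_abs_summable_qbinom simp: norm_mult mult_ac)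
  have lin: "fps_abs_summable (1 - fps_const (b * y) * fps_X) 1" by (rule fps_abs_summable_linear)
  have qp: "fps_abs_summable (fps_qpoch a) 1" by (rule fps_abs_summable_qpoch) simp
  have G: "fps_abs_summable G 1" and "eval_fps G 1 = eval_fps (fps_qpoch a) 1 * eval_fps (dilate
      (fps_inv_qpoch 1)) 1
     * (eval_fps (1 - fps_const (b * y) * fps_X) 1 * eval_fps (dilate (fps_qbinom b y)) 1)"
    unfolding G_def using ab1 lin qp
    by (simp_all add: fps_abs_summable_mult eval_fps_mult_abs)
  hence "eval_fps G 1 = qpoch_inf a q * (1 / qpoch_inf q q) * ((1 - b * y) * (qpoch_inf (b * y
      * q) q / qpoch_inf (q * y) q))"
    unfolding eval_fps_linear using q_lt_1 qy
    by (simp add: eval_fps_dilate eval_fps_qbinom eval_fps_qpoch mult_ac)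
  also have "\<dots> = qpoch_inf a q * qpoch_inf (b * y) q / (qpoch_inf q q * qpoch_inf (q * y) q)"
    by (subst (4) qpoch_inf_rec) simp
  finally have ev: "eval_fps G 1 = qpoch_inf a q * qpoch_inf (b * y) q / (qpoch_inf q q * qpoch_inf
      (q * y) q)" .
  have "(\<lambda>n. fps_nth G n) sums eval_fps G 1"
    using fps_abs_summable_sums[of G 1] G by simp
  hence "(\<lambda>n. \<Sum>i<n. fps_nth G i) \<longlonglongrightarrow> eval_fps G 1" unfolding sums_def .
  hence "(\<lambda>n. \<Sum>i<Suc (Suc n). fps_nth G i) \<longlonglongrightarrow> eval_fps G 1"
    by (rule LIMSEQ_Suc[OF LIMSEQ_Suc])
  hence "(\<lambda>n. fps_nth F (Suc n)) \<longlonglongrightarrow> eval_fps G 1"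
    unfolding F_sum lessThan_Suc_atMost .
  moreover have "fps_nth F (Suc n) = fps_nth D (Suc n) - y * fps_nth D n" for n
    unfolding F_def linear_fps_mult_nth by simp
  ultimately show ?thesis using ev unfolding D_def by simp
qed

text \<open>The case \<open>a = b = 0\<close> of the preceding limit. Passing from \<open>h\<^sub>n/(q;q)\<^sub>n\<close> to \<open>h\<^sub>n\<close> costs an error of size
\<open>q\<^sup>n h\<^sub>n\<close>, which vanishes.\<close>
lemma rogers_szego_limit:
  assumes "norm y \<le> 1"
  shows "(\<lambda>n. rogers_szego y (Suc n) - y * rogers_szego y n) \<longlonglongrightarrow> 1 / qpoch_inf (q * y) q"
proof -
  let ?g = "\<lambda>n. fps_nth (fps_inv_qpoch 1 * fps_inv_qpoch y) n"
  have qy: "norm y * norm q < 1"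
    using mult_right_mono[OF assms, of "norm q"] q_lt_1 by simp
  have "fps_abs_summable (fps_inv_qpoch 1 * fps_inv_qpoch y) (norm q)"
    by (intro fps_abs_summable_mult fps_abs_summable_qbinom) (use q_lt_1 qy in auto)
  hence g0: "(\<lambda>n. ?g n * q ^ n) \<longlonglongrightarrow> 0"
    by (intro summable_LIMSEQ_zero sums_summable[OF fps_abs_summable_sums])
  have eq: "rogers_szego y (Suc n) - y * rogers_szego y n
      = qpoch q q n * ((?g (Suc n) - y * ?g n) - ?g (Suc n) * q ^ Suc n)" for n
    by (simp add: rogers_szego_def qpoch_q_Suc algebra_simps)
  have "(\<lambda>n. rogers_szego y (Suc n) - y * rogers_szego y n) \<longlonglongrightarrow>
      qpoch_inf q q * (qpoch_inf 0 q * qpoch_inf (0 * y) q / (qpoch_inf q q * qpoch_inf (q * y) q) - 0)"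
    unfolding eq
    by (intro tendsto_mult qpoch_tendsto tendsto_diff fps_pair_coeff_limit assms LIMSEQ_Suc[OF g0])
  thus ?thesis using qpoch_inf_neq_0[OF q_lt_1] by simp
qed

end

section \<open>Laurent series on a circle\<close>

lemma has_integral_suminf:
  fixes f :: "nat \<Rightarrow> real \<Rightarrow> complex"
  assumes I: "\<And>n. (f n has_integral I n) {a..b}"
    and M: "\<And>n x. x \<in> {a..b} \<Longrightarrow> norm (f n x) \<le> M n" "summable M"
    and ab: "a \<le> b"
  shows "((\<lambda>x. \<Sum>n. f n x) has_integral (\<Sum>n. I n)) {a..b}"
proof -
  define g where "g x = (\<Sum>n. f n x)" for x
  define S where "S N x = (\<Sum>n<N. f n x)" for N x
  define t where "t N = (\<Sum>n. M (n + N))" for N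
  have M0: "M n \<ge> 0" for n
    using M(1)[of a n] ab norm_ge_zero[of "f n a"] by (metis atLeastAtMost_iff order_refl order_trans)
  have t0: "t \<longlonglongrightarrow> 0"
    unfolding t_def using suminf_exist_split2[OF M(2)] by simp
  have tail: "norm (g x - S N x) \<le> t N" if "x \<in> {a..b}" for x N
  proof -
    have sm: "summable (\<lambda>n. norm (f n x))"
      by (rule summable_comparison_test'[OF M(2), where N = 0]) (use M(1)[OF that] in auto)
    have "g x - S N x = (\<Sum>n. f (n + N) x)"
      unfolding g_def S_def using suminf_split_initial_segment[OF summable_norm_cancel[OF sm], of N]
          by simp
    also have "norm \<dots> \<le> (\<Sum>n. norm (f (n + N) x))"
      by (rule summable_norm) (rule summable_ignore_initial_segment[OF sm])
    also have "\<dots> \<le> t N"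
      unfolding t_def
      by (intro suminf_le M that summable_ignore_initial_segment[OF sm] summable_ignore_initial_segment[OF M(2)])
    finally show ?thesis .
  qed
  have SI: "(S N has_integral (\<Sum>n<N. I n)) {a..b}" for N
    unfolding S_def by (intro has_integral_sum I) simp
  have "g integrable_on cbox a b"
  proof (rule integrable_uniform_limit)
    fix e :: real assume "e > 0"
    hence "eventually (\<lambda>N. t N < e) sequentially" using t0 by (intro order_tendstoD(2))
    then obtain N where N: "t N < e" by (auto simp: eventually_sequentially)
    show "\<exists>h. (\<forall>x\<in>cbox a b. norm (g x - h x) \<le> e) \<and> h integrable_on cbox a b"
    proof (intro exI conjI ballI)
      show "norm (g x - S N x) \<le> e" if "x \<in> cbox a b" for x
        using tail[of x N] that N by simp
      show "S N integrable_on cbox a b"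
        using has_integral_integrable[OF SI[of N]] by simp
    qed
  qed
  then obtain J where J: "(g has_integral J) {a..b}" by (auto simp: integrable_on_def)
  have "norm (J - (\<Sum>n<N. I n)) \<le> t N * (b - a)" for N
  proof -
    have "((\<lambda>x. g x - S N x) has_integral (J - (\<Sum>n<N. I n))) (cbox a b)"
      using has_integral_diff[OF J SI] by simp
    moreover have "t N \<ge> 0" unfolding t_def
      by (intro suminf_nonneg summable_ignore_initial_segment[OF M(2)] M0)
    ultimately have "norm (J - (\<Sum>n<N. I n)) \<le> t N * measure lborel (cbox a b)"
      by (intro has_integral_bound) (use tail in auto)
    thus ?thesis using ab by simp
  qed
  hence "\<forall>\<^sub>F N in sequentially. norm (J - (\<Sum>n<N. I n)) \<le> t N * (b - a)"
    by (intro always_eventually allI)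
  hence "(\<lambda>N. J - (\<Sum>n<N. I n)) \<longlonglongrightarrow> 0"
    by (rule Lim_null_comparison[OF _ tendsto_mult_left_zero[OF t0]])
  hence "(\<lambda>N. J - (J - (\<Sum>n<N. I n))) \<longlonglongrightarrow> J - 0"
    by (intro tendsto_intros)
  hence "I sums J" by (simp add: sums_def)
  thus ?thesis using J unfolding g_def by (simp add: sums_iff)
qed

lemma has_integral_circle_powers:
  fixes k :: complex
  assumes "k \<noteq> 0"
  shows "((\<lambda>\<psi>. (k * cis \<psi>) ^ i * (1 / (k * cis \<psi>)) ^ j) has_integral
           (if i = j then 2 * of_real pi else 0)) {-pi..pi}"
proof (cases "i = j")
  case True
  have "(k * cis \<psi>) ^ i * (1 / (k * cis \<psi>)) ^ j = 1" for \<psi>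
    using assms by (simp add: True flip: power_mult_distrib)
  moreover have "((\<lambda>\<psi>. 1 :: complex) has_integral measure lborel {-pi..pi} *\<^sub>R 1) {-pi..pi}"
    by (rule has_integral_const_real)
  ultimately show ?thesis using True by (simp add: scaleR_conv_of_real)
next
  case False
  define m where "m = real i - real j"
  have m: "m \<noteq> 0" using False by (simp add: m_def)
  have eq: "(k * cis \<psi>) ^ i * (1 / (k * cis \<psi>)) ^ j = k ^ i / k ^ j * cis (m * \<psi>)" for \<psi>
    unfolding power_mult_distrib power_divide power_one
    by (simp add: Complex.DeMoivre m_def left_diff_distrib cis_divide [symmetric])
  have d: "((\<lambda>\<psi>. cis (m * \<psi>) / (\<i> * of_real m)) has_vector_derivative cis (m * \<psi>))
      (at \<psi> within {-pi..pi})" for \<psi>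
  proof -
    have "((\<lambda>x. exp (\<i> * (of_real m * x)) / (\<i> * of_real m)) has_field_derivative
        exp (\<i> * (of_real m * of_real \<psi>))) (at (of_real \<psi>))"
      by (auto intro!: derivative_eq_intros simp: m mult_ac)
    from has_vector_derivative_real_field[OF this, of "{-pi..pi}"] show ?thesis
      by (simp add: cis_conv_exp)
  qed
  have "((\<lambda>\<psi>. cis (m * \<psi>)) has_integral (cis (m * pi) / (\<i> * of_real m) - cis (m * (-pi)) / (\<i>
      * of_real m))) {-pi..pi}"
    by (rule fundamental_theorem_of_calculus[OF _ d]) simp
  moreover have "cis (m * pi) = cis (m * (- pi))"
  proof -
    have "cis (m * pi) / cis (m * (- pi)) = cis (2 * pi * m)" by (simp add: cis_divide mult_ac)
    also have "\<dots> = cis (2 * pi * of_int (int i - int j))" by (simp add: m_def)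
    also have "\<dots> = 1" by (rule cis_multiple_2pi) simp
    finally show ?thesis by simp
  qed
  ultimately have "((\<lambda>\<psi>. cis (m * \<psi>)) has_integral 0) {-pi..pi}" by simp
  hence "((\<lambda>\<psi>. k ^ i / k ^ j * cis (m * \<psi>)) has_integral (k ^ i / k ^ j * 0)) {-pi..pi}"
    by (rule has_integral_mult_right)
  thus ?thesis unfolding eq using False by simp
qed

text \<open>Only one-sided series are multiplied: the integral over the circle pairs the coefficient of \<open>s\<^sup>i\<close>
with that of \<open>s\<close> to the power \<open>-(i+n)\<close>.\<close>
lemma has_integral_laurent_product:
  fixes k :: complex
  assumes k: "k \<noteq> 0" and P: "fps_abs_summable P (norm k)" and D: "fps_abs_summable D (1 / norm k)"
  shows "((\<lambda>\<psi>. eval_fps P (k * cis \<psi>) * eval_fps D (1 / (k * cis \<psi>)) * (k * cis \<psi>) ^ n) has_integral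
           2 * of_real pi * (\<Sum>i. fps_nth P i * fps_nth D (i + n))) {-pi..pi}"
proof -
  define s where "s \<psi> = k * cis \<psi>" for \<psi>
  have ns: "norm (s \<psi>) = norm k" "norm (1 / s \<psi>) = 1 / norm k" for \<psi>
    by (simp_all add: s_def norm_mult norm_divide)
  have pi: "- pi \<le> pi" by simp
  have 1: "((\<lambda>\<psi>. s \<psi> ^ i * eval_fps D (1 / s \<psi>)) has_integral 2 * of_real pi
      * fps_nth D i) {-pi..pi}" for i
  proof -
    have "((\<lambda>\<psi>. \<Sum>j. fps_nth D j * (s \<psi> ^ i * (1 / s \<psi>) ^ j)) has_integral
         (\<Sum>j. fps_nth D j * (if i = j then 2 * of_real pi else 0))) {-pi..pi}"
    proof (rule has_integral_suminf[OF _ _ _ pi])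
      show "((\<lambda>\<psi>. fps_nth D j * (s \<psi> ^ i * (1 / s \<psi>) ^ j)) has_integral
         fps_nth D j * (if i = j then 2 * of_real pi else 0)) {-pi..pi}" for j
        unfolding s_def by (rule has_integral_mult_right[OF has_integral_circle_powers[OF k]])
      show "norm (fps_nth D j * (s \<psi> ^ i * (1 / s \<psi>) ^ j)) \<le> norm k ^ i * (norm (fps_nth D j) *
          (1 / norm k) ^ j)" for j \<psi>
        by (simp add: norm_mult norm_power ns del: power_one_over power_divide)
      show "summable (\<lambda>j. norm k ^ i * (norm (fps_nth D j) * (1 / norm k) ^ j))"
        using D unfolding fps_abs_summable_def by (rule summable_mult)
    qed
    moreover have "(\<Sum>j. fps_nth D j * (if i = j then 2 * of_real pi else 0)) = 2 * of_real pi
        * fps_nth D i"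
      by (subst suminf_finite[of "{i}"]) auto
    moreover have "(\<Sum>j. fps_nth D j * (s \<psi> ^ i * (1 / s \<psi>) ^ j)) = s \<psi> ^ i * eval_fps D (1 / s \<psi>)" for \<psi>
    proof -
      have "(\<lambda>j. s \<psi> ^ i * (fps_nth D j * (1 / s \<psi>) ^ j)) sums (s \<psi> ^ i * eval_fps D (1 / s \<psi>))"
        by (intro sums_mult fps_abs_summable_sums) (unfold ns, rule D)
      thus ?thesis by (simp add: sums_iff mult_ac)
    qed
    ultimately show ?thesis by simp
  qed
  define K where "K = (\<Sum>j. norm (fps_nth D j) * (1 / norm k) ^ j)"
  have K: "norm (eval_fps D (1 / s \<psi>)) \<le> K" for \<psi>
  proof -
    have "norm (eval_fps D (1 / s \<psi>)) \<le> (\<Sum>j. norm (fps_nth D j * (1 / s \<psi>) ^ j))"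
      unfolding eval_fps_def
      by (rule summable_norm) (use D ns fps_abs_summable_norm[of D "1 / s \<psi>"] in simp)
    also have "\<dots> = K" unfolding K_def norm_mult norm_power ns ..
    finally show ?thesis .
  qed
  have "((\<lambda>\<psi>. \<Sum>i. fps_nth P i * (s \<psi> ^ (i + n) * eval_fps D (1 / s \<psi>))) has_integral
         (\<Sum>i. fps_nth P i * (2 * of_real pi * fps_nth D (i + n)))) {-pi..pi}"
  proof (rule has_integral_suminf[OF _ _ _ pi])
    show "((\<lambda>\<psi>. fps_nth P i * (s \<psi> ^ (i + n) * eval_fps D (1 / s \<psi>))) has_integral
         fps_nth P i * (2 * of_real pi * fps_nth D (i + n))) {-pi..pi}" for i
      by (rule has_integral_mult_right[OF 1])
    show "norm (fps_nth P i * (s \<psi> ^ (i + n) * eval_fps D (1 / s \<psi>)))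
        \<le> norm k ^ n * K * (norm (fps_nth P i) * norm k ^ i)" for i \<psi>
    proof -
      have "norm (fps_nth P i * (s \<psi> ^ (i + n) * eval_fps D (1 / s \<psi>)))
        = norm k ^ n * (norm (fps_nth P i) * norm k ^ i) * norm (eval_fps D (1 / s \<psi>))"
        by (simp add: norm_mult norm_power ns power_add)
      also have "\<dots> \<le> norm k ^ n * (norm (fps_nth P i) * norm k ^ i) * K"
        by (intro mult_left_mono K) auto
      finally show ?thesis by (simp add: mult_ac)
    qed
    show "summable (\<lambda>i. norm k ^ n * K * (norm (fps_nth P i) * norm k ^ i))"
      using P unfolding fps_abs_summable_def by (rule summable_mult)
  qed
  moreover have "(\<Sum>i. fps_nth P i * (2 * of_real pi * fps_nth D (i + n))) =
      2 * of_real pi * (\<Sum>i. fps_nth P i * fps_nth D (i + n))"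
  proof -
    have r: "norm k > 0" "1 / norm k > 0" using k by auto
    obtain C where C: "C \<ge> 0" "\<And>n. norm (fps_nth D n) \<le> C * (1 / (1 / norm k)) ^ n"
      using fps_abs_summable_coeff_bound[OF D r(2)] by blast
    have "summable (\<lambda>i. norm (fps_nth P i * fps_nth D (i + n)))"
    proof (rule summable_comparison_test'[where N = 0])
      show "summable (\<lambda>i. C * norm k ^ n * (norm (fps_nth P i) * norm k ^ i))"
        using P unfolding fps_abs_summable_def by (rule summable_mult)
      fix i
      have "norm (fps_nth P i * fps_nth D (i + n)) \<le> norm (fps_nth P i) * (C * norm k ^ (i + n))"
        unfolding norm_mult using C(2)[of "i + n"] by (intro mult_left_mono) auto
      thus "norm (norm (fps_nth P i * fps_nth D (i + n))) \<le> C * norm k ^ n * (norm (fps_nth P i)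
          * norm k ^ i)"
        by (simp add: power_add mult_ac)
    qed
    hence "summable (\<lambda>i. fps_nth P i * fps_nth D (i + n))" by (rule summable_norm_cancel)
    from suminf_mult[OF this, of "2 * of_real pi"] show ?thesis by (simp add: mult_ac)
  qed
  moreover have "(\<Sum>i. fps_nth P i * (s \<psi> ^ (i + n) * eval_fps D (1 / s \<psi>))) =
      eval_fps P (s \<psi>) * eval_fps D (1 / s \<psi>) * s \<psi> ^ n" for \<psi>
  proof -
    have "(\<lambda>i. fps_nth P i * s \<psi> ^ i * (eval_fps D (1 / s \<psi>) * s \<psi> ^ n)) sums
        (eval_fps P (s \<psi>) * (eval_fps D (1 / s \<psi>) * s \<psi> ^ n))"
      by (intro sums_mult2 fps_abs_summable_sums) (unfold ns, rule P)
    thus ?thesis by (simp add: sums_iff power_add mult_ac)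
  qed
  ultimately show ?thesis unfolding s_def by simp
qed

context q_series
begin

section \<open>Moments of the theta quotient\<close>

text \<open>The part \<open>(Hs)(qs/(Hy))\<close> of \<open>\<theta>(Hs)\<theta>(Hy/s)\<close> that is a power series in \<open>s\<close>. The other part,
divided by \<open>(1/s)(y/s)\<close>, is the series \<open>theta_neg\<close> in \<open>1/s\<close>.\<close>
definition theta_pos :: "complex \<Rightarrow> complex \<Rightarrow> complex fps" where
  "theta_pos H y = fps_qpoch H * fps_qpoch (q / (H * y))"

definition theta_neg :: "complex \<Rightarrow> complex \<Rightarrow> complex fps" where
  "theta_neg H y = fps_qbinom (q / H) 1 * fps_qbinom H y"

text \<open>By \<open>has_integral_laurent_product\<close>, the average of \<open>s\<^sup>n\<close> times the theta quotient.\<close>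
definition moment :: "complex \<Rightarrow> complex \<Rightarrow> nat \<Rightarrow> complex" where
  "moment H y n = (\<Sum>i. fps_nth (theta_pos H y) i * fps_nth (theta_neg H y) (i + n))"

lemma fps_abs_summable_theta_pos: "r \<ge> 0 \<Longrightarrow> fps_abs_summable (theta_pos H y) r"
  unfolding theta_pos_def by (intro fps_abs_summable_mult fps_abs_summable_qpoch)

lemma fps_abs_summable_theta_neg:
  "0 \<le> r \<Longrightarrow> r < 1 \<Longrightarrow> norm y * r < 1 \<Longrightarrow> fps_abs_summable (theta_neg H y) r"
  unfolding theta_neg_def by (intro fps_abs_summable_mult fps_abs_summable_qbinom) auto

lemma theta_neg_coeff_bound:
  obtains C R where "C \<ge> 0" "R > 0" "\<And>n. norm (fps_nth (theta_neg H y) n) \<le> C * R ^ n"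
proof -
  \<comment> \<open>Any radius below 1 and below \<open>1/\<bar>y\<bar>\<close> would do.\<close>
  define r where "r = 1 / (2 + norm y)"
  have r: "0 < r" "r < 1" "norm y * r < 1"
    using norm_ge_zero[of y] by (simp_all add: r_def field_simps add_pos_nonneg del: norm_ge_zero)
  obtain C where "C \<ge> 0" "\<And>n. norm (fps_nth (theta_neg H y) n) \<le> C * (1 / r) ^ n"
    using fps_abs_summable_coeff_bound[OF fps_abs_summable_theta_neg r(1), of y H] r by auto
  thus ?thesis using that[of C "1 / r"] r by auto
qed

lemma summable_theta_pos_mult:
  assumes "C \<ge> 0" "R > 0" "\<And>n. norm (E n) \<le> C * R ^ n"
  shows "summable (\<lambda>i. norm (fps_nth (theta_pos H y) i * E (i + n)))"
proof (rule summable_comparison_test'[where N = 0])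
  show "summable (\<lambda>i. C * R ^ n * (norm (fps_nth (theta_pos H y) i) * R ^ i))"
    using fps_abs_summable_theta_pos[of R H y] assms unfolding fps_abs_summable_def
    by (intro summable_mult) auto
  fix i
  have "norm (fps_nth (theta_pos H y) i * E (i + n)) \<le> norm (fps_nth (theta_pos H y) i) * (C * R ^
      (i + n))"
    unfolding norm_mult by (intro mult_left_mono assms) auto
  thus "norm (norm (fps_nth (theta_pos H y) i * E (i + n))) \<le> C * R ^ n * (norm (fps_nth
      (theta_pos H y) i) * R ^ i)"
    by (simp add: power_add mult_ac)
qed

text \<open>The coefficients of \<open>theta_neg\<close> are shifted by one place, so that the first relation is the
instance \<open>n = -1\<close> of the second: there the factor \<open>1 - q\<^sup>n\<^sup>+\<^sup>1\<close> vanishes.\<close>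
lemma moment_recurrences:
  assumes q: "q \<noteq> 0" and H: "H \<noteq> 0" and y: "y \<noteq> 0"
  shows "moment H y (Suc 0) = (1 + y) * moment H y 0"
    and "moment H y (Suc (Suc n)) = (1 + y) * moment H y (Suc n) - y * (1 - q ^ Suc n) * moment H y n"
proof -
  define P where "P = fps_nth (theta_pos H y)"
  define D where "D = fps_nth (theta_neg H y)"
  \<comment> \<open>The shift by one place is what makes the relation for \<open>E\<close> valid from \<open>k = 0\<close> on.\<close>
  define E where "E k = (case k of 0 \<Rightarrow> 0 | Suc m \<Rightarrow> D m)" for k
  define t where "t = q / H + H * y"
  have Dd: "(1 - fps_const 1 * fps_X) * ((1 - fps_const y * fps_X) * theta_neg H y) =
      (1 - fps_const (q / H * 1) * fps_X) * ((1 - fps_const (H * y) * fps_X) * dilate (theta_neg H y))"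
    unfolding theta_neg_def by (rule fps_qbinom_pair_dilate)
  have Pd: "theta_pos H y =
      (1 - fps_const H * fps_X) * ((1 - fps_const (q / (H * y)) * fps_X) * dilate (theta_pos H y))"
    unfolding theta_pos_def dilate_mult
    by (subst (1 2) fps_qpoch_dilate) (simp only: mult_ac)
  have E_rel: "E (k + 2) - (1 + y) * E (k + 1) + y * E k
               = q ^ (k + 1) * E (k + 2) - t * q ^ k * E (k + 1) + y * q ^ k * E k" for k
  proof (cases k)
    case 0
    show ?thesis
      using arg_cong[OF Dd, of "\<lambda>F. fps_nth F (Suc 0)"]
      unfolding two_linear_factors_nth by (simp add: 0 E_def D_def t_def)
  next
    case (Suc m)
    show ?thesis
      using arg_cong[OF Dd, of "\<lambda>F. fps_nth F (Suc (Suc m))"] H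
      unfolding two_linear_factors_nth by (simp add: Suc E_def D_def t_def mult_ac)
  qed
  have yt: "y * (H + q / (H * y)) = t" "y * (H * (q / (H * y))) = q"
    using H y by (simp_all add: t_def field_simps)
  have P1: "y * P 1 = y * q * P 1 - t * P 0"
  proof -
    have "P 1 = q * P 1 - (H + q / (H * y)) * P 0"
      using arg_cong[OF Pd, of "\<lambda>F. fps_nth F (Suc 0)"]
      unfolding two_linear_factors_nth by (simp add: P_def)
    hence "y * P 1 = y * (q * P 1 - (H + q / (H * y)) * P 0)" by (rule arg_cong)
    also have "\<dots> = y * q * P 1 - (y * (H + q / (H * y))) * P 0" by
        (simp only: right_diff_distrib mult.assoc)
    finally show ?thesis unfolding yt .
  qed
  have P2: "y * P (k + 2) = y * q ^ (k + 2) * P (k + 2) - t * q ^ (k + 1) * P (k + 1) + q ^ (k + 1)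
      * P k" for k
  proof -
    have regroup: "y * (a * b - c * d + e * f) = y * a * b - (y * c) * d + (y * e) * f" for a b c d e f
      by (simp add: algebra_simps)
    have "P (k + 2) = q ^ (k + 2) * P (k + 2) - (H + q / (H * y)) * (q ^ (k + 1) * P (k + 1)) + H *
        (q / (H * y)) * (q ^ k * P k)"
      using arg_cong[OF Pd, of "\<lambda>F. fps_nth F (Suc (Suc k))"]
      unfolding two_linear_factors_nth dilate_nth by
          (simp only: P_def add_2_eq_Suc' Suc_eq_plus1 [symmetric])
    hence "y * P (k + 2) = y * (q ^ (k + 2) * P (k + 2) - (H + q / (H * y)) * (q ^ (k + 1) * P (k
        + 1)) + H * (q / (H * y)) * (q ^ k * P k))"
      by (rule arg_cong)
    also have "\<dots> = y * q ^ (k + 2) * P (k + 2) - (y * (H + q / (H * y))) * (q ^ (k + 1) * P (k + 1))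
        + (y * (H * (q / (H * y)))) * (q ^ k * P k)"
      by (rule regroup)
    finally show ?thesis unfolding yt by (simp add: mult_ac)
  qed
  obtain C R where CR: "C \<ge> 0" "R > 0" "\<And>n. norm (D n) \<le> C * R ^ n"
    using theta_neg_coeff_bound[of H y] unfolding D_def by blast
  have sm: "summable (\<lambda>i. norm (P i * E (i + n)))" for n
    unfolding P_def
  proof (rule summable_theta_pos_mult[where R = R and C = "C / R"])
    show "norm (E n) \<le> C / R * R ^ n" for n
      using CR by (cases n) (auto simp: E_def)
  qed (use CR in auto)
  have m: "(\<Sum>i. P i * E (i + Suc n)) = moment H y n" for n
    by (simp add: moment_def P_def D_def E_def)
  note rec = moment_recurrence[of E y t P, OF E_rel P1 P2 sm]
  show "moment H y (Suc 0) = (1 + y) * moment H y 0"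
    using rec[of 0] m[of 0] m[of "Suc 0"] by (simp add: eval_nat_numeral)
  show "moment H y (Suc (Suc n)) = (1 + y) * moment H y (Suc n) - y * (1 - q ^ Suc n) * moment H y n"
    using rec[of "Suc n"] m[of n] m[of "Suc n"] m[of "Suc (Suc n)"] by (simp add: eval_nat_numeral)
qed

lemma moment_rogers_szego:
  assumes "q \<noteq> 0" "H \<noteq> 0" "y \<noteq> 0"
  shows "moment H y n = rogers_szego y n * moment H y 0"
proof (induction n rule: less_induct)
  case (less n)
  consider "n = 0" | "n = Suc 0" | m where "n = Suc (Suc m)" by (metis old.nat.exhaust)
  thus ?case
  proof cases
    case 2
    thus ?thesis using moment_recurrences(1)[OF assms] by (simp add: rogers_szego_1)
  next
    case (3 m)
    thus ?thesis using moment_recurrences(2)[OF assms, of m] less[of m] less[of "Suc m"]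
      by (simp add: rogers_szego_rec algebra_simps)
  qed simp
qed

text \<open>Both \<open>m\<^sub>n\<^sub>+\<^sub>1 - y m\<^sub>n\<close> and \<open>h\<^sub>n\<^sub>+\<^sub>1 - y h\<^sub>n\<close> have computable limits, and \<open>m\<^sub>n = h\<^sub>n m\<^sub>0\<close>. So \<open>m\<^sub>0\<close> is the
quotient of the two limits.\<close>
lemma moment_0_disc:
  assumes "q \<noteq> 0" "H \<noteq> 0" "y \<noteq> 0" "norm y \<le> 1"
  shows "moment H y 0 = qpoch_inf H q * qpoch_inf (q / H) q *
           (qpoch_inf (H * y) q * qpoch_inf (q / (H * y)) q) / qpoch_inf q q"
proof -
  define P where "P = fps_nth (theta_pos H y)"
  define D where "D = fps_nth (theta_neg H y)"
  define \<delta> where "\<delta> k = D (Suc k) - y * D k" for k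
  define L where "L = qpoch_inf (q / H) q * qpoch_inf (H * y) q / (qpoch_inf q q * qpoch_inf (q * y) q)"
  have \<delta>: "\<delta> \<longlonglongrightarrow> L"
    unfolding \<delta>_def D_def L_def theta_neg_def by (rule fps_pair_coeff_limit[OF assms(4)])
  obtain C R where CR: "C \<ge> 0" "R > 0" "\<And>n. norm (D n) \<le> C * R ^ n"
    using theta_neg_coeff_bound[of H y] unfolding D_def by blast
  have s: "summable (\<lambda>i. P i * D (i + n))" for n
    unfolding P_def by (rule summable_norm_cancel[OF summable_theta_pos_mult[OF CR]])
  have P1: "summable (\<lambda>i. norm (P i))"
    using fps_abs_summable_theta_pos[of 1 H y] by (simp add: fps_abs_summable_def P_def)
  have e: "moment H y (Suc n) - y * moment H y n = (\<Sum>i. P i * \<delta> (i + n))" for n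
  proof -
    have "(\<lambda>i. P i * D (i + Suc n) - y * (P i * D (i + n))) sums (moment H y (Suc n) - y
        * moment H y n)"
      unfolding moment_def P_def [symmetric] D_def [symmetric]
      by (intro sums_diff sums_mult summable_sums s)
    thus ?thesis by (simp add: sums_iff \<delta>_def algebra_simps)
  qed
  have "Bseq \<delta>" using \<delta> by (intro convergent_imp_Bseq convergentI)
  then obtain B where B: "B > 0" "\<And>k. norm (\<delta> k) \<le> B" unfolding Bseq_def by blast
  have "((\<lambda>n. \<Sum>i. P i * \<delta> (i + n)) \<longlongrightarrow> (\<Sum>i. P i * L)) sequentially"
  proof (intro conjunct2[OF conjunct2[OF tannerys_theorem[where M = "\<lambda>i. norm (P i) * B"]]])
    show "(\<lambda>n. P k * \<delta> (k + n)) \<longlonglongrightarrow> P k * L" for k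
      by (intro tendsto_intros LIMSEQ_ignore_initial_segment[OF \<delta>, of k, unfolded add.commute[of _ k]])
    show "\<forall>\<^sub>F (k, n) in sequentially \<times>\<^sub>F sequentially. norm (P k * \<delta> (k + n)) \<le> norm (P k) * B"
      using B by (intro always_eventually) (auto simp: norm_mult intro!: mult_left_mono)
    show "summable (\<lambda>i. norm (P i) * B)" using P1 by (rule summable_mult2)
  qed auto
  moreover have "(\<Sum>i. P i * L) = eval_fps (theta_pos H y) 1 * L"
    using suminf_mult2[OF summable_norm_cancel[OF P1], of L] by (simp add: eval_fps_def P_def)
  moreover have "eval_fps (theta_pos H y) 1 = qpoch_inf H q * qpoch_inf (q / (H * y)) q"
    unfolding theta_pos_def by (simp add: eval_fps_mult_abs fps_abs_summable_qpoch eval_fps_qpoch)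
  ultimately have lim1: "(\<lambda>n. moment H y (Suc n) - y * moment H y n) \<longlonglongrightarrow> qpoch_inf H q * qpoch_inf
      (q / (H * y)) q * L"
    unfolding e by simp
  have "(\<lambda>n. (rogers_szego y (Suc n) - y * rogers_szego y n) * moment H y 0)
     \<longlonglongrightarrow> 1 / qpoch_inf (q * y) q * moment H y 0"
    by (intro tendsto_mult_right rogers_szego_limit assms)
  moreover have "(rogers_szego y (Suc n) - y * rogers_szego y n) * moment H y 0
      = moment H y (Suc n) - y * moment H y n" for n
    by (subst (2 3) moment_rogers_szego[OF assms(1-3)]) (simp add: algebra_simps)
  ultimately have "1 / qpoch_inf (q * y) q * moment H y 0 = qpoch_inf H q * qpoch_inf (q / (H
      * y)) q * L"
    using LIMSEQ_unique[OF _ lim1] by simp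
  moreover have "norm (q * y) < 1"
    using mult_left_mono[OF assms(4), of "norm q"] q_lt_1 by (simp add: norm_mult)
  hence "qpoch_inf (q * y) q \<noteq> 0" by (rule qpoch_inf_neq_0)
  ultimately show ?thesis by (simp add: L_def field_simps)
qed

lemma fps_nth_mult_scale:
  fixes c :: complex
  assumes "\<And>n. fps_nth F' n = fps_nth F n * c ^ n" "\<And>n. fps_nth G' n = fps_nth G n * c ^ n"
  shows "fps_nth (F' * G') n = fps_nth (F * G) n * c ^ n"
  unfolding fps_mult_nth_power [symmetric] by (simp add: fps_mult_nth atLeast0AtMost assms)

text \<open>The substitution \<open>s \<mapsto> ys\<close> exchanges the two families of poles and replaces \<open>(H, y)\<close> by \<open>(Hy, 1/y)\<close>;
it reduces \<open>\<bar>y\<bar> > 1\<close> to \<open>\<bar>y\<bar> < 1\<close>.\<close>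
lemma moment_0_swap:
  assumes "H \<noteq> 0" "y \<noteq> 0"
  shows "moment H y 0 = moment (H * y) (1 / y) 0"
proof -
  have sc: "fps_nth (fps_qpoch (a * c)) n = fps_nth (fps_qpoch a) n * c ^ n"
           "fps_nth (fps_inv_qpoch (a * c)) n = fps_nth (fps_inv_qpoch a) n * c ^ n" for a c n
    by (simp_all add: power_mult_distrib)
  have P: "fps_nth (theta_pos (H * y) (1 / y)) n = fps_nth (theta_pos H y) n * y ^ n" for n
  proof -
    have "theta_pos (H * y) (1 / y) = fps_qpoch (H * y) * fps_qpoch (q / (H * y) * y)"
      using assms by (simp add: theta_pos_def)
    thus ?thesis unfolding theta_pos_def by (simp only:) (intro fps_nth_mult_scale sc)
  qed
  have D: "fps_nth (theta_neg (H * y) (1 / y)) n = fps_nth (theta_neg H y) n * (1 / y) ^ n" for n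
  proof -
    have 1: "theta_neg (H * y) (1 / y) =
       (fps_qpoch (q / H * (1 / y)) * fps_inv_qpoch (1 * (1 / y))) * (fps_qpoch (H * y * (1 / y))
           * fps_inv_qpoch (y * (1 / y)))"
      using assms unfolding theta_neg_def fps_qbinom_factor[of "q / (H
          * y)"] fps_qbinom_factor[of "H * y"]
      by (simp add: mult_ac)
    have 2: "theta_neg H y = (fps_qpoch (q / H) * fps_inv_qpoch 1) * (fps_qpoch (H * y)
        * fps_inv_qpoch y)"
      unfolding theta_neg_def fps_qbinom_factor[of "q / H"] fps_qbinom_factor[of H] by simp
    show ?thesis unfolding 1 2 by (intro fps_nth_mult_scale sc)
  qed
  show ?thesis unfolding moment_def P D
    using assms by (simp add: power_divide mult_ac)
qed

lemma moment_0:
  assumes "q \<noteq> 0" "H \<noteq> 0" "y \<noteq> 0"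
  shows "moment H y 0 = qtheta H q * qtheta (H * y) q / qpoch_inf q q"
proof (cases "norm y \<le> 1")
  case True
  show ?thesis
    unfolding moment_0_disc[OF assms True] by (simp add: qtheta_def qpochs_inf_def)
next
  case False
  hence "norm (1 / y) \<le> 1" by (simp add: norm_divide divide_le_eq)
  from moment_0_disc[OF _ _ _ this, of "H * y"] assms show ?thesis
    unfolding moment_0_swap[OF assms(2,3)] by (simp add: qtheta_def qpochs_inf_def mult_ac)
qed

end

section \<open>Terminating convolutions\<close>

lemma binomial_two_add: "(m + i) * (m + i - 1) div 2 = m * (m - 1) div 2 + i * (i - 1) div 2 + m *
    (i::nat)"
proof (induction i)
  case (Suc i)
  have "(m + Suc i) * (m + Suc i - 1) div 2 = Suc (m + i) * (Suc (m + i) - 1) div 2" by simp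
  thus ?case unfolding binomial_two_Suc Suc by simp
qed simp

context q_series
begin

definition inv_qfact :: "nat \<Rightarrow> complex" where
  "inv_qfact n = 1 / qpoch q q n"

lemma inv_qfact_0 [simp]: "inv_qfact 0 = 1"
  by (simp add: inv_qfact_def)

lemma inv_qfact_Suc: "(1 - q ^ Suc n) * inv_qfact (Suc n) = inv_qfact n"
  using one_minus_q_power_neq_0[of n] by (simp add: inv_qfact_def qpoch_q_Suc del: power_Suc)

lemma inv_qfact_rogers_szego: "inv_qfact n * rogers_szego y n = fps_nth (fps_inv_qpoch 1
    * fps_inv_qpoch y) n"
  by (simp add: inv_qfact_def rogers_szego_def)

lemma euler_coeff_mult:
  "euler_coeff m * euler_coeff i * q ^ (m * i) =
     (-1) ^ (m + i) * q ^ ((m + i) * (m + i - 1) div 2) * (inv_qfact m * inv_qfact i)"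
  unfolding binomial_two_add euler_coeff_def inv_qfact_def by (simp add: power_add)

text \<open>This finite identity is the combinatorial core of the product formula. The sum over \<open>l\<close> is the
coefficient of \<open>(X)\<^sub>\<infinity> \<cdot> (WX)\<^sub>\<infinity>/(X)\<^sub>\<infinity> = (WX)\<^sub>\<infinity>\<close> with \<open>W = Z q\<^sup>m\<close>, where \<open>m = r - i\<close> (here \<open>X\<close> is the formal
variable); what is left is a coefficient in \<open>fps_qbinom_chain\<close>.\<close>
lemma triple_convolution:
  "(\<Sum>i\<le>r. \<Sum>l\<le>i. qpoch X q i * qpoch Z q (r - l) * (euler_coeff l * euler_coeff (r - i) * inv_qfact
      (i - l)))
     = qpoch (X * Z) q r * euler_coeff r"
proof -
  have inner: "(\<Sum>l\<le>i. euler_coeff l * (qpoch W q (i - l) * inv_qfact (i - l))) = euler_coeff i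
      * W ^ i" for W i
  proof -
    have "fps_qpoch 1 * fps_qbinom W 1 = fps_qpoch W"
      using fps_qpoch_inverse[of 1] by (simp add: fps_qbinom_factor[of W 1] mult_ac)
    hence "fps_nth (fps_qpoch 1 * fps_qbinom W 1) i = euler_coeff i * W ^ i" by simp
    thus ?thesis by (simp add: fps_mult_nth atLeast0AtMost inv_qfact_def)
  qed
  have "(\<Sum>l\<le>i. qpoch X q i * qpoch Z q (r - l) * (euler_coeff l * euler_coeff (r - i) * inv_qfact (i
      - l)))
      = (-1) ^ r * q ^ (r * (r - 1) div 2) * ((qpoch X q i * inv_qfact i * Z ^ i) * (qpoch Z q (r
          - i) * inv_qfact (r - i)))"
    if "i \<le> r" for i
  proof -
    define m where "m = r - i"
    have r: "r = m + i" using that by (simp add: m_def)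
    have Zl: "qpoch Z q (r - l) = qpoch Z q m * qpoch (Z * q ^ m) q (i - l)" if "l \<le> i" for l
      using qpoch_add[of Z q m "i - l"] that by (simp add: r)
    have "(\<Sum>l\<le>i. qpoch X q i * qpoch Z q (r - l) * (euler_coeff l * euler_coeff (r - i) * inv_qfact
        (i - l)))
       = (\<Sum>l\<le>i. qpoch X q i * qpoch Z q m * euler_coeff m * (euler_coeff l * (qpoch (Z * q ^ m) q (i
           - l) * inv_qfact (i - l))))"
    proof (rule sum.cong[OF refl])
      fix l assume "l \<in> {..i}"
      hence l: "l \<le> i" by simp
      show "qpoch X q i * qpoch Z q (r - l) * (euler_coeff l * euler_coeff (r - i) * inv_qfact (i
          - l)) =
        qpoch X q i * qpoch Z q m * euler_coeff m * (euler_coeff l * (qpoch (Z * q ^ m) q (i - l)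
            * inv_qfact (i - l)))"
        unfolding Zl[OF l] m_def [symmetric] by (simp only: mult_ac)
    qed
    also have "\<dots> = qpoch X q i * qpoch Z q m * euler_coeff m * (euler_coeff i * (Z * q ^ m) ^ i)"
      unfolding sum_distrib_left [symmetric] inner ..
    also have "\<dots> = qpoch X q i * qpoch Z q m * Z ^ i * (euler_coeff m * euler_coeff i * q ^ (m * i))"
      by (simp add: power_mult_distrib power_mult)
    also have "\<dots> = (-1) ^ r * q ^ (r * (r - 1) div 2) * ((qpoch X q i * inv_qfact i * Z ^ i) *
        (qpoch Z q m * inv_qfact m))"
      unfolding euler_coeff_mult r by (simp only: mult_ac)
    finally show ?thesis unfolding m_def .
  qed
  hence "(\<Sum>i\<le>r. \<Sum>l\<le>i. qpoch X q i * qpoch Z q (r - l) * (euler_coeff l * euler_coeff (r - i)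
      * inv_qfact (i - l)))
     = (\<Sum>i\<le>r. (-1) ^ r * q ^ (r * (r - 1) div 2) * ((qpoch X q i * inv_qfact i * Z ^ i) * (qpoch Z q
         (r - i) * inv_qfact (r - i))))"
    by (intro sum.cong) simp_all
  also have "\<dots> = (-1) ^ r * q ^ (r * (r - 1) div 2) * fps_nth (fps_qbinom X (Z * 1) * fps_qbinom Z 1) r"
    by (simp add: sum_distrib_left fps_mult_nth atLeast0AtMost inv_qfact_def)
  also have "\<dots> = qpoch (X * Z) q r * euler_coeff r"
    unfolding fps_qbinom_chain by (simp add: euler_coeff_def)
  finally show ?thesis .
qed

text \<open>With the value 0 at negative integers the relation \<open>(1 - q\<^sup>k)/(q;q)\<^sub>k = 1/(q;q)\<^sub>k\<^sub>-\<^sub>1\<close> holds for every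
integer \<open>k\<close>, so that sums over the linearization index can be shifted without boundary terms.\<close>
definition inv_qfact_int :: "int \<Rightarrow> complex" where
  "inv_qfact_int k = (if k < 0 then 0 else inv_qfact (nat k))"

definition rogers_szego_int :: "complex \<Rightarrow> int \<Rightarrow> complex" where
  "rogers_szego_int y k = (if k < 0 then 0 else rogers_szego y (nat k))"

lemma inv_qfact_int_rec:
  assumes "q \<noteq> 0" shows "inv_qfact_int (k - 1) = (1 - q powi k) * inv_qfact_int k"
proof -
  consider "k < 0" | "k = 0" | n where "k = int (Suc n)"
    by (metis int_cases2 linorder_neqE_linordered_idom nat_int_comparison(2) not0_implies_Suc of_nat_0 zero_less_imp_eq_int)
  thus ?thesis
  proof cases
    case (3 n)
    have "nat (int (Suc n) - 1) = n" "nat (int (Suc n)) = Suc n" by simp_all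
    thus ?thesis using inv_qfact_Suc[of n] unfolding 3 inv_qfact_int_def power_int_of_nat by simp
  qed (simp_all add: inv_qfact_int_def)
qed

lemma rogers_szego_int_rec:
  assumes "k \<ge> 0"
  shows "(1 + y) * rogers_szego_int y k = rogers_szego_int y (k + 1) + y * (1 - q powi k)
      * rogers_szego_int y (k - 1)"
proof -
  obtain n where n: "k = int n" using assms nonneg_int_cases by blast
  show ?thesis
  proof (cases n)
    case 0 thus ?thesis by (simp add: n rogers_szego_int_def rogers_szego_1)
  next
    case (Suc m)
    have "nat (int (Suc m) - 1) = m" "nat (int (Suc m)) = Suc m" "nat (int (Suc m) + 1) = Suc
        (Suc m)" by simp_all
    thus ?thesis unfolding n Suc rogers_szego_int_def power_int_of_nat
      by (simp add: rogers_szego_rec del: power_Suc)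
  qed
qed

text \<open>Induction on \<open>i\<close> by the three-term recurrence in \<open>h\<^sub>i\<close>. With \<open>a = q\<^sup>i\<^sup>-\<^sup>m\<close>, \<open>b = q\<^sup>j\<^sup>-\<^sup>m\<close>, \<open>N = q\<^sup>m\<^sup>+\<^sup>1\<close>, comparing
the coefficients of one \<open>h\<^sub>k\<close> comes down to
\<open>(1 - aN)(1 - b) = (1 - a)(1 - b) + (1 - N)(1 - ab) - (1 - N)(1 - a)\<close>.\<close>
lemma rogers_szego_linearization:
  assumes q: "q \<noteq> 0"
  shows "(\<Sum>n\<le>min i j. inv_qfact n * y ^ n * (inv_qfact (i - n) * inv_qfact (j - n)) * rogers_szego y
      ((i - n) + (j - n)))
     = (inv_qfact i * rogers_szego y i) * (inv_qfact j * rogers_szego y j)"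
proof -
  define t where "t n i = inv_qfact n * y ^ n * (inv_qfact_int (i - int n) * inv_qfact_int (int j
      - int n))
      * rogers_szego_int y (i + int j - 2 * int n)" for n i
  define S where "S i = (\<Sum>n\<le>Suc (i + j). t n (int i))" for i :: nat
  define T where "T K i = (\<Sum>n\<le>K. t n i)" for K i
  have rec: "(1 - q powi (i + 1)) * T K (i + 1) = (1 + y) * T K i - y * T K (i - 1)"
    if "i < int K" for i K
  proof -
    \<comment> \<open>The recurrence of \<open>h\<close> turns \<open>(1 + y) t n i\<close> into \<open>A n + C (n + 1)\<close>, while \<open>y t n (i - 1)\<close> is \<open>G (n + 1)\<close>. Since
\<open>K > i\<close>, the shifts lose no term.\<close>
    define A where "A n = inv_qfact n * y ^ n * (inv_qfact_int (i - int n) * inv_qfact_int (int j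
        - int n))
      * rogers_szego_int y (i + 1 + int j - 2 * int n)" for n
    define C where "C n = (if n = 0 then 0 else inv_qfact (n - 1) * y ^ n * (inv_qfact_int (i
        - int n + 1) * inv_qfact_int (int j - int n + 1))
      * ((1 - q powi (i + int j - 2 * int n + 2)) * rogers_szego_int y (i + 1 + int j - 2
          * int n)))" for n
    define G where "G n = (if n = 0 then 0 else inv_qfact (n - 1) * y ^ n * (inv_qfact_int (i
        - int n) * inv_qfact_int (int j - int n + 1))
      * rogers_szego_int y (i + 1 + int j - 2 * int n))" for n
    have 1: "(1 + y) * t n i = A n + C (Suc n)" for n
    proof (cases "int n \<le> i \<and> n \<le> j")
      case True
      hence "i + int j - 2 * int n \<ge> 0" by linarith
      note r = rogers_szego_int_rec[OF this, of y]
      have "(1 + y) * t n i = inv_qfact n * y ^ n * (inv_qfact_int (i - int n) * inv_qfact_int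
          (int j - int n)) *
         ((1 + y) * rogers_szego_int y (i + int j - 2 * int n))"
        unfolding t_def by (simp only: mult_ac)
      also note r
      finally have "(1 + y) * t n i = inv_qfact n * y ^ n * (inv_qfact_int (i - int n)
          * inv_qfact_int (int j - int n)) *
         (rogers_szego_int y (i + int j - 2 * int n + 1) + y * (1 - q powi (i + int j - 2 * int n))
             * rogers_szego_int y (i + int j - 2 * int n - 1))" .
      thus ?thesis by (simp add: A_def C_def algebra_simps)
    next
      case False
      hence "inv_qfact_int (i - int n) * inv_qfact_int (int j - int n) = 0"
        by (auto simp: inv_qfact_int_def)
      thus ?thesis by (auto simp: t_def A_def C_def)
    qed
    have 2: "y * t n (i - 1) = G (Suc n)" for n
      by (simp add: t_def G_def algebra_simps)
    have 3: "(1 - q powi (i + 1)) * t n (i + 1) = A n + C n - G n" for n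
    proof (cases n)
      case 0
      have "inv_qfact_int i = (1 - q powi (i + 1)) * inv_qfact_int (i + 1)"
        using inv_qfact_int_rec[OF q, of "i + 1"] by simp
      thus ?thesis by (simp add: 0 t_def A_def C_def G_def)
    next
      case (Suc m)
      define a where "a = q powi (i - int m)"
      define b where "b = q powi (int j - int m)"
      define N where "N = q ^ Suc m"
      define e1 where "e1 = inv_qfact_int (i - int m)"
      define e2 where "e2 = inv_qfact_int (int j - int m)"
      have e: "inv_qfact_int (i - int m - 1) = (1 - a) * e1" "inv_qfact_int (int j - int m - 1) = (1
          - b) * e2"
        "inv_qfact m = (1 - N) * inv_qfact (Suc m)"
        using inv_qfact_int_rec[OF q] inv_qfact_Suc[of m] by
            (simp_all add: a_def b_def e1_def e2_def N_def)
      have N: "N = q powi (int m + 1)"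
        using power_int_of_nat[of q "Suc m"] by (simp add: N_def add.commute)
      have p: "q powi (i + 1) = a * N" "q powi (i + int j - 2 * int m) = a * b"
        unfolding N a_def b_def by (simp_all add: q flip: power_int_add)
      define h where "h = rogers_szego_int y (i + int j - 1 - 2 * int m)"
      have T1: "t n (i + 1) = inv_qfact (Suc m) * y ^ Suc m * (e1 * ((1 - b) * e2)) * h"
        unfolding e [symmetric] t_def h_def e1_def Suc by (simp add: algebra_simps)
      have T2: "A n = inv_qfact (Suc m) * y ^ Suc m * (((1 - a) * e1) * ((1 - b) * e2)) * h"
        unfolding e [symmetric] A_def h_def Suc by (simp add: algebra_simps)
      have T3: "C n = ((1 - N) * inv_qfact (Suc m)) * y ^ Suc m * (e1 * e2) * ((1 - a * b) * h)"
        unfolding e(3) [symmetric] p [symmetric] C_def h_def Suc e1_def e2_def by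
            (simp add: algebra_simps)
      have T4: "G n = ((1 - N) * inv_qfact (Suc m)) * y ^ Suc m * (((1 - a) * e1) * e2) * h"
        unfolding e [symmetric] G_def h_def Suc e2_def by (simp add: algebra_simps)
      show ?thesis unfolding p T1 T2 T3 T4 by (simp add: algebra_simps)
    qed
    have z: "t (Suc K) (i + 1) = 0" "A (Suc K) = 0" "t K i = 0" "t K (i - 1) = 0"
      using that by (simp_all add: t_def A_def inv_qfact_int_def)
    have shift: "(\<Sum>n\<le>K. f (Suc n)) = (\<Sum>n\<le>K. f n) + f (Suc K) - f 0" for f :: "nat \<Rightarrow> complex"
      by (induction K) simp_all
    have CG: "C (Suc K) = 0" "G (Suc K) = 0" "C 0 = 0" "G 0 = 0"
      using that by (simp_all add: C_def G_def inv_qfact_int_def)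
    have "(1 - q powi (i + 1)) * T K (i + 1) = (\<Sum>n\<le>K. A n + C n - G n)"
      unfolding T_def sum_distrib_left by (intro sum.cong 3 refl)
    also have "\<dots> = (\<Sum>n\<le>K. A n + C (Suc n)) - (\<Sum>n\<le>K. G (Suc n))"
      using shift[of C] shift[of G] CG by (simp add: sum.distrib sum_subtractf)
    also have "\<dots> = (1 + y) * T K i - y * T K (i - 1)"
      unfolding 1 [symmetric] 2 [symmetric] T_def sum_distrib_left ..
    finally show ?thesis .
  qed
  have main: "T K (int i) = (inv_qfact i * rogers_szego y i) * (inv_qfact j * rogers_szego y j)"
      if "i \<le> K" for K i
    using that
  proof (induction i rule: less_induct)
    case (less i)
    have neg: "T K (- 1) = 0" unfolding T_def by (rule sum.neutral) (simp add: t_def inv_qfact_int_def)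
    have zero: "T K 0 = inv_qfact j * rogers_szego y j"
    proof -
      have "T K 0 = (\<Sum>n\<in>{0}. t n 0)"
        unfolding T_def by (rule sum.mono_neutral_right) (auto simp: t_def inv_qfact_int_def)
      thus ?thesis by (simp add: t_def inv_qfact_int_def rogers_szego_int_def)
    qed
    consider "i = 0" | "i = Suc 0" | m where "i = Suc (Suc m)" by (metis old.nat.exhaust)
    thus ?case
    proof cases
      case 1 thus ?thesis using zero by simp
    next
      case 2
      have "(1 - q) * T K 1 = (1 + y) * T K 0" using rec[of 0 K] neg less.prems 2 by simp
      moreover have "(1 - q) * inv_qfact (Suc 0) = 1" using inv_qfact_Suc[of 0] by simp
      moreover have "1 - q \<noteq> 0" using one_minus_q_power_neq_0[of 0] by simp
      ultimately have "(1 - q) * T K 1 = (1 - q) * (inv_qfact (Suc 0) * (1 + y) * T K 0)"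
        by (simp only: mult.assoc [symmetric]) simp
      with \<open>1 - q \<noteq> 0\<close> show ?thesis by (simp add: 2 zero rogers_szego_1)
    next
      case (3 m)
      have nz: "1 - q ^ Suc (Suc m) \<noteq> 0" by (rule one_minus_q_power_neq_0)
      have a: "int (Suc m) + 1 = int i" "int (Suc m) - 1 = int m" by (simp_all add: 3)
      have "(1 - q ^ Suc (Suc m)) * T K (int i) = (1 + y) * T K (int (Suc m)) - y * T K (int m)"
        using rec[of "int (Suc m)" K] less.prems 3
        unfolding a unfolding 3 power_int_of_nat by simp
      also have "\<dots> = ((1 + y) * (inv_qfact (Suc m) * rogers_szego y (Suc m)) - y * (inv_qfact m
          * rogers_szego y m))
         * (inv_qfact j * rogers_szego y j)"
        using less.IH[of m] less.IH[of "Suc m"] less.prems 3 by (simp add: algebra_simps)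
      also have "(1 + y) * (inv_qfact (Suc m) * rogers_szego y (Suc m)) - y * (inv_qfact m
          * rogers_szego y m)
         = inv_qfact (Suc m) * rogers_szego y (Suc (Suc m))"
        unfolding rogers_szego_rec inv_qfact_Suc[of m, symmetric] by (simp add: algebra_simps)
      also have "inv_qfact (Suc m) = (1 - q ^ Suc (Suc m)) * inv_qfact (Suc (Suc m))"
        using inv_qfact_Suc[of "Suc m"] by simp
      finally have "(1 - q ^ Suc (Suc m)) * T K (int i) = (1 - q ^ Suc (Suc m)) *
         ((inv_qfact i * rogers_szego y i) * (inv_qfact j * rogers_szego y j))"
        unfolding 3 by (simp only: mult.assoc)
      with nz show ?thesis by (metis mult_left_cancel)
    qed
  qed
  have "T i (int i) = (\<Sum>n\<le>min i j. t n (int i))"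
    unfolding T_def by (rule sum.mono_neutral_right) (auto simp: t_def inv_qfact_int_def)
  also have "\<dots> = (\<Sum>n\<le>min i j. inv_qfact n * y ^ n * (inv_qfact (i - n) * inv_qfact (j - n))
      * rogers_szego y ((i - n) + (j - n)))"
  proof (rule sum.cong[OF refl])
    fix n assume "n \<in> {..min i j}"
    hence n: "n \<le> i" "n \<le> j" by auto
    have "nat (int i - int n) = i - n" "nat (int j - int n) = j - n"
      "nat (int i + int j - 2 * int n) = (i - n) + (j - n)" using n by linarith+
    moreover have "\<not> int i - int n < 0" "\<not> int j - int n < 0" "\<not> int i + int j - 2 * int n < 0"
      using n by linarith+
    ultimately show "t n (int i) = inv_qfact n * y ^ n * (inv_qfact (i - n) * inv_qfact (j - n))
        * rogers_szego y ((i - n) + (j - n))"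
      unfolding t_def inv_qfact_int_def rogers_szego_int_def by (simp only: if_False)
  qed
  finally show ?thesis using main[of i i] by simp
qed

section \<open>The factor with quadratic argument\<close>

text \<open>The expansion of \<open>(\<alpha>s)(\<alpha>ys)/(\<alpha>s\<^sup>2)\<close> in powers of \<open>\<alpha>\<close>, with \<open>s\<close> as a parameter; the first factor is
\<open>(\<alpha>s)/(\<alpha>s\<^sup>2)\<close>. Each coefficient is a polynomial in \<open>s\<close>.\<close>
definition kernel_fps :: "complex \<Rightarrow> complex \<Rightarrow> complex fps" where
  "kernel_fps y s = fps_qbinom (1 / s) (s ^ 2) * fps_qpoch (y * s)"

lemma kernel_fps_rec:
  assumes "s \<noteq> 0"
  shows "fps_nth (kernel_fps y s) 0 = 1"
    and "(1 - q) * fps_nth (kernel_fps y s) (Suc 0) = s ^ 2 - (1 + y) * s"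
    and "(1 - q ^ Suc (Suc r)) * fps_nth (kernel_fps y s) (Suc (Suc r)) =
       s ^ 2 * fps_nth (kernel_fps y s) (Suc r) - (1 + y) * q ^ Suc r * (s * fps_nth
           (kernel_fps y s) (Suc r))
       + y * q ^ r * (s ^ 2 * fps_nth (kernel_fps y s) r)"
proof -
  define K where "K = kernel_fps y s"
  have "(1 - fps_const (s ^ 2) * fps_X) * K =
      ((1 - fps_const (s ^ 2) * fps_X) * fps_qbinom (1 / s) (s ^ 2)) * fps_qpoch (y * s)"
    unfolding K_def kernel_fps_def by (simp only: mult.assoc)
  also have "\<dots> = ((1 - fps_const (1 / s * s ^ 2) * fps_X) * dilate (fps_qbinom (1 / s) (s ^ 2))) *
      ((1 - fps_const (y * s) * fps_X) * dilate (fps_qpoch (y * s)))"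
    unfolding fps_qbinom_dilate by (subst fps_qpoch_dilate) simp
  also have "\<dots> = (1 - fps_const s * fps_X) * ((1 - fps_const (y * s) * fps_X) * dilate K)"
    unfolding K_def kernel_fps_def dilate_mult using assms by (simp add: mult_ac power2_eq_square)
  finally have eq: "(1 - fps_const (s ^ 2) * fps_X) * K = \<dots>" .
  show 0: "fps_nth (kernel_fps y s) 0 = 1" by (simp add: kernel_fps_def)
  show "(1 - q) * fps_nth (kernel_fps y s) (Suc 0) = s ^ 2 - (1 + y) * s"
    using arg_cong[OF eq, of "\<lambda>F. fps_nth F (Suc 0)"] 0
    unfolding two_linear_factors_nth linear_fps_mult_nth K_def [symmetric] by (simp add: algebra_simps)
  show "(1 - q ^ Suc (Suc r)) * fps_nth (kernel_fps y s) (Suc (Suc r)) =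
       s ^ 2 * fps_nth (kernel_fps y s) (Suc r) - (1 + y) * q ^ Suc r * (s * fps_nth
           (kernel_fps y s) (Suc r))
       + y * q ^ r * (s ^ 2 * fps_nth (kernel_fps y s) r)"
    using arg_cong[OF eq, of "\<lambda>F. fps_nth F (Suc (Suc r))"]
    unfolding two_linear_factors_nth linear_fps_mult_nth K_def [symmetric] by
        (simp add: algebra_simps power2_eq_square)
qed

text \<open>The value of the moment functional on \<open>s\<^sup>n\<close> times the coefficient of \<open>\<alpha>\<^sup>r\<close> in \<open>kernel_fps\<close>. It is a multiple
of the single moment \<open>m\<^sub>n\<close>, although the coefficient involves the powers from \<open>s\<^sup>r\<close> to \<open>s\<^sup>2\<^sup>r\<close>.\<close>
definition kernel_moment :: "complex \<Rightarrow> (nat \<Rightarrow> complex) \<Rightarrow> nat \<Rightarrow> nat \<Rightarrow> complex" where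
  "kernel_moment y m r n = qpoch (q ^ Suc n) q r * euler_coeff r * y ^ r * m n"

text \<open>The recurrence of \<open>kernel_fps_rec\<close> with \<open>s\<^sup>k\<close> replaced by a shift of \<open>n\<close>. The two terms at \<open>n + 2\<close> combine, by
\<open>(1 - q\<^sup>n\<^sup>+\<^sup>r\<^sup>+\<^sup>3) - (1 - q\<^sup>r\<^sup>+\<^sup>1) = q\<^sup>r\<^sup>+\<^sup>1(1 - q\<^sup>n\<^sup>+\<^sup>2)\<close>, with the same factor as the term at \<open>n + 1\<close>; the moment
recurrence then leaves a multiple of \<open>m\<^sub>n\<close>.\<close>
lemma kernel_moment_rec:
  assumes m: "\<And>n. m (Suc (Suc n)) = (1 + y) * m (Suc n) - y * (1 - q ^ Suc n) * m n"
  shows "kernel_moment y m 0 n = m n"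
    and "(1 - q) * kernel_moment y m (Suc 0) n = m (n + 2) - (1 + y) * m (n + 1)"
    and "(1 - q ^ Suc (Suc r)) * kernel_moment y m (Suc (Suc r)) n =
       kernel_moment y m (Suc r) (n + 2) - (1 + y) * q ^ Suc r * kernel_moment y m (Suc r) (n + 1)
       + y * q ^ r * kernel_moment y m r (n + 2)"
proof -
  show "kernel_moment y m 0 n = m n" by (simp add: kernel_moment_def)
  have eu1: "euler_coeff (Suc 0) * (1 - q) = - 1" using euler_coeff_Suc[of 0] by simp
  have "(1 - q) * kernel_moment y m (Suc 0) n = (euler_coeff (Suc 0) * (1 - q)) * ((1 - q ^ Suc n)
      * y * m n)"
    unfolding kernel_moment_def by (simp add: qpoch_Suc mult_ac)
  hence "(1 - q) * kernel_moment y m (Suc 0) n = - (1 - q ^ Suc n) * y * m n"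
    unfolding eu1 by (simp add: algebra_simps)
  thus "(1 - q) * kernel_moment y m (Suc 0) n = m (n + 2) - (1 + y) * m (n + 1)"
    unfolding add_2_eq_Suc' Suc_eq_plus1 [symmetric] m[of n] by (simp add: algebra_simps)
  define e where "e = euler_coeff (Suc r)"
  define Q where "Q = qpoch (q ^ Suc (Suc (Suc n))) q r"
  have e1: "(1 - q ^ Suc (Suc r)) * euler_coeff (Suc (Suc r)) = - (q ^ Suc r) * e"
    using euler_coeff_Suc[of "Suc r"] by (simp only: e_def mult.commute)
  have e0: "q ^ r * euler_coeff r = - (1 - q ^ Suc r) * e"
    using euler_coeff_Suc[of r] unfolding e_def by (simp add: algebra_simps)
  have Q1: "qpoch (q ^ Suc (Suc (Suc n))) q (Suc r) = Q * (1 - q ^ Suc (Suc n) * q ^ Suc r)"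
    unfolding Q_def by (simp add: qpoch_Suc mult_ac)
  have Q2: "qpoch (q ^ Suc (Suc n)) q (Suc r) = (1 - q ^ Suc (Suc n)) * Q"
    unfolding Q_def by (simp add: qpoch_Suc_left mult_ac)
  have Q3: "qpoch (q ^ Suc n) q (Suc (Suc r)) = (1 - q ^ Suc n) * ((1 - q ^ Suc (Suc n)) * Q)"
    unfolding Q2 [symmetric] using qpoch_Suc_left[of "q ^ Suc n" q "Suc r"] by (simp add: mult_ac)
  have 1: "(1 - q ^ Suc (Suc r)) * kernel_moment y m (Suc (Suc r)) n
     = ((1 - q ^ Suc (Suc r)) * euler_coeff (Suc (Suc r))) * qpoch (q ^ Suc n) q (Suc (Suc r))
         * y ^ Suc (Suc r) * m n"
    unfolding kernel_moment_def by (simp only: mult_ac)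
  have 2: "kernel_moment y m (Suc r) (n + 2) = Q * (1 - q ^ Suc (Suc n) * q ^ Suc r) * e * y ^ Suc r
      * m (Suc (Suc n))"
    unfolding kernel_moment_def e_def Q1 [symmetric] by simp
  have 3: "kernel_moment y m (Suc r) (n + 1) = (1 - q ^ Suc (Suc n)) * Q * e * y ^ Suc r * m (Suc n)"
    unfolding kernel_moment_def e_def Q2 [symmetric] by simp
  have 4: "y * q ^ r * kernel_moment y m r (n + 2) = Q * (q ^ r * euler_coeff r) * y ^ Suc r * m
      (Suc (Suc n))"
    unfolding kernel_moment_def Q_def by simp
  show "(1 - q ^ Suc (Suc r)) * kernel_moment y m (Suc (Suc r)) n =
       kernel_moment y m (Suc r) (n + 2) - (1 + y) * q ^ Suc r * kernel_moment y m (Suc r) (n + 1)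
       + y * q ^ r * kernel_moment y m r (n + 2)"
    unfolding 1 2 3 4 e0 e1 Q3 m[of n] by (simp add: algebra_simps)
qed

end

section \<open>Rearrangement of absolutely convergent families\<close>

lemma summable_on_times:
  fixes F :: "'a \<Rightarrow> real" and G :: "'b \<Rightarrow> real"
  assumes "F summable_on A" "G summable_on B" "\<And>x. F x \<ge> 0" "\<And>y. G y \<ge> 0"
  shows "(\<lambda>(x, y). F x * G y) summable_on A \<times> B"
proof (rule summable_on_SigmaI)
  show "((\<lambda>y. case (x, y) of (x, y) \<Rightarrow> F x * G y) has_sum F x * infsum G B) B" for x
    using has_sum_cmult_right[OF has_sum_infsum[OF assms(2)], of "F x"] by simp
  show "(\<lambda>x. F x * infsum G B) summable_on A"
    by (rule summable_on_cmult_left[OF assms(1)])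
qed (use assms in auto)

lemma summable_on_geometric_nat: "0 \<le> r \<Longrightarrow> r < 1 \<Longrightarrow> (\<lambda>n::nat. r ^ n :: real) summable_on UNIV"
  by (rule norm_summable_imp_summable_on) (simp add: summable_geometric)

lemma summable_on_norm_bound:
  fixes f :: "'a \<Rightarrow> complex"
  assumes "F summable_on A" "\<And>x. x \<in> A \<Longrightarrow> norm (f x) \<le> C * F x"
  shows "f summable_on A"
  by (rule abs_summable_summable,
      rule Infinite_Sum.abs_summable_on_comparison_test'[OF summable_on_cmult_right[OF assms(1), of C]])
     (rule assms(2))

text \<open>Summation by the fibres of an arbitrary map with finite fibres. Every regrouping by a
derived index below is an instance.\<close>
lemma infsum_fibers:
  fixes f :: "'a \<Rightarrow> complex" and \<phi> :: "'a \<Rightarrow> 'b"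
  assumes "f summable_on UNIV" "\<And>y. finite {x. \<phi> x = y}"
  shows "infsum f UNIV = (\<Sum>\<^sub>\<infinity>y. \<Sum>x | \<phi> x = y. f x)"
    and "(\<lambda>y. \<Sum>x | \<phi> x = y. f x) summable_on UNIV"
proof -
  have bij: "bij_betw (\<lambda>x. (\<phi> x, x)) UNIV (SIGMA y:UNIV. {x. \<phi> x = y})"
    by (rule bij_betwI[where g = snd]) auto
  have sm: "(\<lambda>(y, x). f x) summable_on (SIGMA y:UNIV. {x. \<phi> x = y})"
    using summable_on_reindex_bij_betw[OF bij, of "\<lambda>(y, x). f x"] assms(1) by simp
  have "infsum f UNIV = infsum (\<lambda>(y, x). f x) (SIGMA y:UNIV. {x. \<phi> x = y})"
    using infsum_reindex_bij_betw[OF bij, of "\<lambda>(y, x). f x"] by simp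
  also have "\<dots> = (\<Sum>\<^sub>\<infinity>y. \<Sum>\<^sub>\<infinity>x\<in>{x. \<phi> x = y}. f x)"
    by (rule infsum_Sigma'_banach[OF sm, symmetric])
  finally show "infsum f UNIV = (\<Sum>\<^sub>\<infinity>y. \<Sum>x | \<phi> x = y. f x)"
    using assms(2) by simp
  show "(\<lambda>y. \<Sum>x | \<phi> x = y. f x) summable_on UNIV"
    using summable_on_Sigma_banach[OF sm] assms(2) by simp
qed

lemma infsum_antidiagonal:
  fixes f :: "nat \<times> nat \<Rightarrow> complex"
  assumes "f summable_on UNIV"
  shows "infsum f UNIV = (\<Sum>\<^sub>\<infinity>n. \<Sum>i\<le>n. f (i, n - i))"
proof -
  have eq: "{x :: nat \<times> nat. fst x + snd x = n} = (\<lambda>i. (i, n - i)) ` {..n}" for n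
    by force
  have "(\<Sum>x | fst x + snd x = n. f x) = (\<Sum>i\<le>n. f (i, n - i))" for n
    unfolding eq by (subst sum.reindex) (auto simp: inj_on_def)
  thus ?thesis
    by (subst infsum_fibers(1)[OF assms, of "\<lambda>x. fst x + snd x"]) (simp_all add: eq)
qed

lemma infsum_nat_eq_suminf:
  fixes f :: "nat \<Rightarrow> complex"
  assumes "f summable_on UNIV"
  shows "infsum f UNIV = (\<Sum>n. f n)"
  by (rule sums_unique[OF has_sum_imp_sums[OF has_sum_infsum[OF assms]]])

lemma infsum_pair:
  fixes f :: "'a \<times> 'b \<Rightarrow> complex"
  assumes "f summable_on UNIV"
  shows "infsum f UNIV = (\<Sum>\<^sub>\<infinity>x. \<Sum>\<^sub>\<infinity>y. f (x, y))" and "(\<lambda>x. \<Sum>\<^sub>\<infinity>y. f (x, y)) summable_on UNIV"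
    and "(\<lambda>y. f (x, y)) summable_on UNIV"
proof -
  have sm: "f summable_on (UNIV \<times> UNIV)" using assms by simp
  show "infsum f UNIV = (\<Sum>\<^sub>\<infinity>x. \<Sum>\<^sub>\<infinity>y. f (x, y))"
    using infsum_Sigma_banach[OF sm] by simp
  show "(\<lambda>x. \<Sum>\<^sub>\<infinity>y. f (x, y)) summable_on UNIV"
    using summable_on_Sigma_banach[of "\<lambda>x y. f (x, y)" UNIV "\<lambda>_. UNIV"] sm by simp
  show "(\<lambda>y. f (x, y)) summable_on UNIV"
    using summable_on_SigmaD1[of "\<lambda>x y. f (x, y)" UNIV "\<lambda>_. UNIV"] sm by simp
qed

lemma infsum_nat_pair_eq_suminf:
  fixes f :: "nat \<times> nat \<Rightarrow> complex"
  assumes "f summable_on UNIV"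
  shows "infsum f UNIV = (\<Sum>i. \<Sum>j. f (i, j))"
  unfolding infsum_pair(1)[OF assms] infsum_nat_eq_suminf[OF infsum_pair(2)[OF assms]]
  by (subst infsum_nat_eq_suminf[OF infsum_pair(3)[OF assms]]) simp

context q_series
begin

section \<open>The bilinear sum\<close>

lemma euler_coeff_norm_le: "norm (euler_coeff n) \<le> norm (inv_qfact n)"
proof -
  have "norm (euler_coeff n) = norm q ^ (n * (n - 1) div 2) * norm (inv_qfact n)"
    by (simp add: euler_coeff_def inv_qfact_def norm_mult norm_divide norm_power)
  also have "\<dots> \<le> 1 * norm (inv_qfact n)"
    using q_lt_1 by (intro mult_right_mono power_le_one) auto
  finally show ?thesis by simp
qed

lemma coeff_bounds:
  obtains C where "C > 0" "\<And>n. norm (inv_qfact n) \<le> C" "\<And>n. norm (euler_coeff n) \<le> C"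
proof -
  obtain C where "C > 0" "\<And>n. norm (inv_qfact n) \<le> C"
    using inverse_qpoch_q_bounded unfolding inv_qfact_def by blast
  thus ?thesis using that euler_coeff_norm_le order_trans by blast
qed

lemma rogers_szego_bound:
  assumes "1 < \<rho>" "norm y < \<rho>"
  obtains C where "C > 0" "\<And>n. norm (rogers_szego y n) \<le> C * \<rho> ^ n"
proof -
  have r: "1 / \<rho> > 0" using assms by simp
  have "fps_abs_summable (fps_inv_qpoch 1 * fps_inv_qpoch y) (1 / \<rho>)"
    by (intro fps_abs_summable_mult fps_abs_summable_qbinom) (use assms in \<open>auto simp: field_simps\<close>)
  from fps_abs_summable_coeff_bound[OF this r]
  obtain C where C: "C \<ge> 0" "\<And>n. norm (fps_nth (fps_inv_qpoch 1 * fps_inv_qpoch y) n) \<le> C * \<rho> ^ n"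
    by auto
  obtain D where D: "D > 0" "\<And>n. norm (qpoch q q n) \<le> D"
    using qpoch_bounded[of "norm q"] by (metis order_refl)
  show ?thesis
  proof (rule that[of "D * C + 1"])
    show "0 < D * C + 1" using C D by (simp add: add_nonneg_pos)
    fix n
    have "norm (rogers_szego y n) \<le> D * (C * \<rho> ^ n)"
      unfolding rogers_szego_def norm_mult by (intro mult_mono C D) (use D in auto)
    also have "\<dots> \<le> (D * C + 1) * \<rho> ^ n" using assms by (simp add: algebra_simps)
    finally show "norm (rogers_szego y n) \<le> (D * C + 1) * \<rho> ^ n" .
  qed
qed

text \<open>The general term of \<open>\<Sum>\<^sub>n (g;q)\<^sub>n B\<^sup>n/(q;q)\<^sub>n\<close> times the average of \<open>s\<^sup>n (a)(ay)/(as)\<close> under the functional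
\<open>s\<^sup>n \<mapsto> h\<^sub>n(y)\<close>, expanded with \<open>n = l + i\<close>. In this form products of two such sums can be linearized.\<close>
definition rs_phi_term :: "complex \<Rightarrow> complex \<Rightarrow> complex \<Rightarrow> complex \<Rightarrow> nat \<times> nat \<Rightarrow> complex" where
  "rs_phi_term a B g y = (\<lambda>(l, i). qpoch g q (l + i) * euler_coeff l * inv_qfact i *
      ((a * B * y) ^ l * B ^ i * rogers_szego y i))"

text \<open>On the diagonal \<open>l + i = n\<close> the terms add up to \<open>(g;q)\<^sub>n B\<^sup>n\<close> times a coefficient of \<open>(ayX)/((X)(yX))\<close>,
which can also be expanded as \<open>1/(X)\<close> times a q-binomial series. In that second
double series the sum over \<open>j\<close> is a q-binomial sum, and the sum over \<open>k\<close> is the \<open>\<^sub>2\<phi>\<^sub>1\<close>.\<close>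
lemma infsum_rs_phi_term:
  assumes \<rho>: "1 < \<rho>" "norm y < \<rho>" and B: "norm B * \<rho> < 1" and Y: "norm (a * B * y) < 1"
    and c: "\<And>k. qpoch (g * B) q k \<noteq> 0"
  shows "infsum (rs_phi_term a B g y) UNIV
           = qpoch_inf (g * B) q / qpoch_inf B q * phi21 a g (g * B) q (B * y)"
proof -
  have B1: "norm B < 1"
    using mult_left_mono[of 1 \<rho> "norm B"] \<rho> B by simp
  have By: "norm (B * y) < 1"
    using mult_left_mono[of "norm y" \<rho> "norm B"] \<rho> B by (simp add: norm_mult)
  obtain G where G: "G > 0" "\<And>n. norm (qpoch g q n) \<le> G" using qpoch_bounded[of "norm g"] by
      (metis order_refl)
  obtain A where A: "A > 0" "\<And>n. norm (qpoch a q n) \<le> A" using qpoch_bounded[of "norm a"] by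
      (metis order_refl)
  obtain C where C: "C > 0" "\<And>n. norm (inv_qfact n) \<le> C" "\<And>n. norm (euler_coeff n) \<le> C"
    using coeff_bounds by blast
  obtain H where H: "H > 0" "\<And>n. norm (rogers_szego y n) \<le> H * \<rho> ^ n" using rogers_szego_bound[OF \<rho>]
      by blast
  have s1: "rs_phi_term a B g y summable_on UNIV"
  proof (rule summable_on_norm_bound)
    have "(\<lambda>(l, i). norm (a * B * y) ^ l * (norm B * \<rho>) ^ i) summable_on (UNIV \<times> UNIV)"
      by (intro summable_on_times summable_on_geometric_nat) (use B Y \<rho> in auto)
    thus "(\<lambda>(l, i). norm (a * B * y) ^ l * (norm B * \<rho>) ^ i) summable_on UNIV" by simp
    fix x :: "nat \<times> nat"
    obtain l i where x: "x = (l, i)" by force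
    have "norm (rs_phi_term a B g y x) = norm (qpoch g q (l + i)) * norm (euler_coeff l) * norm
        (inv_qfact i) *
       (norm (a * B * y) ^ l * norm B ^ i * norm (rogers_szego y i))"
      unfolding x rs_phi_term_def by (simp only: prod.case norm_mult norm_power)
    also have "\<dots> \<le> G * C * C * (norm (a * B * y) ^ l * norm B ^ i * (H * \<rho> ^ i))"
      by (intro mult_mono G C H mult_nonneg_nonneg order_refl) (use G C H \<rho> in auto)
    finally show "norm (rs_phi_term a B g y x) \<le> (G * C * C * H) * (case x of (l, i) \<Rightarrow> norm (a * B
        * y) ^ l * (norm B * \<rho>) ^ i)"
      by (simp add: x power_mult_distrib mult_ac)
  qed
  define f where "f = (\<lambda>(k, j). qpoch g q (k + j) * (qpoch a q k * inv_qfact k * inv_qfact j) * ((B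
      * y) ^ k * B ^ j))"
  have s2: "f summable_on UNIV"
  proof (rule summable_on_norm_bound)
    have "(\<lambda>(k, j). norm (B * y) ^ k * norm B ^ j) summable_on (UNIV \<times> UNIV)"
      by (intro summable_on_times summable_on_geometric_nat) (use B1 By in auto)
    thus "(\<lambda>(k, j). norm (B * y) ^ k * norm B ^ j) summable_on UNIV" by simp
    fix x :: "nat \<times> nat"
    obtain k j where x: "x = (k, j)" by force
    have "norm (f x) = norm (qpoch g q (k + j)) * (norm (qpoch a q k) * norm (inv_qfact k) * norm
        (inv_qfact j)) *
        (norm (B * y) ^ k * norm B ^ j)"
      unfolding x f_def by (simp only: prod.case norm_mult norm_power)
    also have "\<dots> \<le> G * (A * C * C) * (norm (B * y) ^ k * norm B ^ j)"
      by (intro mult_mono G C A mult_nonneg_nonneg order_refl) (use G C A in auto)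
    finally show "norm (f x) \<le> G * (A * C * C) * (case x of (k, j) \<Rightarrow> norm (B * y) ^ k * norm B ^ j)"
      by (simp add: x)
  qed
  have diag: "(\<Sum>l\<le>n. rs_phi_term a B g y (l, n - l)) = (\<Sum>k\<le>n. f (k, n - k))" for n
  proof -
    have fps: "fps_qpoch (a * y) * (fps_inv_qpoch 1 * fps_inv_qpoch y) = fps_qbinom a y
        * fps_inv_qpoch 1"
      by (simp add: fps_qbinom_factor[of a y] mult_ac)
    have "(\<Sum>l\<le>n. rs_phi_term a B g y (l, n - l))
        = (\<Sum>l\<le>n. qpoch g q n * B ^ n * ((euler_coeff l * (a * y) ^ l) * (inv_qfact (n - l)
            * rogers_szego y (n - l))))"
    proof (rule sum.cong[OF refl])
      fix l assume "l \<in> {..n}"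
      hence "B ^ n = B ^ l * B ^ (n - l)" "l + (n - l) = n" by (simp_all flip: power_add)
      thus "rs_phi_term a B g y (l, n - l) = qpoch g q n * B ^ n * ((euler_coeff l * (a * y) ^ l) *
          (inv_qfact (n - l) * rogers_szego y (n - l)))"
        unfolding rs_phi_term_def by (simp add: power_mult_distrib mult_ac)
    qed
    also have "\<dots> = qpoch g q n * B ^ n * fps_nth (fps_qpoch (a * y) * (fps_inv_qpoch 1
        * fps_inv_qpoch y)) n"
      unfolding sum_distrib_left [symmetric] inv_qfact_rogers_szego fps_mult_nth[of "fps_qpoch (a
          * y)"] atLeast0AtMost by simp
    also have "\<dots> = (\<Sum>k\<le>n. qpoch g q n * B ^ n * (qpoch a q k * inv_qfact k * y ^ k * inv_qfact (n
        - k)))"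
      unfolding fps fps_mult_nth[of "fps_qbinom a y"] atLeast0AtMost sum_distrib_left
      by (simp add: inv_qfact_def)
    also have "\<dots> = (\<Sum>k\<le>n. f (k, n - k))"
    proof (rule sum.cong[OF refl])
      fix k assume "k \<in> {..n}"
      hence "B ^ n = B ^ k * B ^ (n - k)" "k + (n - k) = n" by (simp_all flip: power_add)
      thus "qpoch g q n * B ^ n * (qpoch a q k * inv_qfact k * y ^ k * inv_qfact (n - k)) = f (k, n
          - k)"
        unfolding f_def by (simp add: power_mult_distrib mult_ac)
    qed
    finally show ?thesis .
  qed
  have inner: "(\<Sum>j. f (k, j)) = qpoch_inf (g * B) q / qpoch_inf B q *
      (qpoch a q k * qpoch g q k / (qpoch q q k * qpoch (g * B) q k) * (B * y) ^ k)" for k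
  proof -
    have "(\<lambda>j. fps_nth (fps_qbinom (g * q ^ k) 1) j * B ^ j) sums eval_fps (fps_qbinom (g * q ^ k) 1) B"
      by (intro fps_abs_summable_sums fps_abs_summable_qbinom) (use B1 in auto)
    also have "eval_fps (fps_qbinom (g * q ^ k) 1) B = qpoch_inf (g * q ^ k * B) q / qpoch_inf B q"
      using eval_fps_qbinom[of 1 B "g * q ^ k"] B1 by simp
    also have "qpoch_inf (g * q ^ k * B) q = qpoch_inf (g * B) q / qpoch (g * B) q k"
      using qpoch_inf_split[of "g * B" k] c[of k] by (simp add: mult_ac field_simps)
    finally have "(\<lambda>j. (qpoch a q k * qpoch g q k * inv_qfact k * (B * y) ^ k) * (fps_nth
        (fps_qbinom (g * q ^ k) 1) j * B ^ j)) sums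
      ((qpoch a q k * qpoch g q k * inv_qfact k * (B * y) ^ k) * (qpoch_inf (g * B) q / qpoch (g
          * B) q k / qpoch_inf B q))"
      by (rule sums_mult)
    moreover have "(qpoch a q k * qpoch g q k * inv_qfact k * (B * y) ^ k) * (fps_nth (fps_qbinom (g
        * q ^ k) 1) j * B ^ j) = f (k, j)" for j
      unfolding f_def by (simp add: qpoch_add inv_qfact_def)
    ultimately show ?thesis by (simp add: sums_iff inv_qfact_def mult_ac)
  qed
  have sk: "summable (\<lambda>k. qpoch a q k * qpoch g q k / (qpoch q q k * qpoch (g * B) q k) * (B * y) ^ k)"
  proof (cases "qpoch_inf (g * B) q = 0")
    case False
    have "(\<lambda>k. \<Sum>\<^sub>\<infinity>j. f (k, j)) summable_on UNIV" by (rule infsum_pair(2)[OF s2])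
    hence "summable (\<lambda>k. \<Sum>j. f (k, j))"
      using infsum_nat_eq_suminf[OF infsum_pair(3)[OF s2]] by (auto dest: summable_on_imp_summable)
    hence "summable (\<lambda>k. qpoch_inf B q / qpoch_inf (g * B) q * (\<Sum>j. f (k, j)))" by (rule summable_mult)
    thus ?thesis using False qpoch_inf_neq_0[OF B1] by (simp add: inner mult_ac)
  next
    case True
    have "1 - g * B * q ^ k \<noteq> 0" for k using c[of "Suc k"] by (auto simp: qpoch_Suc)
    hence "qpoch_inf (g * B) q \<noteq> 0" unfolding qpoch_inf_def by
        (rule prodinf_nonzero[OF convergent_prod_qpoch])
    with True show ?thesis by simp
  qed
  have "infsum (rs_phi_term a B g y) UNIV = infsum f UNIV"
    unfolding infsum_antidiagonal[OF s1] infsum_antidiagonal[OF s2] diag ..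
  also have "\<dots> = (\<Sum>k. \<Sum>j. f (k, j))" by (rule infsum_nat_pair_eq_suminf[OF s2])
  also have "\<dots> = qpoch_inf (g * B) q / qpoch_inf B q * phi21 a g (g * B) q (B * y)"
    unfolding inner phi21_def by (rule suminf_mult[OF sk])
  finally show ?thesis .
qed

text \<open>Grouping by \<open>r = l + m + n\<close> leaves the finite sums of \<open>triple_convolution\<close>.\<close>
lemma infsum_triple_convolution:
  assumes Y: "norm Y < 1"
  shows "(\<lambda>(l, m, n). qpoch X q (l + n) * qpoch Z q (m + n) * (euler_coeff l * euler_coeff m
      * inv_qfact n) * Y ^ (l + m + n))
           summable_on UNIV" (is "?F summable_on UNIV")
    and "infsum (\<lambda>(l, m, n). qpoch X q (l + n) * qpoch Z q (m + n) * (euler_coeff l * euler_coeff m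
        * inv_qfact n) * Y ^ (l + m + n)) UNIV
           = (\<Sum>r. qpoch (X * Z) q r * euler_coeff r * Y ^ r)"
proof -
  obtain A where A: "A > 0" "\<And>n. norm (qpoch X q n) \<le> A" using qpoch_bounded[of "norm X"] by
      (metis order_refl)
  obtain B where B: "B > 0" "\<And>n. norm (qpoch Z q n) \<le> B" using qpoch_bounded[of "norm Z"] by
      (metis order_refl)
  obtain C where C: "C > 0" "\<And>n. norm (inv_qfact n) \<le> C" "\<And>n. norm (euler_coeff n) \<le> C"
    using coeff_bounds by blast
  show s: "?F summable_on UNIV"
  proof (rule summable_on_norm_bound)
    have "(\<lambda>(l, x). norm Y ^ l * (case x of (m, n) \<Rightarrow> norm Y ^ m * norm Y ^ n)) summable_on (UNIV \<times>
        (UNIV \<times> UNIV))"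
      by (intro summable_on_times summable_on_geometric_nat) (use Y in auto)
    thus "(\<lambda>(l, m, n). norm Y ^ l * (norm Y ^ m * norm Y ^ n)) summable_on UNIV"
      by (simp add: case_prod_unfold)
    fix x :: "nat \<times> nat \<times> nat"
    obtain l m n where x: "x = (l, m, n)" by (cases x) auto
    have "norm (?F x) = norm (qpoch X q (l + n)) * norm (qpoch Z q (m + n)) *
        (norm (euler_coeff l) * norm (euler_coeff m) * norm (inv_qfact n)) * norm Y ^ (l + m + n)"
      unfolding x by (simp only: prod.case norm_mult norm_power)
    also have "\<dots> \<le> A * B * (C * C * C) * norm Y ^ (l + m + n)"
      by (intro mult_mono A B C mult_nonneg_nonneg order_refl) (use A B C in auto)
    finally show "norm (?F x) \<le> A * B * (C * C * C) * (case x of (l, m, n) \<Rightarrow> norm Y ^ l *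
        (norm Y ^ m * norm Y ^ n))"
      by (simp add: x power_add mult_ac)
  qed
  define \<phi> where "\<phi> = (\<lambda>(l, m, n). l + m + n :: nat)"
  have fin: "finite {x. \<phi> x = r}" for r
    by (rule finite_subset[of _ "{..r} \<times> {..r} \<times> {..r}"]) (auto simp: \<phi>_def)
  have fib: "(\<Sum>x | \<phi> x = r. ?F x) = qpoch (X * Z) q r * euler_coeff r * Y ^ r" for r
  proof -
    have "(\<Sum>x | \<phi> x = r. ?F x) = (\<Sum>(i, l) \<in> (SIGMA i:{..r}. {..i}).
        qpoch X q i * qpoch Z q (r - l) * (euler_coeff l * euler_coeff (r - i) * inv_qfact (i - l))
            * Y ^ r)"
      by (rule sum.reindex_bij_witness[where i = "\<lambda>(i, l). (l, r - i, i - l)" and j = "\<lambda>(l, m, n).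
          (l + n, l)"])
         (auto simp: \<phi>_def)
    also have "\<dots> = (\<Sum>i\<le>r. \<Sum>l\<le>i. qpoch X q i * qpoch Z q (r - l) * (euler_coeff l * euler_coeff (r
        - i) * inv_qfact (i - l))) * Y ^ r"
      by (subst sum.Sigma [symmetric]) (simp_all add: sum_distrib_right)
    finally show ?thesis unfolding triple_convolution .
  qed
  show "infsum ?F UNIV = (\<Sum>r. qpoch (X * Z) q r * euler_coeff r * Y ^ r)"
    using infsum_fibers(1)[OF s fin] infsum_nat_eq_suminf[OF infsum_fibers(2)[OF s fin]]
    unfolding fib by simp
qed

text \<open>Both sides are sums of one absolutely convergent five-fold family in \<open>((u, v), (l, m, n))\<close>. Summing
over \<open>(l, m, n)\<close> first gives the left side by the triple convolution with parameters \<open>gq\<^sup>u\<close> and \<open>g'q\<^sup>v\<close>, whose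
product is \<open>q\<^sup>u\<^sup>+\<^sup>v\<^sup>+\<^sup>1\<close> because \<open>gg' = q\<close>. Grouping by \<open>i = u + n\<close> and \<open>j = v + n\<close> instead, the sum over \<open>n\<close> is the
linearization of \<open>h\<^sub>ih\<^sub>j\<close>, and the family splits into a product.\<close>
lemma rogers_szego_bilinear_sum:
  assumes q: "q \<noteq> 0" and g: "g * g' = q"
    and \<rho>: "1 < \<rho>" "norm y < \<rho>" and a: "norm a * \<rho> < 1" and B: "norm B * \<rho> < 1"
  shows "(\<lambda>(u, v). qpoch g q u * inv_qfact u * B ^ u * (qpoch g' q v * inv_qfact v * a ^ v) *
            (rogers_szego y (u + v) * (\<Sum>r. qpoch (q ^ Suc (u + v)) q r * euler_coeff r * (a * B
                * y) ^ r))) summable_on UNIV"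
    and "(\<Sum>u. \<Sum>v. qpoch g q u * inv_qfact u * B ^ u * (qpoch g' q v * inv_qfact v * a ^ v) *
            (rogers_szego y (u + v) * (\<Sum>r. qpoch (q ^ Suc (u + v)) q r * euler_coeff r * (a * B
                * y) ^ r)))
         = infsum (rs_phi_term a B g y) UNIV * infsum (rs_phi_term B a g' y) UNIV"
proof -
  define Y where "Y = a * B * y"
  have Y: "norm Y < 1"
  proof -
    have "norm a * norm y \<le> norm a * \<rho>" using \<rho> by (intro mult_left_mono) auto
    hence "norm a * norm y < 1" using a by linarith
    moreover have "norm B < 1" using mult_left_mono[of 1 \<rho> "norm B"] \<rho> B by simp
    ultimately have "(norm a * norm y) * norm B < 1"
      by (metis mult_strict_mono' mult_1 norm_ge_zero mult_nonneg_nonneg)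
    thus ?thesis by (simp add: Y_def norm_mult mult_ac)
  qed
  define T where "T = (\<lambda>((u, v), (l, m, n)). qpoch g q (u + (l + n)) * qpoch g' q (v + (m + n)) *
      (inv_qfact u * inv_qfact v * inv_qfact n * euler_coeff l * euler_coeff m) *
      (B ^ u * a ^ v * Y ^ (l + m + n) * rogers_szego y (u + v)))"
  obtain G where G: "G > 0" "\<And>n. norm (qpoch g q n) \<le> G" using qpoch_bounded[of "norm g"] by
      (metis order_refl)
  obtain G' where G': "G' > 0" "\<And>n. norm (qpoch g' q n) \<le> G'" using qpoch_bounded[of "norm g'"] by
      (metis order_refl)
  obtain C where C: "C > 0" "\<And>n. norm (inv_qfact n) \<le> C" "\<And>n. norm (euler_coeff n) \<le> C"
    using coeff_bounds by blast
  obtain H where H: "H > 0" "\<And>n. norm (rogers_szego y n) \<le> H * \<rho> ^ n" using rogers_szego_bound[OF \<rho>]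
      by blast
  have sT: "T summable_on UNIV"
  proof (rule summable_on_norm_bound)
    have "(\<lambda>(x, z). (case x of (u, v) \<Rightarrow> (norm B * \<rho>) ^ u * (norm a * \<rho>) ^ v) *
        (case z of (l, w) \<Rightarrow> norm Y ^ l * (case w of (m, n) \<Rightarrow> norm Y ^ m * norm Y ^ n))) summable_on
            ((UNIV \<times> UNIV) \<times> (UNIV \<times> (UNIV \<times> UNIV)))"
      by (intro summable_on_times summable_on_geometric_nat) (use a B \<rho> Y in auto)
    thus "(\<lambda>((u, v), (l, m, n)). (norm B * \<rho>) ^ u * (norm a * \<rho>) ^ v * (norm Y ^ l * (norm Y ^ m
        * norm Y ^ n))) summable_on UNIV"
      by (simp add: case_prod_unfold)
    fix x :: "(nat \<times> nat) \<times> nat \<times> nat \<times> nat"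
    obtain u v l m n where x: "x = ((u, v), (l, m, n))" by (cases x) auto
    have "norm (T x) = norm (qpoch g q (u + (l + n))) * norm (qpoch g' q (v + (m + n))) *
      (norm (inv_qfact u) * norm (inv_qfact v) * norm (inv_qfact n) * norm (euler_coeff l) * norm
          (euler_coeff m)) *
      (norm B ^ u * norm a ^ v * norm Y ^ (l + m + n) * norm (rogers_szego y (u + v)))"
      unfolding x T_def by (simp only: prod.case norm_mult norm_power)
    also have "\<dots> \<le> G * G' * (C * C * C * C * C) * (norm B ^ u * norm a ^ v * norm Y ^ (l + m + n) *
        (H * \<rho> ^ (u + v)))"
      by (intro mult_mono G G' C H mult_nonneg_nonneg order_refl) (use G G' C H \<rho> in auto)
    finally show "norm (T x) \<le> G * G' * (C * C * C * C * C) * H *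
       (\<lambda>((u, v), (l, m, n)). (norm B * \<rho>) ^ u * (norm a * \<rho>) ^ v * (norm Y ^ l * (norm Y ^ m
           * norm Y ^ n))) x"
      by (simp add: x power_add power_mult_distrib mult_ac)
  qed
  define c where "c u v = qpoch g q u * inv_qfact u * B ^ u * (qpoch g' q v * inv_qfact v * a ^ v)
      * rogers_szego y (u + v)" for u v
  \<comment> \<open>First way: the sum over \<open>(l, m, n)\<close> is a triple convolution.\<close>
  have way1: "(\<Sum>\<^sub>\<infinity>z. T (x, z)) = (case x of (u, v) \<Rightarrow> c u v * (\<Sum>r. qpoch (q ^ Suc (u + v)) q r
      * euler_coeff r * Y ^ r))" for x
  proof -
    obtain u v where x: "x = (u, v)" by force
    have XZ: "g * q ^ u * (g' * q ^ v) = q ^ Suc (u + v)"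
    proof -
      have "g * q ^ u * (g' * q ^ v) = (g * g') * (q ^ u * q ^ v)" by (simp only: mult_ac)
      thus ?thesis by (simp add: g power_add)
    qed
    let ?F = "\<lambda>(l, m, n). qpoch (g * q ^ u) q (l + n) * qpoch (g' * q ^ v) q (m + n) *
        (euler_coeff l * euler_coeff m * inv_qfact n) * Y ^ (l + m + n)"
    have "T (x, z) = c u v * ?F z" for z
      unfolding x T_def c_def by (cases z) (simp add: qpoch_add)
    hence "(\<Sum>\<^sub>\<infinity>z. T (x, z)) = (\<Sum>\<^sub>\<infinity>z. c u v * ?F z)" by simp
    also have "\<dots> = c u v * infsum ?F UNIV"
      by (rule infsum_cmult_right) (rule infsum_triple_convolution(1)[OF Y])
    also have "infsum ?F UNIV = (\<Sum>r. qpoch (q ^ Suc (u + v)) q r * euler_coeff r * Y ^ r)"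
      unfolding infsum_triple_convolution(2)[OF Y] XZ ..
    finally show ?thesis by (simp add: x)
  qed
  have "infsum T UNIV = (\<Sum>\<^sub>\<infinity>x. \<Sum>\<^sub>\<infinity>z. T (x, z))" by (rule infsum_pair(1)[OF sT])
  also have "\<dots> = (\<Sum>u. \<Sum>v. c u v * (\<Sum>r. qpoch (q ^ Suc (u + v)) q r * euler_coeff r * Y ^ r))"
    using infsum_nat_pair_eq_suminf[OF infsum_pair(2)[OF sT]] unfolding way1 by simp
  finally have L: "infsum T UNIV = \<dots>" .
  \<comment> \<open>Second way: fixing \<open>u + n\<close> and \<open>v + n\<close> leaves a finite sum over \<open>n\<close>.\<close>
  define \<phi> :: "(nat \<times> nat) \<times> nat \<times> nat \<times> nat \<Rightarrow> (nat \<times> nat) \<times> (nat \<times> nat)"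
    where "\<phi> = (\<lambda>((u, v), (l, m, n)). ((l, u + n), (m, v + n)))"
  have fib_eq: "{x. \<phi> x = ((l, i), (m, j))} = (\<lambda>n. ((i - n, j - n), (l, m, n))) ` {..min i j}"
      for l i m j
    by (force simp: \<phi>_def)
  have fin: "finite {x. \<phi> x = w}" for w
    by (cases w) (auto simp: fib_eq)
  have fib: "(\<Sum>x | \<phi> x = w. T x) = rs_phi_term a B g y (fst w) * rs_phi_term B a g' y (snd w)" for w
  proof -
    obtain l i m j where w: "w = ((l, i), (m, j))" by (cases w) auto
    have "(\<Sum>x | \<phi> x = w. T x) = (\<Sum>n\<le>min i j. T ((i - n, j - n), (l, m, n)))"
      unfolding w fib_eq by (subst sum.reindex) (auto simp: inj_on_def)
    also have "\<dots> = (\<Sum>n\<le>min i j. qpoch g q (l + i) * qpoch g' q (m + j) * (euler_coeff l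
        * euler_coeff m) * (Y ^ l * Y ^ m) * (B ^ i * a ^ j) *
       (inv_qfact n * y ^ n * (inv_qfact (i - n) * inv_qfact (j - n)) * rogers_szego y ((i - n) + (j
           - n))))"
    proof (rule sum.cong[OF refl])
      fix n assume "n \<in> {..min i j}"
      hence n: "n \<le> i" "n \<le> j" by auto
      have p: "B ^ i = B ^ (i - n) * B ^ n" "a ^ j = a ^ (j - n) * a ^ n" using n by
          (simp_all flip: power_add)
      have Yn: "Y ^ (l + m + n) = Y ^ l * Y ^ m * (a ^ n * B ^ n * y ^ n)"
        by (simp add: power_add Y_def power_mult_distrib)
      have i: "i - n + (l + n) = l + i" "j - n + (m + n) = m + j" using n by simp_all
      show "T ((i - n, j - n), (l, m, n)) = qpoch g q (l + i) * qpoch g' q (m + j) * (euler_coeff l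
          * euler_coeff m) * (Y ^ l * Y ^ m) * (B ^ i * a ^ j) *
       (inv_qfact n * y ^ n * (inv_qfact (i - n) * inv_qfact (j - n)) * rogers_szego y ((i - n) + (j
           - n)))"
        unfolding T_def prod.case i Yn p by (simp only: mult_ac)
    qed
    also have "\<dots> = qpoch g q (l + i) * qpoch g' q (m + j) * (euler_coeff l * euler_coeff m) * (Y ^ l
        * Y ^ m) * (B ^ i * a ^ j) *
       ((inv_qfact i * rogers_szego y i) * (inv_qfact j * rogers_szego y j))"
      unfolding sum_distrib_left [symmetric] rogers_szego_linearization[OF q] ..
    also have "\<dots> = rs_phi_term a B g y (l, i) * rs_phi_term B a g' y (m, j)"
      unfolding rs_phi_term_def prod.case Y_def by (simp only: mult_ac)
    finally show ?thesis by (simp add: w)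
  qed
  have sR: "(\<lambda>w. rs_phi_term a B g y (fst w) * rs_phi_term B a g' y (snd w)) summable_on UNIV"
    using infsum_fibers(2)[OF sT fin] unfolding fib .
  have "infsum T UNIV = (\<Sum>\<^sub>\<infinity>w. rs_phi_term a B g y (fst w) * rs_phi_term B a g' y (snd w))"
    using infsum_fibers(1)[OF sT fin] unfolding fib .
  also have "\<dots> = (\<Sum>\<^sub>\<infinity>x. \<Sum>\<^sub>\<infinity>z. rs_phi_term a B g y x * rs_phi_term B a g' y z)"
    using infsum_pair(1)[OF sR] by simp
  also have "\<dots> = infsum (rs_phi_term a B g y) UNIV * infsum (rs_phi_term B a g' y) UNIV"
    by (simp add: infsum_cmult_right' infsum_cmult_left')
  finally show "(\<Sum>u. \<Sum>v. qpoch g q u * inv_qfact u * B ^ u * (qpoch g' q v * inv_qfact v * a ^ v) *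
            (rogers_szego y (u + v) * (\<Sum>r. qpoch (q ^ Suc (u + v)) q r * euler_coeff r * (a * B
                * y) ^ r)))
         = infsum (rs_phi_term a B g y) UNIV * infsum (rs_phi_term B a g' y) UNIV"
    using L unfolding c_def Y_def by (simp add: mult.assoc)
  show "(\<lambda>(u, v). qpoch g q u * inv_qfact u * B ^ u * (qpoch g' q v * inv_qfact v * a ^ v) *
            (rogers_szego y (u + v) * (\<Sum>r. qpoch (q ^ Suc (u + v)) q r * euler_coeff r * (a * B
                * y) ^ r))) summable_on UNIV"
    using infsum_pair(2)[OF sT] unfolding way1 c_def Y_def by (simp add: mult.assoc)
qed

end

context q_series
begin

section \<open>Euler's transformation\<close>

definition phi_fps :: "complex \<Rightarrow> complex \<Rightarrow> complex \<Rightarrow> complex fps" where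
  "phi_fps A B C = Abs_fps (\<lambda>n. qpoch A q n * qpoch B q n / (qpoch q q n * qpoch C q n))"

lemma eval_phi_fps: "eval_fps (phi_fps A B C) z = phi21 A B C q z"
  by (simp add: phi_fps_def eval_fps_def phi21_def)

lemma phi_fps_rec:
  assumes "1 - C * q ^ n \<noteq> 0"
  shows "(1 - q ^ Suc n) * (1 - C * q ^ n) * fps_nth (phi_fps A B C) (Suc n)
      = (1 - A * q ^ n) * (1 - B * q ^ n) * fps_nth (phi_fps A B C) n"
proof -
  have cancel: "e * c * ((x * X) * (y * Y) / ((p * e) * (r * c))) = X * Y * (x * y / (p * r))"
    if "e \<noteq> 0" "c \<noteq> 0" for e c x X y Y p r :: complex
    using that by simp
  show ?thesis
    unfolding phi_fps_def fps_nth_Abs_fps qpoch_q_Suc qpoch_Suc[of A] qpoch_Suc[of B] qpoch_Suc[of C]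
    by (rule cancel[OF one_minus_q_power_neq_0 assms])
qed

lemma phi_fps_abs_summable:
  assumes C: "\<And>n. qpoch C q n \<noteq> 0" and r: "0 \<le> r" "r < 1"
  shows "fps_abs_summable (phi_fps A B C) r"
proof -
  obtain K where K: "K > 0" "\<And>n. norm (qpoch A q n) \<le> K" using qpoch_bounded[of "norm A"] by
      (metis order_refl)
  obtain L where L: "L > 0" "\<And>n. norm (qpoch B q n) \<le> L" using qpoch_bounded[of "norm B"] by
      (metis order_refl)
  obtain D where D: "D > 0" "\<And>n. norm (1 / qpoch q q n) \<le> D" using inverse_qpoch_q_bounded by blast
  have "1 - C * q ^ k \<noteq> 0" for k using C[of "Suc k"] by (auto simp: qpoch_Suc)
  hence "qpoch_inf C q \<noteq> 0" unfolding qpoch_inf_def by (rule prodinf_nonzero[OF convergent_prod_qpoch])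
  hence "(\<lambda>n. 1 / qpoch C q n) \<longlonglongrightarrow> 1 / qpoch_inf C q"
    by (intro tendsto_intros qpoch_tendsto)
  hence "Bseq (\<lambda>n. 1 / qpoch C q n)" by (intro convergent_imp_Bseq convergentI)
  then obtain M where M: "M > 0" "\<And>n. norm (1 / qpoch C q n) \<le> M" unfolding Bseq_def by blast
  show ?thesis
    unfolding fps_abs_summable_def
  proof (rule summable_comparison_test'[where N = 0])
    show "summable (\<lambda>n. (K * L * (D * M)) * r ^ n)"
      by (intro summable_mult summable_geometric) (use r in simp)
    fix n
    have "norm (fps_nth (phi_fps A B C) n) = norm (qpoch A q n) * norm (qpoch B q n) * (norm
        (1 / qpoch q q n) * norm (1 / qpoch C q n))"
      by (simp add: phi_fps_def norm_mult norm_divide)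
    also have "\<dots> \<le> K * L * (D * M)"
      by (intro mult_mono K L D M mult_nonneg_nonneg) (use K L D M in auto)
    finally have "norm (fps_nth (phi_fps A B C) n) \<le> K * L * (D * M)" .
    thus "norm (norm (fps_nth (phi_fps A B C) n) * r ^ n) \<le> (K * L * (D * M)) * r ^ n"
      using r by (simp add: abs_mult mult_right_mono)
  qed
qed

text \<open>Both sides, as power series in \<open>z\<close>, solve Heine's second-order q-difference equation: multiplying a
solution with the transformed parameters by \<open>(\<mu>z)/(z)\<close>, \<open>\<mu> = AB/C\<close>, changes the equation into the original
one. The equation is a two-term recurrence for the coefficients, so the constant coefficient fixes
the solution. The argument is free of the restrictions on the size of the parameters that iterating Heine's
transformation would impose.\<close>
lemma euler_transformation:
  assumes nz: "q \<noteq> 0" "A \<noteq> 0" "B \<noteq> 0" "C \<noteq> 0" and C: "\<And>n. qpoch C q n \<noteq> 0"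
    and z: "norm z < 1" "norm (A * B / C * z) < 1"
  shows "phi21 A B C q z =
    qpoch_inf (A * B / C * z) q / qpoch_inf z q * phi21 (C / A) (C / B) C q (A * B / C * z)"
proof -
  define \<mu> where "\<mu> = A * B / C"
  define W where "W = fps_qbinom \<mu> 1"
  define g where "g = phi_fps (C / A) (C / B) C"
  define G where "G = Abs_fps (\<lambda>n. fps_nth g n * \<mu> ^ n)"
  define R where "R = fps_const (1 + C / q) - fps_const (A + B) * fps_X"
  have C1: "1 - C * q ^ n \<noteq> 0" for n using C[of "Suc n"] by (auto simp: qpoch_Suc)
  have g_rec: "(1 - q ^ Suc n) * (1 - C * q ^ n) * fps_nth g (Suc n) = (1 - C / A * q ^ n) * (1
      - C / B * q ^ n) * fps_nth g n" for n
    unfolding g_def by (rule phi_fps_rec[OF C1])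
  have factor: "(1 - C / A * x) * (1 - C / B * x) * \<mu> = \<mu> - (A + B) * x + C * x ^ 2" for x
    using nz unfolding \<mu>_def by (simp add: field_simps power2_eq_square)
  have factor': "1 - (1 + C / q) * q ^ Suc n + C / q * (q ^ Suc n * q ^ Suc n) = (1 - q ^ Suc n) *
      (1 - C * q ^ n)" for n
    using nz by (simp add: field_simps)
  \<comment> \<open>The equation of \<open>G\<close>, multiplied by the dilated \<open>W\<close>, is the equation of \<open>t = W G\<close>.\<close>
  have G_eq: "(1 - fps_const \<mu> * fps_X) * G - R * dilate G + fps_const (C / q) * ((1 - fps_const q
      * fps_X) * dilate (dilate G)) = 0"
  proof (rule fps_ext)
    fix n
    show "fps_nth ((1 - fps_const \<mu> * fps_X) * G - R * dilate G + fps_const (C / q) * ((1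
        - fps_const q * fps_X) * dilate (dilate G))) n = fps_nth 0 n"
    proof (cases n)
      case 0
      thus ?thesis by (simp add: R_def G_def g_def phi_fps_def)
    next
      case (Suc m)
      have "fps_nth ((1 - fps_const \<mu> * fps_X) * G - R * dilate G + fps_const (C / q) * ((1
          - fps_const q * fps_X) * dilate (dilate G))) (Suc m)
        = (fps_nth G (Suc m) - \<mu> * fps_nth G m) - ((1 + C / q) * (q ^ Suc m * fps_nth G (Suc m)) -
            (A + B) * (q ^ m * fps_nth G m))
          + C / q * ((q ^ Suc m * (q ^ Suc m * fps_nth G (Suc m))) - q * (q ^ m * (q ^ m
              * fps_nth G m)))"
        unfolding fps_add_nth fps_sub_nth R_def linear_fps_mult_nth fps_mult_left_const_nth
        by (simp add: left_diff_distrib mult.assoc)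
      also have "\<dots> = (1 - (1 + C / q) * q ^ Suc m + C / q * (q ^ Suc m * q ^ Suc m)) * fps_nth G (Suc m)
          - (\<mu> - (A + B) * q ^ m + C / q * q * (q ^ m) ^ 2) * fps_nth G m"
        by (simp add: algebra_simps power2_eq_square)
      also have "C / q * q = C" using nz by simp
      also have "(1 - (1 + C / q) * q ^ Suc m + C / q * (q ^ Suc m * q ^ Suc m)) * fps_nth G (Suc m)
          = ((1 - q ^ Suc m) * (1 - C * q ^ m) * fps_nth g (Suc m)) * \<mu> ^ Suc m"
        unfolding factor' G_def by (simp add: mult.assoc)
      also have "\<dots> = ((1 - C / A * q ^ m) * (1 - C / B * q ^ m) * \<mu>) * fps_nth G m"
        unfolding g_rec G_def by (simp add: mult_ac)
      also have "(1 - C / A * q ^ m) * (1 - C / B * q ^ m) * \<mu> = \<mu> - (A + B) * q ^ m + C * (q ^ m) ^ 2"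
        by (rule factor)
      finally show ?thesis by (simp add: Suc)
    qed
  qed
  define t where "t = W * G"
  have W1: "(1 - fps_X) * W = (1 - fps_const \<mu> * fps_X) * dilate W"
    using fps_qbinom_dilate[of 1 \<mu>] by (simp add: W_def)
  have W2: "(1 - fps_const q * fps_X) * dilate W = (1 - fps_const (\<mu> * q) * fps_X) * dilate (dilate W)"
  proof -
    have lin: "dilate (1 - fps_const c * fps_X) = 1 - fps_const (c * q) * fps_X" for c
      by (rule fps_ext) (auto simp: fps_X_def fps_one_def)
    show ?thesis
      using arg_cong[OF fps_qbinom_dilate[of 1 \<mu>], of dilate]
      unfolding dilate_mult lin W_def by simp
  qed
  have t_eq: "(1 - fps_X) * t - R * dilate t + fps_const (C / q) * ((1 - fps_const (\<mu> * q) * fps_X)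
      * dilate (dilate t)) = 0"
  proof -
    have "(1 - fps_X) * t - R * dilate t + fps_const (C / q) * ((1 - fps_const (\<mu> * q) * fps_X)
        * dilate (dilate t))
      = ((1 - fps_X) * W) * G - R * (dilate W * dilate G) + fps_const (C / q) * (((1 - fps_const (\<mu>
          * q) * fps_X) * dilate (dilate W)) * dilate (dilate G))"
      unfolding t_def dilate_mult by (simp only: mult_ac)
    also have "\<dots> = dilate W * ((1 - fps_const \<mu> * fps_X) * G - R * dilate G + fps_const (C / q) *
        ((1 - fps_const q * fps_X) * dilate (dilate G)))"
      unfolding W1 W2 [symmetric] by (simp add: algebra_simps)
    finally show ?thesis unfolding G_eq by simp
  qed
  have t_rec: "(1 - q ^ Suc n) * (1 - C * q ^ n) * fps_nth t (Suc n) = (1 - A * q ^ n) * (1 - B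
      * q ^ n) * fps_nth t n" for n
  proof -
    have "fps_nth ((1 - fps_X) * t - R * dilate t + fps_const (C / q) * ((1 - fps_const (\<mu> * q)
        * fps_X) * dilate (dilate t))) (Suc n)
      = (fps_nth t (Suc n) - fps_nth t n) - ((1 + C / q) * (q ^ Suc n * fps_nth t (Suc n)) - (A + B)
          * (q ^ n * fps_nth t n))
          + C / q * ((q ^ Suc n * (q ^ Suc n * fps_nth t (Suc n))) - \<mu> * q * (q ^ n * (q ^ n
              * fps_nth t n)))"
      unfolding fps_add_nth fps_sub_nth R_def linear_fps_mult_nth fps_mult_left_const_nth
      by (simp add: left_diff_distrib mult.assoc)
    also have "\<dots> = (1 - (1 + C / q) * q ^ Suc n + C / q * (q ^ Suc n * q ^ Suc n)) * fps_nth t (Suc n)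
          - (1 - (A + B) * q ^ n + C / q * \<mu> * q * (q ^ n * q ^ n)) * fps_nth t n"
      by (simp add: algebra_simps)
    also have "C / q * \<mu> * q = A * B" using nz by (simp add: \<mu>_def)
    also have "1 - (A + B) * q ^ n + A * B * (q ^ n * q ^ n) = (1 - A * q ^ n) * (1 - B * q ^ n)"
      by (simp add: algebra_simps)
    finally show ?thesis unfolding factor' t_eq by simp
  qed
  have f_rec: "(1 - q ^ Suc n) * (1 - C * q ^ n) * fps_nth (phi_fps A B C) (Suc n)
      = (1 - A * q ^ n) * (1 - B * q ^ n) * fps_nth (phi_fps A B C) n" for n
    by (rule phi_fps_rec[OF C1])
  have "fps_nth (phi_fps A B C) n = fps_nth t n" for n
  proof (induction n)
    case 0
    show ?case by (simp add: t_def W_def G_def g_def phi_fps_def)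
  next
    case (Suc n)
    have "(1 - q ^ Suc n) * (1 - C * q ^ n) \<noteq> 0"
      using one_minus_q_power_neq_0[of n] C1[of n] by simp
    moreover have "(1 - q ^ Suc n) * (1 - C * q ^ n) * fps_nth (phi_fps A B C) (Suc n)
        = (1 - q ^ Suc n) * (1 - C * q ^ n) * fps_nth t (Suc n)"
      unfolding f_rec t_rec Suc ..
    ultimately show ?case by (metis mult_left_cancel)
  qed
  hence ft: "phi_fps A B C = W * G" unfolding t_def by (rule fps_ext)
  have gs: "fps_abs_summable g (norm (\<mu> * z))"
    unfolding g_def using z(2) by (intro phi_fps_abs_summable C) (auto simp: \<mu>_def)
  hence "fps_abs_summable G (norm z)"
    by (simp add: fps_abs_summable_def G_def norm_mult norm_power power_mult_distrib mult_ac)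
  moreover have "fps_abs_summable W (norm z)"
    unfolding W_def using z by (intro fps_abs_summable_qbinom) auto
  ultimately have "phi21 A B C q z = eval_fps W z * eval_fps G z"
    by (simp add: ft eval_fps_mult_abs flip: eval_phi_fps)
  also have "eval_fps W z = qpoch_inf (\<mu> * z) q / qpoch_inf z q"
    unfolding W_def using eval_fps_qbinom[of 1 z \<mu>] z by simp
  also have "eval_fps G z = eval_fps g (\<mu> * z)"
    by (simp add: eval_fps_def G_def power_mult_distrib mult_ac)
  also have "\<dots> = phi21 (C / A) (C / B) C q (\<mu> * z)"
    unfolding g_def by (rule eval_phi_fps)
  finally show ?thesis unfolding \<mu>_def .
qed

lemma phi21_commute: "phi21 A B C q z = phi21 B A C q z"
  by (simp add: phi21_def mult.commute)

section \<open>The integral\<close>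

text \<open>The power series in \<open>s\<close> are inserted one after the other, each under a uniform bound on the circle, and the
integral is evaluated monomial by monomial. The resulting iterated sum is the left side of
\<open>rogers_szego_bilinear_sum\<close>.\<close>
lemma circle_integral:
  fixes k :: complex
  assumes nz: "q \<noteq> 0" "H \<noteq> 0" "y \<noteq> 0" and g: "g * g' = q"
    and k: "1 < norm k" "norm y < norm k" and a: "norm a * norm k < 1" and B: "norm B * norm k < 1"
  shows "((\<lambda>\<psi>. let s = k * cis \<psi> in
            eval_fps (theta_pos H y) s * eval_fps (theta_neg H y) (1 / s) *
              (eval_fps (fps_qbinom g B) s * (eval_fps (fps_qbinom g' a) s * eval_fps
                  (kernel_fps y s) (a * B))))
          has_integral
            2 * of_real pi * moment H y 0 *
              (infsum (rs_phi_term a B g y) UNIV * infsum (rs_phi_term B a g' y) UNIV)) {-pi..pi}"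
proof -
  define \<rho> where "\<rho> = norm k"
  define s where "s \<psi> = k * cis \<psi>" for \<psi>
  define V where "V \<psi> = eval_fps (theta_pos H y) (s \<psi>) * eval_fps (theta_neg H y) (1 / s \<psi>)" for \<psi>
  define K where "K \<psi> = eval_fps (kernel_fps y (s \<psi>)) (a * B)" for \<psi>
  have k0: "k \<noteq> 0" using k by auto
  have \<rho>: "\<rho> > 1" "norm y < \<rho>" "norm a * \<rho> < 1" "norm B * \<rho> < 1" using k a B by (simp_all add: \<rho>_def)
  have ns: "norm (s \<psi>) = \<rho>" "norm (1 / s \<psi>) = 1 / \<rho>" "s \<psi> \<noteq> 0" for \<psi>
    using k0 by (simp_all add: s_def \<rho>_def norm_mult norm_divide)
  have tp: "fps_abs_summable (theta_pos H y) \<rho>"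
    by (rule fps_abs_summable_theta_pos) (use \<rho> in simp)
  have tn: "fps_abs_summable (theta_neg H y) (1 / \<rho>)"
    by (rule fps_abs_summable_theta_neg) (use \<rho> in \<open>simp_all add: field_simps\<close>)
  define VM where "VM = (\<Sum>n. norm (fps_nth (theta_pos H y) n) * \<rho> ^ n) * (\<Sum>n. norm (fps_nth
      (theta_neg H y) n) * (1 / \<rho>) ^ n)"
  have VM: "norm (V \<psi>) \<le> VM" for \<psi>
    unfolding V_def VM_def norm_mult
    by (intro mult_mono norm_eval_fps_le tp tn ns norm_ge_zero order_trans[OF norm_ge_zero norm_eval_fps_le[OF tp ns(1)]])
  have VM0: "VM \<ge> 0" using VM[of 0] norm_ge_zero order_trans by blast
  have int0: "((\<lambda>\<psi>. V \<psi> * s \<psi> ^ n) has_integral 2 * of_real pi * moment H y n) {-pi..pi}" for n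
    using has_integral_laurent_product[OF k0, of "theta_pos H y" "theta_neg H y" n] tp tn
    unfolding V_def s_def moment_def \<rho>_def by simp
  \<comment> \<open>Induction on the power \<open>r\<close> of \<open>\<alpha>\<close>: integrands and values satisfy the same recurrence.\<close>
  have intA: "((\<lambda>\<psi>. V \<psi> * (s \<psi> ^ n * fps_nth (kernel_fps y (s \<psi>)) r)) has_integral
      2 * of_real pi * kernel_moment y (moment H y) r n) {-pi..pi}" for n r
  proof (induction r arbitrary: n rule: less_induct)
    case (less r)
    have m: "moment H y (Suc (Suc n)) = (1 + y) * moment H y (Suc n) - y * (1 - q ^ Suc n)
        * moment H y n" for n
      by (rule moment_recurrences(2)[OF nz])
    note kr = kernel_fps_rec[OF ns(3), where y = y]
    note mr = kernel_moment_rec[where m = "moment H y" and y = y, OF m]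
    consider "r = 0" | "r = Suc 0" | m where "r = Suc (Suc m)" by (metis old.nat.exhaust)
    thus ?case
    proof cases
      case 1
      thus ?thesis using int0[of n] by (simp add: kr(1) mr(1))
    next
      case 2
      have q1: "1 - q \<noteq> 0" using one_minus_q_power_neq_0[of 0] by simp
      have "((\<lambda>\<psi>. 1 / (1 - q) * (V \<psi> * s \<psi> ^ (n + 2) - (1 + y) * (V \<psi> * s \<psi> ^ (n + 1)))) has_integral
         1 / (1 - q) * (2 * of_real pi * moment H y (n + 2) - (1 + y) * (2 * of_real pi * moment H y
             (n + 1)))) {-pi..pi}"
        by (intro has_integral_mult_right has_integral_diff int0)
      moreover have "1 / (1 - q) * (V \<psi> * s \<psi> ^ (n + 2) - (1 + y) * (V \<psi> * s \<psi> ^ (n + 1)))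
          = V \<psi> * (s \<psi> ^ n * fps_nth (kernel_fps y (s \<psi>)) r)" for \<psi>
      proof -
        have "fps_nth (kernel_fps y (s \<psi>)) r = (s \<psi> ^ 2 - (1 + y) * s \<psi>) / (1 - q)"
          using kr(2)[of \<psi>] q1 unfolding 2 by (metis nonzero_mult_div_cancel_left)
        thus ?thesis by (simp add: power_add power2_eq_square field_simps)
      qed
      moreover have "1 / (1 - q) * (2 * of_real pi * moment H y (n + 2) - (1 + y) * (2 * of_real pi
          * moment H y (n + 1)))
          = 2 * of_real pi * kernel_moment y (moment H y) r n"
      proof -
        have "kernel_moment y (moment H y) r n = (moment H y (n + 2) - (1 + y) * moment H y (n
            + 1)) / (1 - q)"
          using mr(2)[of n] q1 unfolding 2 by (metis nonzero_mult_div_cancel_left)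
        thus ?thesis by (simp add: field_simps)
      qed
      ultimately show ?thesis by simp
    next
      case (3 m)
      define Q where "Q = 1 - q ^ Suc (Suc m)"
      have Q: "Q \<noteq> 0" unfolding Q_def by (rule one_minus_q_power_neq_0)
      define F where "F r n \<psi> = V \<psi> * (s \<psi> ^ n * fps_nth (kernel_fps y (s \<psi>)) r)" for r n \<psi>
      define M where "M = kernel_moment y (moment H y)"
      have IH: "(F (Suc m) n has_integral 2 * of_real pi * M (Suc m) n) {-pi..pi}"
               "(F m n has_integral 2 * of_real pi * M m n) {-pi..pi}" for n
        unfolding F_def M_def using less.IH[of "Suc m" n] less.IH[of m n] 3 by simp_all
      have "((\<lambda>\<psi>. 1 / Q * (F (Suc m) (n + 2) \<psi> - (1 + y) * q ^ Suc m * F (Suc m) (n + 1) \<psi> + y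
          * q ^ m * F m (n + 2) \<psi>)) has_integral
         1 / Q * (2 * of_real pi * M (Suc m) (n + 2) - (1 + y) * q ^ Suc m * (2 * of_real pi * M
             (Suc m) (n + 1)) + y * q ^ m * (2 * of_real pi * M m (n + 2)))) {-pi..pi}"
        by (intro has_integral_mult_right has_integral_add has_integral_diff IH)
      moreover have "1 / Q * (F (Suc m) (n + 2) \<psi> - (1 + y) * q ^ Suc m * F (Suc m) (n + 1) \<psi> + y
          * q ^ m * F m (n + 2) \<psi>)
          = F r n \<psi>" for \<psi>
      proof -
        have e: "fps_nth (kernel_fps y (s \<psi>)) r = (s \<psi> ^ 2 * fps_nth (kernel_fps y (s \<psi>)) (Suc m) -
            (1 + y) * q ^ Suc m * (s \<psi> * fps_nth (kernel_fps y (s \<psi>)) (Suc m))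
             + y * q ^ m * (s \<psi> ^ 2 * fps_nth (kernel_fps y (s \<psi>)) m)) / Q"
          using kr(3)[of m \<psi>] Q unfolding 3 Q_def by (metis nonzero_mult_div_cancel_left)
        show ?thesis unfolding F_def e by
            (simp add: power_add power2_eq_square add_divide_distrib diff_divide_distrib algebra_simps)
      qed
      moreover have "1 / Q * (2 * of_real pi * M (Suc m) (n + 2) - (1 + y) * q ^ Suc m * (2
          * of_real pi * M (Suc m) (n + 1)) + y * q ^ m * (2 * of_real pi * M m (n + 2)))
          = 2 * of_real pi * M r n"
      proof -
        have e: "M r n = (M (Suc m) (n + 2) - (1 + y) * q ^ Suc m * M (Suc m) (n + 1) + y * q ^ m
            * M m (n + 2)) / Q"
          using mr(3)[of m n] Q unfolding 3 Q_def M_def by (metis nonzero_mult_div_cancel_left)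
        show ?thesis unfolding e by (simp add: add_divide_distrib diff_divide_distrib algebra_simps)
      qed
      ultimately show ?thesis by (simp add: F_def M_def)
    qed
  qed
  obtain C where C: "C > 0" "\<And>a n. norm a \<le> 1 \<Longrightarrow> norm (qpoch a q n) \<le> C"
    using qpoch_bounded[of 1] by blast
  \<comment> \<open>Majorants, independent of the point on the circle, for the coefficients of \<open>kernel_fps\<close>.\<close>
  define M1 where "M1 i = C * (norm (inv_qfact i) * (\<rho> ^ 2) ^ i)" for i
  define M2 where "M2 i = norm (euler_coeff i) * (norm y * \<rho>) ^ i" for i
  define MK where "MK r = (\<Sum>i\<le>r. M1 i * M2 (r - i))" for r
  have ab: "norm (a * B) * \<rho> ^ 2 < 1"
  proof -
    have "(norm a * \<rho>) * (norm B * \<rho>) < 1 * 1"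
      by (rule mult_strict_mono') (use \<rho> in auto)
    thus ?thesis by (simp add: norm_mult power2_eq_square mult_ac)
  qed
  have AK: "norm (fps_nth (kernel_fps y (s \<psi>)) r) \<le> MK r" for \<psi> r
  proof -
    have "norm (fps_nth (kernel_fps y (s \<psi>)) r) \<le> (\<Sum>i\<le>r. norm (fps_nth (fps_qbinom (1 / s \<psi>)
        (s \<psi> ^ 2)) i * fps_nth (fps_qpoch (y * s \<psi>)) (r - i)))"
      unfolding kernel_fps_def fps_mult_nth atLeast0AtMost by (rule norm_sum)
    also have "\<dots> \<le> MK r"
      unfolding MK_def
    proof (rule sum_mono)
      fix i
      have "norm (1 / s \<psi>) \<le> 1" unfolding ns using \<rho> by simp
      hence "norm (qpoch (1 / s \<psi>) q i) \<le> C" by (rule C(2))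
      hence "norm (qpoch (1 / s \<psi>) q i) * (norm (inv_qfact i) * (\<rho> ^ 2) ^ i) \<le> M1 i"
        unfolding M1_def by (rule mult_right_mono) simp
      moreover have "norm (fps_nth (fps_qbinom (1 / s \<psi>) (s \<psi> ^ 2)) i) = norm (qpoch (1 / s \<psi>) q i)
          * (norm (inv_qfact i) * (\<rho> ^ 2) ^ i)"
        by (simp add: inv_qfact_def norm_mult norm_divide norm_power ns)
      moreover have "norm (fps_nth (fps_qpoch (y * s \<psi>)) (r - i)) = M2 (r - i)"
        by (simp add: M2_def norm_mult norm_power ns)
      moreover have "M2 (r - i) \<ge> 0" using \<rho> by (simp add: M2_def)
      ultimately show "norm (fps_nth (fps_qbinom (1 / s \<psi>) (s \<psi> ^ 2)) i * fps_nth (fps_qpoch (y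
          * s \<psi>)) (r - i)) \<le> M1 i * M2 (r - i)"
        unfolding norm_mult by (simp add: mult_right_mono)
    qed
    finally show ?thesis .
  qed
  have MK0: "MK r \<ge> 0" for r using order_trans[OF norm_ge_zero AK[of 0 r]] .
  have MKs: "summable (\<lambda>r. MK r * norm (a * B) ^ r)"
  proof -
    have "fps_abs_summable (fps_inv_qpoch (of_real (\<rho> ^ 2))) (norm (a * B))"
      by (rule fps_abs_summable_qbinom) (use ab \<rho> in \<open>simp_all add: norm_power mult_ac\<close>)
    hence "summable (\<lambda>n. C * (norm (fps_nth (fps_inv_qpoch (of_real (\<rho> ^ 2))) n) * norm (a * B) ^ n))"
      unfolding fps_abs_summable_def by (rule summable_mult)
    hence s1: "summable (\<lambda>n. M1 n * norm (a * B) ^ n)"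
      using \<rho> by (simp add: M1_def inv_qfact_def norm_mult norm_divide norm_power mult_ac)
    have "fps_abs_summable (fps_qpoch (of_real (norm y * \<rho>))) (norm (a * B))"
      by (rule fps_abs_summable_qpoch) simp
    hence s2: "summable (\<lambda>n. M2 n * norm (a * B) ^ n)"
      unfolding fps_abs_summable_def using \<rho> by (simp add: M2_def norm_mult norm_power)
    have nn: "M1 n \<ge> 0" "M2 n \<ge> 0" for n using C \<rho> by (simp_all add: M1_def M2_def)
    have "summable (\<lambda>r. \<Sum>i\<le>r. (M1 i * norm (a * B) ^ i) * (M2 (r - i) * norm (a * B) ^ (r - i)))"
      by (rule summable_Cauchy_product) (use s1 s2 nn in simp_all)
    moreover have "(\<Sum>i\<le>r. (M1 i * norm (a * B) ^ i) * (M2 (r - i) * norm (a * B) ^ (r - i))) = MK r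
        * norm (a * B) ^ r" for r
      unfolding MK_def sum_distrib_right
      by (intro sum.cong refl) (simp add: power_add [symmetric] mult_ac)
    ultimately show ?thesis by simp
  qed
  define KM where "KM = (\<Sum>r. MK r * norm (a * B) ^ r)"
  have Ksum: "summable (\<lambda>r. norm (fps_nth (kernel_fps y (s \<psi>)) r * (a * B) ^ r))" for \<psi>
    by (rule summable_comparison_test'[OF MKs, where N = 0])
       (simp add: norm_mult norm_power mult_right_mono AK)
  have KM: "norm (K \<psi>) \<le> KM" for \<psi>
  proof -
    have "norm (K \<psi>) \<le> (\<Sum>r. norm (fps_nth (kernel_fps y (s \<psi>)) r * (a * B) ^ r))"
      unfolding K_def eval_fps_def by (rule summable_norm[OF Ksum])
    also have "\<dots> \<le> KM" unfolding KM_def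
      by (intro suminf_le Ksum MKs) (simp add: norm_mult norm_power mult_right_mono AK)
    finally show ?thesis .
  qed
  have KM0: "KM \<ge> 0" using KM[of 0] norm_ge_zero order_trans by blast
  have pi: "- pi \<le> pi" by simp
  define \<tau> where "\<tau> n = (\<Sum>r. (a * B) ^ r * (2 * of_real pi * kernel_moment y (moment H y) r n))" for n
  have intK: "((\<lambda>\<psi>. V \<psi> * (s \<psi> ^ n * K \<psi>)) has_integral \<tau> n) {-pi..pi}" for n
  proof -
    have "((\<lambda>\<psi>. \<Sum>r. (a * B) ^ r * (V \<psi> * (s \<psi> ^ n * fps_nth (kernel_fps y (s \<psi>)) r)))
        has_integral \<tau> n) {-pi..pi}"
      unfolding \<tau>_def
    proof (rule has_integral_suminf[OF has_integral_mult_right[OF intA] _ _ pi])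
      show "norm ((a * B) ^ r * (V \<psi> * (s \<psi> ^ n * fps_nth (kernel_fps y (s \<psi>)) r))) \<le> (VM * \<rho> ^ n) *
          (MK r * norm (a * B) ^ r)" for r \<psi>
      proof -
        have "norm ((a * B) ^ r * (V \<psi> * (s \<psi> ^ n * fps_nth (kernel_fps y (s \<psi>)) r)))
           = (norm (V \<psi>) * \<rho> ^ n) * (norm (fps_nth (kernel_fps y (s \<psi>)) r) * norm (a * B) ^ r)"
          by (simp add: norm_mult norm_power ns mult_ac)
        also have "\<dots> \<le> (VM * \<rho> ^ n) * (MK r * norm (a * B) ^ r)"
          by (intro mult_mono VM AK mult_nonneg_nonneg order_refl) (use VM0 MK0 \<rho> in auto)
        finally show ?thesis .
      qed
      show "summable (\<lambda>r. (VM * \<rho> ^ n) * (MK r * norm (a * B) ^ r))" by (rule summable_mult[OF MKs])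
    qed
    moreover have "(\<Sum>r. (a * B) ^ r * (V \<psi> * (s \<psi> ^ n * fps_nth (kernel_fps y (s \<psi>)) r))) = V \<psi> *
        (s \<psi> ^ n * K \<psi>)" for \<psi>
    proof -
      have "(\<lambda>r. fps_nth (kernel_fps y (s \<psi>)) r * (a * B) ^ r) sums K \<psi>"
        unfolding K_def eval_fps_def by (rule summable_sums[OF summable_norm_cancel[OF Ksum]])
      hence "(\<lambda>r. (V \<psi> * s \<psi> ^ n) * (fps_nth (kernel_fps y (s \<psi>)) r * (a * B) ^ r)) sums ((V \<psi>
          * s \<psi> ^ n) * K \<psi>)"
        by (rule sums_mult)
      thus ?thesis by (simp add: sums_iff mult_ac)
    qed
    ultimately show ?thesis by simp
  qed
  have gB: "fps_abs_summable (fps_qbinom g B) \<rho>" and ga: "fps_abs_summable (fps_qbinom g' a) \<rho>"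
    by (rule fps_abs_summable_qbinom; use \<rho> in simp)+
  define w where "w = fps_nth (fps_qbinom g B)"
  define w' where "w' = fps_nth (fps_qbinom g' a)"
  have int2: "((\<lambda>\<psi>. V \<psi> * (s \<psi> ^ n * (eval_fps (fps_qbinom g' a) (s \<psi>) * K \<psi>))) has_integral
      (\<Sum>j. w' j * \<tau> (n + j))) {-pi..pi}" for n
  proof -
    have "((\<lambda>\<psi>. \<Sum>j. w' j * (V \<psi> * (s \<psi> ^ (n + j) * K \<psi>))) has_integral (\<Sum>j. w' j * \<tau> (n
        + j))) {-pi..pi}"
    proof (rule has_integral_suminf[OF has_integral_mult_right[OF intK] _ _ pi])
      show "norm (w' j * (V \<psi> * (s \<psi> ^ (n + j) * K \<psi>))) \<le> (VM * \<rho> ^ n * KM) * (norm (w' j) * \<rho> ^ j)"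
          for j \<psi>
      proof -
        have "norm (w' j * (V \<psi> * (s \<psi> ^ (n + j) * K \<psi>))) = (norm (V \<psi>) * \<rho> ^ n * norm (K \<psi>)) *
            (norm (w' j) * \<rho> ^ j)"
          by (simp add: norm_mult norm_power ns power_add mult_ac)
        also have "\<dots> \<le> (VM * \<rho> ^ n * KM) * (norm (w' j) * \<rho> ^ j)"
          by (intro mult_mono VM KM mult_nonneg_nonneg order_refl) (use VM0 KM0 \<rho> in auto)
        finally show ?thesis .
      qed
      show "summable (\<lambda>j. (VM * \<rho> ^ n * KM) * (norm (w' j) * \<rho> ^ j))"
        using ga unfolding fps_abs_summable_def w'_def by (rule summable_mult)
    qed
    moreover have "(\<Sum>j. w' j * (V \<psi> * (s \<psi> ^ (n + j) * K \<psi>))) = V \<psi> * (s \<psi> ^ n * (eval_fps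
        (fps_qbinom g' a) (s \<psi>) * K \<psi>))" for \<psi>
    proof -
      have "(\<lambda>j. w' j * s \<psi> ^ j) sums eval_fps (fps_qbinom g' a) (s \<psi>)"
        unfolding w'_def by (rule fps_abs_summable_sums) (simp add: ns ga)
      hence "(\<lambda>j. (V \<psi> * s \<psi> ^ n * K \<psi>) * (w' j * s \<psi> ^ j)) sums ((V \<psi> * s \<psi> ^ n * K \<psi>) * eval_fps
          (fps_qbinom g' a) (s \<psi>))"
        by (rule sums_mult)
      thus ?thesis by (simp add: sums_iff power_add mult_ac)
    qed
    ultimately show ?thesis by simp
  qed
  define AM where "AM = (\<Sum>n. norm (fps_nth (fps_qbinom g' a) n) * \<rho> ^ n)"
  have AM: "norm (eval_fps (fps_qbinom g' a) (s \<psi>)) \<le> AM" for \<psi>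
    unfolding AM_def by (rule norm_eval_fps_le[OF ga ns(1)])
  have AM0: "AM \<ge> 0" using AM[of 0] norm_ge_zero order_trans by blast
  have int3: "((\<lambda>\<psi>. V \<psi> * (eval_fps (fps_qbinom g B) (s \<psi>) * (eval_fps (fps_qbinom g' a) (s \<psi>)
      * K \<psi>))) has_integral
     (\<Sum>i. w i * (\<Sum>j. w' j * \<tau> (i + j)))) {-pi..pi}"
  proof -
    define U where "U \<psi> = eval_fps (fps_qbinom g' a) (s \<psi>) * K \<psi>" for \<psi>
    have U: "norm (U \<psi>) \<le> AM * KM" for \<psi>
      unfolding U_def norm_mult by (intro mult_mono AM KM) (use AM0 in auto)
    have "((\<lambda>\<psi>. \<Sum>i. w i * (V \<psi> * (s \<psi> ^ i * U \<psi>))) has_integral (\<Sum>i. w i * (\<Sum>j. w' j * \<tau> (i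
        + j)))) {-pi..pi}"
      unfolding U_def
    proof (rule has_integral_suminf[OF has_integral_mult_right[OF int2] _ _ pi], fold U_def)
      show "norm (w i * (V \<psi> * (s \<psi> ^ i * U \<psi>))) \<le> (VM * (AM * KM)) * (norm (w i) * \<rho> ^ i)" for i \<psi>
      proof -
        have "norm (w i * (V \<psi> * (s \<psi> ^ i * U \<psi>))) = (norm (V \<psi>) * norm (U \<psi>)) * (norm (w i) * \<rho> ^ i)"
          by (simp add: norm_mult norm_power ns mult_ac)
        also have "\<dots> \<le> (VM * (AM * KM)) * (norm (w i) * \<rho> ^ i)"
          by (intro mult_mono VM U mult_nonneg_nonneg order_refl) (use VM0 AM0 KM0 \<rho> in auto)
        finally show ?thesis .
      qed
      show "summable (\<lambda>i. (VM * (AM * KM)) * (norm (w i) * \<rho> ^ i))"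
        using gB unfolding fps_abs_summable_def w_def by (rule summable_mult)
    qed
    moreover have "(\<Sum>i. w i * (V \<psi> * (s \<psi> ^ i * U \<psi>))) = V \<psi> * (eval_fps (fps_qbinom g B) (s \<psi>)
        * U \<psi>)" for \<psi>
    proof -
      have "(\<lambda>i. w i * s \<psi> ^ i) sums eval_fps (fps_qbinom g B) (s \<psi>)"
        unfolding w_def by (rule fps_abs_summable_sums) (simp add: ns gB)
      hence "(\<lambda>i. (V \<psi> * U \<psi>) * (w i * s \<psi> ^ i)) sums ((V \<psi> * U \<psi>) * eval_fps (fps_qbinom g B) (s \<psi>))"
        by (rule sums_mult)
      thus ?thesis by (simp add: sums_iff mult_ac)
    qed
    ultimately show ?thesis unfolding U_def by simp
  qed
  have \<tau>: "\<tau> n = 2 * of_real pi * moment H y 0 *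
      (rogers_szego y n * (\<Sum>r. qpoch (q ^ Suc n) q r * euler_coeff r * (a * B * y) ^ r))" for n
  proof -
    have "norm (a * B * y) < 1"
    proof -
      have "norm (a * B) * norm y \<le> norm (a * B) * \<rho> ^ 2"
      proof (rule mult_left_mono)
        have "\<rho> * 1 \<le> \<rho> * \<rho>" using \<rho> by (intro mult_left_mono) auto
        thus "norm y \<le> \<rho> ^ 2" unfolding power2_eq_square using \<rho>(2) by linarith
      qed simp
      thus ?thesis using ab by (simp add: norm_mult)
    qed
    hence s: "summable (\<lambda>r. qpoch (q ^ Suc n) q r * euler_coeff r * (a * B * y) ^ r)"
    proof -
      obtain A where A: "A > 0" "\<And>r. norm (qpoch (q ^ Suc n) q r) \<le> A"
        using qpoch_bounded[of "norm (q ^ Suc n)"] by (metis order_refl)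
      have "summable (\<lambda>r. A * (norm (fps_nth (fps_qpoch 1) r) * norm (a * B * y) ^ r))"
        using fps_abs_summable_qpoch[of "norm (a * B * y)" 1]
        unfolding fps_abs_summable_def by (intro summable_mult) simp
      moreover have "norm (qpoch (q ^ Suc n) q r * euler_coeff r * Z ^ r)
          \<le> A * (norm (fps_nth (fps_qpoch 1) r) * norm Z ^ r)" for r Z
        unfolding norm_mult norm_power mult.assoc by (rule mult_mono) (use A in auto)
      ultimately show ?thesis by (rule summable_comparison_test'[where N = 0])
    qed
    have eq: "(a * B) ^ r * (2 * of_real pi * kernel_moment y (moment H y) r n) =
        (2 * of_real pi * moment H y 0 * rogers_szego y n) * (qpoch (q ^ Suc n) q r * euler_coeff r
            * (a * B * y) ^ r)" for r
      unfolding kernel_moment_def moment_rogers_szego[OF nz, of n] power_mult_distrib[of "a * B" y]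
      by (simp only: mult_ac)
    show ?thesis unfolding \<tau>_def eq by (subst suminf_mult[OF s]) (simp only: mult_ac)
  qed
  define c where "c u v = qpoch g q u * inv_qfact u * B ^ u * (qpoch g' q v * inv_qfact v * a ^ v) *
            (rogers_szego y (u + v) * (\<Sum>r. qpoch (q ^ Suc (u + v)) q r * euler_coeff r * (a * B
                * y) ^ r))" for u v
  have wc: "w i * (w' j * \<tau> (i + j)) = (2 * of_real pi * moment H y 0) * c i j" for i j
    unfolding \<tau> c_def w_def w'_def fps_nth_qbinom by (simp add: inv_qfact_def mult_ac)
  have sc: "(\<lambda>(u, v). c u v) summable_on UNIV"
    unfolding c_def by (rule rogers_szego_bilinear_sum(1)[OF nz(1) g k a B])
  define \<Lambda> where "\<Lambda> = 2 * of_real pi * moment H y 0"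
  have sc': "(\<lambda>(u, v). \<Lambda> * c u v) summable_on UNIV"
    using summable_on_cmult_right[OF sc, of \<Lambda>] by (simp add: case_prod_unfold)
  have "(\<Sum>i. w i * (\<Sum>j. w' j * \<tau> (i + j))) = (\<Sum>i. \<Sum>j. \<Lambda> * c i j)"
  proof (rule suminf_cong)
    fix i
    show "w i * (\<Sum>j. w' j * \<tau> (i + j)) = (\<Sum>j. \<Lambda> * c i j)"
    proof (cases "w i = 0")
      case True
      have "\<Lambda> * c i j = 0" for j unfolding \<Lambda>_def wc [symmetric] True by simp
      thus ?thesis unfolding True by (simp only: mult_zero_left suminf_zero)
    next
      case False
      have "summable (\<lambda>j. \<Lambda> * c i j)"
        using summable_on_imp_summable[OF infsum_pair(3)[OF sc', of i]] by (simp only: prod.case)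
      hence "summable (\<lambda>j. w i * (w' j * \<tau> (i + j)))" unfolding wc \<Lambda>_def .
      hence s: "summable (\<lambda>j. w' j * \<tau> (i + j))" using False by (simp add: summable_cmult_iff)
      show ?thesis unfolding suminf_mult[OF s, symmetric] wc \<Lambda>_def ..
    qed
  qed
  also have "\<dots> = infsum (\<lambda>(u, v). \<Lambda> * c u v) UNIV"
    using infsum_nat_pair_eq_suminf[OF sc'] by simp
  also have "\<dots> = \<Lambda> * infsum (\<lambda>(u, v). c u v) UNIV"
    using infsum_cmult_right[OF sc, of \<Lambda>] by (simp add: case_prod_unfold)
  also have "infsum (\<lambda>(u, v). c u v) UNIV = (\<Sum>u. \<Sum>v. c u v)"
    using infsum_nat_pair_eq_suminf[OF sc] by simp
  also have "\<dots> = infsum (rs_phi_term a B g y) UNIV * infsum (rs_phi_term B a g' y) UNIV"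
    unfolding c_def by (rule rogers_szego_bilinear_sum(2)[OF nz(1) g k a B])
  finally show ?thesis
    using int3 unfolding \<Lambda>_def V_def K_def s_def Let_def by simp
qed

text \<open>Signs give \<open>(v\<^sup>2;q\<^sup>2)\<close> and \<open>(qv\<^sup>2;q\<^sup>2)\<close>, the factors of \<open>(v\<^sup>2;q)\<close> with even and odd index.\<close>
lemma four_root_factors:
  assumes "p ^ 2 = q"
  shows "qpoch_inf v q * qpoch_inf (- v) q * (qpoch_inf (p * v) q * qpoch_inf (- (p * v)) q)
      = qpoch_inf (v ^ 2) q"
proof -
  have eq: "qpoch v q n * qpoch (- v) q n * (qpoch (p * v) q n * qpoch (- (p * v)) q n) = qpoch
      (v ^ 2) q (2 * n)" for n
  proof (induction n)
    case (Suc n)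
    have "qpoch (v ^ 2) q (2 * Suc n) = qpoch (v ^ 2) q (2 * n) * ((1 - v ^ 2 * q ^ (2 * n)) * (1
        - v ^ 2 * q ^ Suc (2 * n)))"
      by (simp add: qpoch_Suc)
    also have "(1 - v ^ 2 * q ^ (2 * n)) = (1 - v * q ^ n) * (1 - (- v) * q ^ n)"
      by (simp add: power_mult power2_eq_square algebra_simps power_mult_distrib)
    also have "(1 - v ^ 2 * q ^ Suc (2 * n)) = (1 - p * v * q ^ n) * (1 - (- (p * v)) * q ^ n)"
      by (simp add: power_mult power2_eq_square algebra_simps power_mult_distrib assms [symmetric])
    finally show ?case unfolding Suc [symmetric] qpoch_Suc by (simp only: mult_ac)
  qed simp
  have "(\<lambda>n. qpoch v q n * qpoch (- v) q n * (qpoch (p * v) q n * qpoch (- (p * v)) q n)) \<longlonglongrightarrow>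
     qpoch_inf v q * qpoch_inf (- v) q * (qpoch_inf (p * v) q * qpoch_inf (- (p * v)) q)"
    by (intro tendsto_mult qpoch_tendsto)
  moreover have "(\<lambda>n. qpoch (v ^ 2) q (2 * n)) \<longlonglongrightarrow> qpoch_inf (v ^ 2) q"
    using LIMSEQ_subseq_LIMSEQ[OF qpoch_tendsto, of "\<lambda>n. 2 * n" "v ^ 2"]
    by (simp add: strict_mono_def o_def)
  ultimately show ?thesis unfolding eq using LIMSEQ_unique by blast
qed

text \<open>The same integral with all power series evaluated as products. The condition \<open>gg' = q\<close> is the relation
between the two numerator factors \<open>(gBs)\<close> and \<open>(g'as)\<close> and the quadratic one \<open>(aBs\<^sup>2)\<close>.\<close>
lemma circle_integral_product:
  fixes k :: complex
  assumes nz: "q \<noteq> 0" "H \<noteq> 0" "y \<noteq> 0" "a \<noteq> 0" "B \<noteq> 0" "g \<noteq> 0" and g: "g * g' = q"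
    and k: "1 < norm k" "norm y < norm k" and a: "norm a * norm k < 1" and B: "norm B * norm k < 1"
    and c: "\<And>n. qpoch (g * B) q n \<noteq> 0" and d: "\<And>n. qpoch (g' * a) q n \<noteq> 0"
  shows "((\<lambda>\<psi>. let s = k * cis \<psi> in
            (qpoch_inf (H * s) q * qpoch_inf (q / (H * y) * s) q) *
            (qpoch_inf (q / H * (1 / s)) q / qpoch_inf (1 / s) q * (qpoch_inf (H * y *
                (1 / s)) q / qpoch_inf (y * (1 / s)) q)) *
            ((qpoch_inf (g * B * s) q / qpoch_inf (B * s) q) * ((qpoch_inf (g' * a
                * s) q / qpoch_inf (a * s) q) *
              (qpoch_inf (a * B * s) q / qpoch_inf (a * B * s ^ 2) q * qpoch_inf (a * B * y * s) q))))
          has_integral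
            2 * of_real pi * (qtheta H q * qtheta (H * y) q / qpoch_inf q q) *
              (qpoch_inf (g * B) q / qpoch_inf B q * phi21 a g (g * B) q (B * y) *
               (qpoch_inf (g' * a) q / qpoch_inf a q *
                 (qpoch_inf (B * y) q / qpoch_inf (a * y) q * phi21 a (g' * a / B) (g' * a) q (B
                     * y))))) {-pi..pi}"
proof -
  have g': "g' \<noteq> 0" using g nz by auto
  have a1: "norm a < 1" and B1: "norm B < 1"
    using mult_left_mono[of 1 "norm k" "norm a"] mult_left_mono[of 1 "norm k" "norm B"] k a B
        by simp_all
  have ay: "norm (a * y) < 1" and By: "norm (B * y) < 1"
    using mult_left_mono[of "norm y" "norm k" "norm a"] mult_left_mono[of "norm y" "norm k" "norm B"] k a B
    by (simp_all add: norm_mult)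
  have aBy: "norm (a * B * y) < 1"
  proof -
    have "norm a * norm (B * y) \<le> norm a * 1" using By by (intro mult_left_mono) auto
    thus ?thesis using a1 by (simp add: norm_mult mult.assoc)
  qed
  have BAy: "norm (B * a * y) < 1" using aBy by (simp add: mult_ac)
  have S1: "infsum (rs_phi_term a B g y) UNIV = qpoch_inf (g * B) q / qpoch_inf B q * phi21 a g (g
      * B) q (B * y)"
    by (rule infsum_rs_phi_term[OF k B aBy c])
  have "infsum (rs_phi_term B a g' y) UNIV = qpoch_inf (g' * a) q / qpoch_inf a q * phi21 B g' (g'
      * a) q (a * y)"
    by (rule infsum_rs_phi_term[OF k a BAy d])
  also have "phi21 B g' (g' * a) q (a * y) = qpoch_inf (B * y) q / qpoch_inf (a * y) q * phi21 (g'
      * a / B) a (g' * a) q (B * y)"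
  proof -
    have e: "B * g' / (g' * a) * (a * y) = B * y" "g' * a / g' = a" using nz g' by simp_all
    have "phi21 B g' (g' * a) q (a * y) = qpoch_inf (B * g' / (g' * a) * (a * y)) q / qpoch_inf (a
        * y) q *
       phi21 (g' * a / B) (g' * a / g') (g' * a) q (B * g' / (g' * a) * (a * y))"
      by (rule euler_transformation) (use nz g' d ay By e in auto)
    thus ?thesis unfolding e .
  qed
  also have "phi21 (g' * a / B) a (g' * a) q (B * y) = phi21 a (g' * a / B) (g' * a) q (B * y)"
    by (rule phi21_commute)
  finally have S2: "infsum (rs_phi_term B a g' y) UNIV = qpoch_inf (g' * a) q / qpoch_inf a q *
      (qpoch_inf (B * y) q / qpoch_inf (a * y) q * phi21 a (g' * a / B) (g' * a) q (B * y))" .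
  note I = circle_integral[OF nz(1-3) g k a B, unfolded S1 S2 moment_0[OF nz(1-3)]]
  show ?thesis
  proof (rule has_integral_eq[OF _ I])
    fix \<psi>
    define s where "s = k * cis \<psi>"
    have k0: "norm k > 0" using k by linarith
    have ns: "norm s = norm k" "norm (1 / s) = 1 / norm k" "s \<noteq> 0"
      using k0 by (auto simp: s_def norm_mult norm_divide)
    have s1: "norm (1 / s) < 1" "norm (y * (1 / s)) < 1" "norm (B * s) < 1" "norm (a * s) < 1"
      unfolding norm_mult ns using k a B k0 by (simp_all add: field_simps)
    have s2: "norm (s ^ 2 * (a * B)) < 1"
    proof -
      have "norm (a * s) * norm (B * s) < 1 * 1" by (rule mult_strict_mono') (use s1 in auto)
      thus ?thesis by (simp add: norm_mult power2_eq_square mult_ac)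
    qed
    have tp: "eval_fps (theta_pos H y) s = qpoch_inf (H * s) q * qpoch_inf (q / (H * y) * s) q"
      unfolding theta_pos_def by (simp add: eval_fps_mult_abs fps_abs_summable_qpoch eval_fps_qpoch)
    have tn: "eval_fps (theta_neg H y) (1 / s) =
        qpoch_inf (q / H * (1 / s)) q / qpoch_inf (1 / s) q * (qpoch_inf (H * y *
            (1 / s)) q / qpoch_inf (y * (1 / s)) q)"
    proof -
      have "eval_fps (theta_neg H y) (1 / s) = eval_fps (fps_qbinom (q / H) 1) (1 / s) * eval_fps
          (fps_qbinom H y) (1 / s)"
        unfolding theta_neg_def
        by (intro eval_fps_mult_abs fps_abs_summable_qbinom)
            (use s1 in \<open>auto simp: norm_mult norm_divide\<close>)
      thus ?thesis using eval_fps_qbinom[of 1 "1 / s" "q / H"] eval_fps_qbinom[of y "1 / s" H] s1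
          by simp
    qed
    have kk: "eval_fps (kernel_fps y s) (a * B) =
        qpoch_inf (a * B * s) q / qpoch_inf (a * B * s ^ 2) q * qpoch_inf (a * B * y * s) q"
    proof -
      have "eval_fps (kernel_fps y s) (a * B) = eval_fps (fps_qbinom (1 / s) (s ^ 2)) (a * B)
          * eval_fps (fps_qpoch (y * s)) (a * B)"
        unfolding kernel_fps_def
        by (intro eval_fps_mult_abs fps_abs_summable_qbinom fps_abs_summable_qpoch)
            (use s2 in \<open>auto simp: norm_mult\<close>)
      also have "eval_fps (fps_qbinom (1 / s) (s ^ 2)) (a * B) = qpoch_inf (1 / s * s ^ 2 * (a
          * B)) q / qpoch_inf (s ^ 2 * (a * B)) q"
        by (rule eval_fps_qbinom[OF s2])
      also have "1 / s * s ^ 2 * (a * B) = a * B * s" using ns(3) by (simp add: power2_eq_square)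
      finally show ?thesis by (simp add: eval_fps_qpoch mult_ac)
    qed
    show "(let s = k * cis \<psi> in
            eval_fps (theta_pos H y) s * eval_fps (theta_neg H y) (1 / s) *
              (eval_fps (fps_qbinom g B) s * (eval_fps (fps_qbinom g' a) s * eval_fps
                  (kernel_fps y s) (a * B)))) =
          (let s = k * cis \<psi> in
            (qpoch_inf (H * s) q * qpoch_inf (q / (H * y) * s) q) *
            (qpoch_inf (q / H * (1 / s)) q / qpoch_inf (1 / s) q * (qpoch_inf (H * y *
                (1 / s)) q / qpoch_inf (y * (1 / s)) q)) *
            ((qpoch_inf (g * B * s) q / qpoch_inf (B * s) q) * ((qpoch_inf (g' * a
                * s) q / qpoch_inf (a * s) q) *
              (qpoch_inf (a * B * s) q / qpoch_inf (a * B * s ^ 2) q * qpoch_inf (a * B * y * s) q))))"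
      unfolding Let_def s_def [symmetric] tp tn kk eval_fps_qbinom[OF s1(3)] eval_fps_qbinom[OF s1(4)] ..
  qed
qed

end

theorem theorem8p1:
  fixes q z a b c h :: complex
    and sq sa sb sc sz :: complex
    and \<sigma> :: real
  assumes nonzero: "q \<noteq> 0" "z \<noteq> 0" "a \<noteq> 0" "b \<noteq> 0" "c \<noteq> 0" "h \<noteq> 0"
    and norms: "norm q < 1" "norm z < 1"
    and sqrts: "sq ^ 2 = q" "sa ^ 2 = a" "sb ^ 2 = b" "sc ^ 2 = c" "sz ^ 2 = z"
    and sigma: "\<sigma> > 0"
    and h_generic: "h * (sc / (sb * sz)) \<notin> {q powi k | k :: int. True}"
    and rhs_denominator: "qpochs_inf [q, a, c / b, a * b * z / c] q \<noteq> 0"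
    and series_denominators:
      "c \<notin> {q powi (- int k) | k :: nat. True}"
      "q * a / b \<notin> {q powi (- int k) | k :: nat. True}"
    and modulus_sigma:
      "norm (of_real \<sigma> * (sc / (sb * sz))) < 1"
      "norm (of_real \<sigma> * (sb * sz / sc)) < 1"
    and modulus_gamma:
      "\<forall>\<gamma> \<in> {a * (sb * sz / sc), sc * sz / sb,
              sa * sz, - (sa * sz), sq * sa * sz, - (sq * sa * sz)}. norm \<gamma> / \<sigma> < 1"
  shows
    "((\<lambda>\<psi>. let w = cis \<psi> in
         qpochs_inf
           (scale_list [h * (sc / (sb * sz)), q / h * (sb * sz / sc)] (of_real \<sigma> / w) @
            scale_list [h * (sc / (sb * sz)), q / h * (sb * sz / sc),
                        sb * sc * sz, a * (sc * sz / sb), q * a * (sz / (sb * sc)),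
                        a * (sb * sz ^ 3 / sc)] (w / of_real \<sigma>)) q
         / qpochs_inf
           (scale_list [sc / (sb * sz), sb * sz / sc] (of_real \<sigma> / w) @
            scale_list [a * (sb * sz / sc), sc * sz / sb,
                        sa * sz, - (sa * sz), sq * sa * sz, - (sq * sa * sz)]
                       (w / of_real \<sigma>)) q)
      has_integral
        (2 * of_real pi * qthetas [h, h * (c / (b * z))] q * qpochs_inf [z, c, q * a / b] q
           / qpochs_inf [q, a, c / b, a * b * z / c] q
         * phi21 a b c q z * phi21 a (q * a / c) (q * a / b) q z))
      {-pi..pi}"
proof -
  interpret q_series q by unfold_locales (rule norms(1))
  define X where "X = sc / (sb * sz)"
  define k where "k = 1 / (of_real \<sigma> * X)"
  define y where "y = b * z / c"
  define H where "H = h * (c / (b * z))"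
  define B where "B = c / b"
  have roots: "sq \<noteq> 0" "sa \<noteq> 0" "sb \<noteq> 0" "sc \<noteq> 0" "sz \<noteq> 0"
    using sqrts nonzero by auto
  have X0: "X \<noteq> 0" using roots by (simp add: X_def)
  have X2: "X ^ 2 = c / (b * z)" by (simp add: X_def power_divide power_mult_distrib sqrts)
  have y: "y = 1 / X ^ 2" unfolding X2 y_def by simp
  have invX: "sb * sz / sc = 1 / X" by (simp add: X_def)
  have k0: "k \<noteq> 0" using X0 sigma by (simp add: k_def)
  have nk: "norm k = 1 / (\<sigma> * norm X)" using sigma by (simp add: k_def norm_divide norm_mult)
  have k1: "1 < norm k"
    using modulus_sigma(1) sigma X0 unfolding nk X_def [symmetric] by (simp add: norm_mult)
  have k2: "norm y < norm k"
  proof -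
    have "norm (of_real \<sigma> * (1 / X)) < 1" using modulus_sigma(2) unfolding invX .
    hence "\<sigma> < norm X" using sigma X0 by (simp add: norm_mult norm_divide)
    thus ?thesis unfolding nk y using sigma X0 by
        (simp add: norm_divide norm_mult power2_eq_square field_simps)
  qed
  have ak: "norm a * norm k < 1"
  proof -
    have "norm (a * (1 / X)) / \<sigma> < 1" using modulus_gamma unfolding invX by blast
    thus ?thesis by (simp add: nk norm_divide mult_ac)
  qed
  have BX: "sc * sz / sb = B / X"
    using roots by (simp add: B_def X_def power2_eq_square flip: sqrts)
  have Bk: "norm B * norm k < 1"
  proof -
    have "norm (B / X) / \<sigma> < 1" using modulus_gamma unfolding BX by blast
    thus ?thesis by (simp add: nk norm_divide mult_ac)
  qed
  have nonpole: "qpoch e q n \<noteq> 0" if e: "e \<notin> {q powi (- int k) | k :: nat. True}" for e n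
  proof -
    have "1 - e * q ^ j \<noteq> 0" for j
    proof
      assume "1 - e * q ^ j = 0"
      hence "e = q powi (- int j)" using nonzero(1) by (simp add: power_int_minus field_simps)
      with e show False by blast
    qed
    thus ?thesis unfolding qpoch_def by (subst prod_zero_iff) auto
  qed
  \<comment> \<open>The parameters of the general formula are \<open>g = b\<close> and \<open>g' = q/b\<close>.\<close>
  have gB: "b * B = c" "q / b * a = q * a / b" "B * y = z" "q * a / b / B = q * a / c" "H * y
      = h" "a * y = a * b * z / c"
    using nonzero by (simp_all add: B_def y_def H_def)
  have nzH: "H \<noteq> 0" "y \<noteq> 0" "B \<noteq> 0" using nonzero by (simp_all add: H_def y_def B_def)
  have bq: "b * (q / b) = q" using nonzero by simp
  note I = circle_integral_product[of H y a B b "q / b" k, OF nonzero(1) nzH(1,2) nonzero(3) nzH(3) nonzero(4) bq k1 k2 ak Bk,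
    unfolded gB, OF nonpole[OF series_denominators(1)] nonpole[OF series_denominators(2)]]
  have rhs: "2 * of_real pi * (qtheta H q * qtheta h q / qpoch_inf q q) *
      (qpoch_inf c q / qpoch_inf B q * phi21 a b c q z *
       (qpoch_inf (q * a / b) q / qpoch_inf a q * (qpoch_inf z q / qpoch_inf (a * b * z / c) q
           * phi21 a (q * a / c) (q * a / b) q z)))
    = 2 * of_real pi * qthetas [h, h * (c / (b * z))] q * qpochs_inf [z, c, q * a / b] q
           / qpochs_inf [q, a, c / b, a * b * z / c] q
         * phi21 a b c q z * phi21 a (q * a / c) (q * a / b) q z"
    by (simp add: qthetas_def qpochs_inf_def B_def H_def mult_ac)
  have I': "((\<lambda>\<psi>. let s = k * cis \<psi> in
            (qpoch_inf (H * s) q * qpoch_inf (q / h * s) q) *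
            (qpoch_inf (q / H * (1 / s)) q / qpoch_inf (1 / s) q * (qpoch_inf (h *
                (1 / s)) q / qpoch_inf (y * (1 / s)) q)) *
            ((qpoch_inf (c * s) q / qpoch_inf (B * s) q) * ((qpoch_inf (q * a / b * s) q / qpoch_inf
                (a * s) q) *
              (qpoch_inf (a * B * s) q / qpoch_inf (a * B * s ^ 2) q * qpoch_inf (a * B * y * s) q))))
       has_integral (2 * of_real pi * qthetas [h, h * (c / (b * z))] q * qpochs_inf [z, c, q * a / b] q
           / qpochs_inf [q, a, c / b, a * b * z / c] q
         * phi21 a b c q z * phi21 a (q * a / c) (q * a / b) q z)) {-pi..pi}"
    using I unfolding rhs .
  show ?thesis
  proof (rule has_integral_eq[OF _ I'])
    fix \<psi>
    define s where "s = k * cis \<psi>"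
    have w: "cis \<psi> / of_real \<sigma> = X * s" "of_real \<sigma> / cis \<psi> = 1 / (X * s)"
      using X0 sigma by (simp_all add: s_def k_def)
    have "s \<noteq> 0" using k0 by (simp add: s_def)
    have HX: "H = h * X ^ 2" by (simp add: H_def X2)
    have root_products: "sb * sc * sz * X = c" "q * a * (sz / (sb * sc)) * X = q * a / b"
      "a * (sb * sz ^ 3 / sc) * X = a * B * y"
    proof -
      show "sb * sc * sz * X = c"
        using roots by (simp add: X_def power2_eq_square flip: sqrts(4))
      show "q * a * (sz / (sb * sc)) * X = q * a / b"
        using roots by (simp add: X_def power2_eq_square flip: sqrts(3))
      have "a * (sb * sz ^ 3 / sc) * X = a * sz ^ 2"
        using roots by (simp add: X_def power2_eq_square power3_eq_cube)
      thus "a * (sb * sz ^ 3 / sc) * X = a * B * y" using gB(3) by (simp add: sqrts mult.assoc)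
    qed
    have args: "h * X * (1 / (X * s)) = h * (1 / s)"
      "q / h * (1 / X) * (1 / (X * s)) = q / H * (1 / s)"
      "h * X * (X * s) = H * s"
      "q / h * (1 / X) * (X * s) = q / h * s"
      "sb * sc * sz * (X * s) = c * s"
      "a * (B / X) * (X * s) = a * B * s"
      "q * a * (sz / (sb * sc)) * (X * s) = q * a / b * s"
      "a * (sb * sz ^ 3 / sc) * (X * s) = a * B * y * s"
      "X * (1 / (X * s)) = 1 / s"
      "1 / X * (1 / (X * s)) = y * (1 / s)"
      "a * (1 / X) * (X * s) = a * s"
      "B / X * (X * s) = B * s"
      using X0 nonzero root_products by (simp_all add: HX y power2_eq_square mult.assoc [symmetric])
    have four: "qpoch_inf (sa * sz * (X * s)) q * qpoch_inf (- (sa * sz) * (X * s)) q *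
       (qpoch_inf (sq * sa * sz * (X * s)) q * qpoch_inf (- (sq * sa * sz) * (X * s)) q) = qpoch_inf
           (a * B * s ^ 2) q"
    proof -
      have "(sa * sz * (X * s)) ^ 2 = a * B * s ^ 2"
        using nonzero by (simp add: power_mult_distrib sqrts X2 B_def)
      thus ?thesis using four_root_factors[OF sqrts(1), of "sa * sz * (X * s)"] by (simp add: mult_ac)
    qed
    show "(let s = k * cis \<psi> in
            (qpoch_inf (H * s) q * qpoch_inf (q / h * s) q) *
            (qpoch_inf (q / H * (1 / s)) q / qpoch_inf (1 / s) q * (qpoch_inf (h *
                (1 / s)) q / qpoch_inf (y * (1 / s)) q)) *
            ((qpoch_inf (c * s) q / qpoch_inf (B * s) q) * ((qpoch_inf (q * a / b * s) q / qpoch_inf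
                (a * s) q) *
              (qpoch_inf (a * B * s) q / qpoch_inf (a * B * s ^ 2) q * qpoch_inf (a * B * y * s) q)))) =
      (let w = cis \<psi> in
         qpochs_inf
           (scale_list [h * (sc / (sb * sz)), q / h * (sb * sz / sc)] (of_real \<sigma> / w) @
            scale_list [h * (sc / (sb * sz)), q / h * (sb * sz / sc),
                        sb * sc * sz, a * (sc * sz / sb), q * a * (sz / (sb * sc)),
                        a * (sb * sz ^ 3 / sc)] (w / of_real \<sigma>)) q
         / qpochs_inf
           (scale_list [sc / (sb * sz), sb * sz / sc] (of_real \<sigma> / w) @
            scale_list [a * (sb * sz / sc), sc * sz / sb,
                        sa * sz, - (sa * sz), sq * sa * sz, - (sq * sa * sz)]
                       (w / of_real \<sigma>)) q)"
      unfolding Let_def s_def [symmetric] w invX BX X_def [symmetric] four [symmetric]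
      unfolding qpochs_inf_def scale_list_def list.map append.simps args prod_list.Cons prod_list.Nil
      by (simp add: mult_ac)
  qed
qed

end
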